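(* Let $S$ be a finite set. The map $\delta\colon\mathcal A^w(S)\to\mathcal A^w(S;S)$ is an isomorphism of vector spaces (in general not multiplicative). Its inverse on $D\in\mathcal A^w(S;S)$ is given by the following process: (1) write $D$ with only arrow heads on the head strands and only arrow tails on the tail strands; this produces a well-defined element $D'$ of $\mathcal A^w(hS\sqcup tS)$; (2) stitch all the head-tail pairs of strands in $D'$, putting each head strand ahead of (below) its corresponding tail strand: $\delta^{-1}(D)=\big(\prod_{a\in S}dm^{ha,ta}_a\big)(D')$.
   Context: **The space $\mathcal A^w(S)$.** Everything is over $\mathbb Q$. An arrow diagram on a finite set $S$ consists of vertical upward-oriented strands labelled by $S$ (the skeleton) and a finite directed graph whose univalent vertices (ends) are attached at distinct points of the strands (a source end is a "tail", a sink end is a "head"), whose other vertices are trivalent with two incoming edges and one outgoing edge and with an ordering (left, right) of the incoming edges, and each of whose connected components has at least one end on the skeleton. Its degree is half the total number of vertices (ends and trivalent). A trivalent vertex with left input $p$ and right input $q$ is thought of as outputting the bracket $[p,q]$. $\mathcal A^w(S)$ is the degree completion of the span of arrow diagrams modulo: (AS) exchanging the two inputs of a trivalent vertex negates the diagram; (IHX) the Jacobi identity $[[p,q],r]+[[q,r],p]+[[r,p],q]=0$ applied locally; (STU$_1$) if the heads of edges $p,q$ are adjacent on a strand, ($p$ below $q$) $-$ ($q$ below $p$) $=$ the diagram with a single head there, on the edge output by a new vertex $[p,q]$; (STU$_2$) if the head of an edge $p$ and the tail of an edge $e$ are adjacent on a strand, (head below tail) $-$ (tail below head) $=$ the diagram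 with a single tail there, feeding as the left input of a new vertex whose right input is $p$ and whose output continues along $e$; (TC) adjacent tails on a strand may be exchanged. Multiplication on $\mathcal A^w(S)$ is stacking: $D_1\ast D_2$ is $D_2$ on top of $D_1$. **Operations.** $d\Delta^a_{bc}$ replaces strand $a$ by two parallel strands $b,c$ and sums over all ways of lifting each end on $a$ to $b$ or $c$. $dm^{ab}_c$ stitches strand $a$ to strand $b$, with $a$ before (below) $b$, and calls the resulting strand $c$. **The space $\mathcal A^w(H;T)$.** For finite sets $H$ (head labels) and $T$ (tail labels), possibly overlapping, $\mathcal A^w(H;T)$ is $\mathcal A^w(H\sqcup T)$ (disjoint union made by force; strands from $H$ are head strands, from $T$ tail strands) modulo: a diagram with a tail on a head strand is $0$; (CP) a diagram in which a head is the lowest vertex on some tail strand is $0$. It is isomorphic to the space spanned by diagrams with only heads on head strands and only tails on tail strands, modulo AS, IHX, STU$_1$ and TC (slide heads on tail strands to the bottom using STU$_2$, where they vanish by CP). Multiplication $D_1\#D_2$ on $\mathcal A^w(H;T)$: with $D_1,D_2$ in this form, stitch equally labelled head strands ($D_1$ below $D_2$) and merge all tails on equally labelled tail strands onto one strand. **The map $\delta$.** With $ha$, $ta$ denoting the head and tail copies of the label $a\in S$, and $hS=\{ha\}$, $tS=\{ta\}$, $\delta$ is the composition of the "double every strand" map $\prod_{a\in S}d\Delta^a_{ha,ta}\colon\mathcal A^w(S)\to\mathcal A^w(hS\sqcup tS)$ with the projection $\mathcal A^w(hS\sqcup tS)\to\mathcal A^w(S;S)$. *)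

theory Defs
  imports Complex_Main "HOL-Library.Poly_Mapping"
begin

section \<open>Arrow diagrams\<close>

text \<open>
  Edges are named by natural numbers. A univalent vertex carries exactly one edge, so it is
  recorded as an end of that edge: \<open>Tail e\<close> is the source end of \<open>e\<close>, \<open>Head e\<close> its sink end.
  A strand is the list of its ends, read from bottom to top. A trivalent vertex is recorded as
  the triple (left input, right input, output) of its edges.
\<close>

datatype 'e arrow_end = Head 'e | Tail 'e

datatype 'l diagram =
  Diagram (strand: "'l \<Rightarrow> nat arrow_end list") (trivs: "(nat \<times> nat \<times> nat) set")

definition ends :: "'l diagram \<Rightarrow> nat arrow_end set" where
  "ends D = (\<Union>s. set (strand D s))"

definition tails :: "'l diagram \<Rightarrow> nat set" where
  "tails D = {e. Tail e \<in> ends D}"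

definition heads :: "'l diagram \<Rightarrow> nat set" where
  "heads D = {e. Head e \<in> ends D}"

definition in_edges :: "nat \<times> nat \<times> nat \<Rightarrow> nat set" where
  "in_edges v = (case v of (l, r, u) \<Rightarrow> {l, r})"

definition out_edge :: "nat \<times> nat \<times> nat \<Rightarrow> nat" where
  "out_edge v = (case v of (l, r, u) \<Rightarrow> u)"

definition edges :: "'l diagram \<Rightarrow> nat set" where
  "edges D = tails D \<union> heads D \<union> (\<Union>v\<in>trivs D. insert (out_edge v) (in_edges v))"

definition adjacent :: "'l diagram \<Rightarrow> nat rel" where
  "adjacent D = {(e, e'). \<exists>v\<in>trivs D. {e, e'} \<subseteq> insert (out_edge v) (in_edges v)}"

text \<open>
  The clauses on \<open>tails\<close> and \<open>out_edge\<close> say that every edge has exactly one source (a tail on the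
  skeleton, or a trivalent vertex with that output), those on \<open>heads\<close> and \<open>in_edges\<close> that it has
  exactly one target (a head on the skeleton, or one of the two inputs of a trivalent vertex).
  The final clause says that every connected component of the graph has an end on the skeleton.
\<close>

definition arrow_diagram :: "'l set \<Rightarrow> 'l diagram \<Rightarrow> bool" where
  "arrow_diagram S D \<longleftrightarrow>
     finite (trivs D) \<and>
     (\<forall>s. s \<notin> S \<longrightarrow> strand D s = []) \<and>
     (\<forall>s. distinct (strand D s)) \<and>
     (\<forall>s s'. s \<noteq> s' \<longrightarrow> set (strand D s) \<inter> set (strand D s') = {}) \<and>
     tails D \<inter> out_edge ` trivs D = {} \<and> inj_on out_edge (trivs D) \<and>
     tails D \<union> out_edge ` trivs D = edges D \<and>
     (\<forall>(l, r, u) \<in> trivs D. l \<noteq> r) \<and>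
     heads D \<inter> (\<Union>v\<in>trivs D. in_edges v) = {} \<and>
     (\<forall>v\<in>trivs D. \<forall>w\<in>trivs D. v \<noteq> w \<longrightarrow> in_edges v \<inter> in_edges w = {}) \<and>
     heads D \<union> (\<Union>v\<in>trivs D. in_edges v) = edges D \<and>
     (\<forall>e\<in>edges D. \<exists>e'. (e, e') \<in> (adjacent D)\<^sup>* \<and> e' \<in> tails D \<union> heads D)"

definition degree :: "'l set \<Rightarrow> 'l diagram \<Rightarrow> rat" where
  "degree S D = of_nat ((\<Sum>s\<in>S. length (strand D s)) + card (trivs D)) / 2"

definition diagrams :: "'l set \<Rightarrow> nat \<Rightarrow> 'l diagram set" where
  "diagrams S n = {D. arrow_diagram S D \<and> degree S D = of_nat n}"

lemma degree_eq_card_tails: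
  assumes "finite S" and "arrow_diagram S D"
  shows "degree S D = of_nat (card (tails D))"
proof -
  have ft: "finite (trivs D)" and out: "\<forall>s. s \<notin> S \<longrightarrow> strand D s = []"
    and dist: "\<forall>s. distinct (strand D s)"
    and disj: "\<forall>s s'. s \<noteq> s' \<longrightarrow> set (strand D s) \<inter> set (strand D s') = {}"
    and src1: "tails D \<inter> out_edge ` trivs D = {}" and src2: "inj_on out_edge (trivs D)"
    and src3: "tails D \<union> out_edge ` trivs D = edges D"
    and tgt1: "\<forall>(l, r, u) \<in> trivs D. l \<noteq> r" and tgt2: "heads D \<inter> (\<Union>v\<in>trivs D. in_edges v) = {}"
    and tgt3: "\<forall>v\<in>trivs D. \<forall>w\<in>trivs D. v \<noteq> w \<longrightarrow> in_edges v \<inter> in_edges w = {}"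
    and tgt4: "heads D \<union> (\<Union>v\<in>trivs D. in_edges v) = edges D"
    using assms(2) unfolding arrow_diagram_def by simp_all
  have "s \<in> S" if "x \<in> set (strand D s)" for x s
    using out that by (cases "s \<in> S") auto
  then have E: "ends D = (\<Union>s\<in>S. set (strand D s))" unfolding ends_def by blast
  have fE: "finite (ends D)" using E assms(1) by simp
  have "card (ends D) = (\<Sum>s\<in>S. card (set (strand D s)))"
    unfolding E by (rule card_UN_disjoint) (use assms(1) disj in simp_all)
  also have "\<dots> = (\<Sum>s\<in>S. length (strand D s))"
    using dist by (simp add: distinct_card)
  finally have len: "(\<Sum>s\<in>S. length (strand D s)) = card (ends D)" by simp
  have split: "ends D = Tail ` tails D \<union> Head ` heads D"
  proof (rule set_eqI)
    fix x show "x \<in> ends D \<longleftrightarrow> x \<in> Tail ` tails D \<union> Head ` heads D"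
      by (cases x) (auto simp: tails_def heads_def)
  qed
  have "Tail ` tails D \<subseteq> ends D" "Head ` heads D \<subseteq> ends D" using split by blast+
  then have fT: "finite (tails D)" and fH: "finite (heads D)"
    using fE by (meson finite_subset finite_imageD inj_onI arrow_end.inject)+
  have "card (ends D) = card (Tail ` tails D) + card (Head ` heads D)"
    by (subst split, rule card_Un_disjoint) (use fT fH in auto)
  then have ce: "card (ends D) = card (tails D) + card (heads D)"
    by (simp add: card_image inj_on_def)
  have "card (edges D) = card (tails D) + card (out_edge ` trivs D)"
    unfolding src3[symmetric] by (rule card_Un_disjoint) (use fT ft src1 in simp_all)
  then have c1: "card (edges D) = card (tails D) + card (trivs D)"
    using src2 by (simp add: card_image)
  have fi: "finite (in_edges v)" for v by (cases v) (simp add: in_edges_def)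
  have "card (edges D) = card (heads D) + card (\<Union>v\<in>trivs D. in_edges v)"
    unfolding tgt4[symmetric] by (rule card_Un_disjoint) (use fH ft fi tgt2 in simp_all)
  also have "card (\<Union>v\<in>trivs D. in_edges v) = (\<Sum>v\<in>trivs D. card (in_edges v))"
    by (rule card_UN_disjoint) (use ft fi tgt3 in simp_all)
  also have "\<dots> = (\<Sum>v\<in>trivs D. 2)"
    by (rule sum.cong) (use tgt1 in \<open>auto simp: in_edges_def\<close>)
  finally have "card (edges D) = card (heads D) + 2 * card (trivs D)" by simp
  with c1 ce len have "(\<Sum>s\<in>S. length (strand D s)) + card (trivs D) = 2 * card (tails D)" by simp
  then show ?thesis unfolding degree_def by simp
qed

definition rename :: "(nat \<Rightarrow> nat) \<Rightarrow> 'l diagram \<Rightarrow> 'l diagram" where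
  "rename f D = Diagram (\<lambda>s. map (map_arrow_end f) (strand D s))
                        (map_prod f (map_prod f f) ` trivs D)"


section \<open>Linear combinations and quotients\<close>

definition scale :: "rat \<Rightarrow> ('b \<Rightarrow>\<^sub>0 rat) \<Rightarrow> ('b \<Rightarrow>\<^sub>0 rat)" where
  "scale c f = Poly_Mapping.map ((*) c) f"

lemma lookup_scale [simp]: "Poly_Mapping.lookup (scale c f) x = c * Poly_Mapping.lookup f x"
  by (simp add: scale_def Poly_Mapping.map.rep_eq when_def)

interpretation lc: vector_space "scale :: rat \<Rightarrow> ('b \<Rightarrow>\<^sub>0 rat) \<Rightarrow> ('b \<Rightarrow>\<^sub>0 rat)"
  by unfold_locales (rule poly_mapping_eqI, simp add: lookup_add algebra_simps)+

abbreviation basis :: "'b \<Rightarrow> ('b \<Rightarrow>\<^sub>0 rat)" where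
  "basis b \<equiv> Poly_Mapping.single b 1"

definition lin_ext :: "('b \<Rightarrow> ('c \<Rightarrow>\<^sub>0 rat)) \<Rightarrow> ('b \<Rightarrow>\<^sub>0 rat) \<Rightarrow> ('c \<Rightarrow>\<^sub>0 rat)" where
  "lin_ext \<phi> f = (\<Sum>b\<in>Poly_Mapping.keys f. scale (Poly_Mapping.lookup f b) (\<phi> b))"

definition coset :: "('b \<Rightarrow>\<^sub>0 rat) set \<Rightarrow> ('b \<Rightarrow>\<^sub>0 rat) \<Rightarrow> ('b \<Rightarrow>\<^sub>0 rat) set" where
  "coset R f = {g. g - f \<in> R}"

text \<open>
  The degree completion of a graded quotient is the product over all degrees \<open>n\<close> of the
  quotient spaces \<open>F n / R n\<close>. Operations on it are given by the union, over all representatives,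
  of the resulting cosets; this union is again a coset exactly when the operation does not depend
  on the representatives.
\<close>

definition completed_quotient ::
    "(nat \<Rightarrow> ('b \<Rightarrow>\<^sub>0 rat) set) \<Rightarrow> (nat \<Rightarrow> ('b \<Rightarrow>\<^sub>0 rat) set) \<Rightarrow> (nat \<Rightarrow> ('b \<Rightarrow>\<^sub>0 rat) set) set" where
  "completed_quotient F R = {x. \<forall>n. x n \<in> coset (R n) ` F n}"

definition quot_add where
  "quot_add R x y = (\<lambda>n::nat. \<Union>f\<in>x n. \<Union>g\<in>y n. coset (R n) (f + g))"

definition quot_scale where
  "quot_scale R c x = (\<lambda>n::nat. \<Union>f\<in>x n. coset (R n) (scale c f))"

definition quot_map ::
    "(nat \<Rightarrow> ('c \<Rightarrow>\<^sub>0 rat) set) \<Rightarrow> (('b \<Rightarrow>\<^sub>0 rat) \<Rightarrow> ('c \<Rightarrow>\<^sub>0 rat)) \<Rightarrow>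
     (nat \<Rightarrow> ('b \<Rightarrow>\<^sub>0 rat) set) \<Rightarrow> (nat \<Rightarrow> ('c \<Rightarrow>\<^sub>0 rat) set)" where
  "quot_map R \<phi> x = (\<lambda>n. \<Union>f\<in>x n. coset (R n) (\<phi> f))"

definition vector_space_iso where
  "vector_space_iso A R A' R' h \<longleftrightarrow>
     bij_betw h A A' \<and>
     (\<forall>x\<in>A. \<forall>y\<in>A. h (quot_add R x y) = quot_add R' (h x) (h y)) \<and>
     (\<forall>c. \<forall>x\<in>A. h (quot_scale R c x) = quot_scale R' c (h x))"


section \<open>The space of arrow diagrams on a skeleton\<close>

text \<open>
  Diagrams are considered up to isomorphism, which is imposed by the relation \<open>iso\<close>. In the other
  relations, requiring every occurring diagram to be valid forces the displayed trivalent vertices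
  not to lie in \<open>V\<close> and the edge \<open>m\<close> to be new. Edges leaving the local picture may coincide where
  validity allows it, e.g. \<open>p = e\<close> in \<open>STU2\<close>.
\<close>

inductive_set relators :: "'l set \<Rightarrow> nat \<Rightarrow> ('l diagram \<Rightarrow>\<^sub>0 rat) set"
  for S :: "'l set" and n :: nat where
  iso: "\<lbrakk>D \<in> diagrams S n; inj_on f (edges D)\<rbrakk>
    \<Longrightarrow> basis D - basis (rename f D) \<in> relators S n"
| AS: "\<lbrakk>D = Diagram \<sigma> (insert (p, q, u) V); D' = Diagram \<sigma> (insert (q, p, u) V);
     {D, D'} \<subseteq> diagrams S n\<rbrakk>
    \<Longrightarrow> basis D + basis D' \<in> relators S n"
| IHX: "\<lbrakk>D\<^sub>1 = Diagram \<sigma> ({(p, q, m), (m, r, u)} \<union> V);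
     D\<^sub>2 = Diagram \<sigma> ({(q, r, m), (m, p, u)} \<union> V);
     D\<^sub>3 = Diagram \<sigma> ({(r, p, m), (m, q, u)} \<union> V);
     {D\<^sub>1, D\<^sub>2, D\<^sub>3} \<subseteq> diagrams S n\<rbrakk>
    \<Longrightarrow> basis D\<^sub>1 + basis D\<^sub>2 + basis D\<^sub>3 \<in> relators S n"
| STU1: "\<lbrakk>D\<^sub>1 = Diagram (\<sigma>(s := xs @ [Head p, Head q] @ ys)) V;
     D\<^sub>2 = Diagram (\<sigma>(s := xs @ [Head q, Head p] @ ys)) V;
     D\<^sub>3 = Diagram (\<sigma>(s := xs @ [Head m] @ ys)) (insert (p, q, m) V);
     {D\<^sub>1, D\<^sub>2, D\<^sub>3} \<subseteq> diagrams S n\<rbrakk>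
    \<Longrightarrow> basis D\<^sub>1 - basis D\<^sub>2 - basis D\<^sub>3 \<in> relators S n"
| STU2: "\<lbrakk>D\<^sub>1 = Diagram (\<sigma>(s := xs @ [Head p, Tail e] @ ys)) V;
     D\<^sub>2 = Diagram (\<sigma>(s := xs @ [Tail e, Head p] @ ys)) V;
     D\<^sub>3 = Diagram (\<sigma>(s := xs @ [Tail m] @ ys)) (insert (m, p, e) V);
     {D\<^sub>1, D\<^sub>2, D\<^sub>3} \<subseteq> diagrams S n\<rbrakk>
    \<Longrightarrow> basis D\<^sub>1 - basis D\<^sub>2 - basis D\<^sub>3 \<in> relators S n"
| TC: "\<lbrakk>D = Diagram (\<sigma>(s := xs @ [Tail d, Tail e] @ ys)) V;
     D' = Diagram (\<sigma>(s := xs @ [Tail e, Tail d] @ ys)) V;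
     {D, D'} \<subseteq> diagrams S n\<rbrakk>
    \<Longrightarrow> basis D - basis D' \<in> relators S n"

definition free_space :: "'l set \<Rightarrow> nat \<Rightarrow> ('l diagram \<Rightarrow>\<^sub>0 rat) set" where
  "free_space S n = lc.span (basis ` diagrams S n)"

definition rels :: "'l set \<Rightarrow> nat \<Rightarrow> ('l diagram \<Rightarrow>\<^sub>0 rat) set" where
  "rels S n = lc.span (relators S n)"

definition Aw :: "'l set \<Rightarrow> (nat \<Rightarrow> ('l diagram \<Rightarrow>\<^sub>0 rat) set) set" where
  "Aw S = completed_quotient (free_space S) (rels S)"

definition stack :: "'l diagram \<Rightarrow> 'l diagram \<Rightarrow> 'l diagram" where
  "stack D\<^sub>1 D\<^sub>2 =
     (let E\<^sub>1 = rename (\<lambda>e. 2 * e) D\<^sub>1; E\<^sub>2 = rename (\<lambda>e. 2 * e + 1) D\<^sub>2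
      in Diagram (\<lambda>s. strand E\<^sub>1 s @ strand E\<^sub>2 s) (trivs E\<^sub>1 \<union> trivs E\<^sub>2))"

definition lin_stack ::
    "('l diagram \<Rightarrow>\<^sub>0 rat) \<Rightarrow> ('l diagram \<Rightarrow>\<^sub>0 rat) \<Rightarrow> ('l diagram \<Rightarrow>\<^sub>0 rat)" where
  "lin_stack f g = lin_ext (\<lambda>D\<^sub>1. lin_ext (\<lambda>D\<^sub>2. basis (stack D\<^sub>1 D\<^sub>2)) g) f"

definition Aw_mult where
  "Aw_mult S x y = (\<lambda>n. \<Union>{coset (rels S n) (\<Sum>i\<le>n. lin_stack (f i) (g (n - i))) |f g.
                             (\<forall>i. f i \<in> x i) \<and> (\<forall>i. g i \<in> y i)})"


section \<open>The space with head strands and tail strands\<close>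

text \<open>
  In the label set \<open>H <+> T\<close> the labels \<open>Inl h\<close> are the head strands and \<open>Inr t\<close> the tail strands.
\<close>

inductive_set ht_relators :: "'h set \<Rightarrow> 't set \<Rightarrow> nat \<Rightarrow> (('h + 't) diagram \<Rightarrow>\<^sub>0 rat) set"
  for H :: "'h set" and T :: "'t set" and n :: nat where
  Aw: "r \<in> relators (H <+> T) n \<Longrightarrow> r \<in> ht_relators H T n"
| tail_on_head_strand: "\<lbrakk>D \<in> diagrams (H <+> T) n; Tail e \<in> set (strand D (Inl h))\<rbrakk>
    \<Longrightarrow> basis D \<in> ht_relators H T n"
| CP: "\<lbrakk>D \<in> diagrams (H <+> T) n; strand D (Inr t) = Head e # xs\<rbrakk>
    \<Longrightarrow> basis D \<in> ht_relators H T n"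

definition ht_rels :: "'h set \<Rightarrow> 't set \<Rightarrow> nat \<Rightarrow> (('h + 't) diagram \<Rightarrow>\<^sub>0 rat) set" where
  "ht_rels H T n = lc.span (ht_relators H T n)"

definition Aw_ht :: "'h set \<Rightarrow> 't set \<Rightarrow> (nat \<Rightarrow> (('h + 't) diagram \<Rightarrow>\<^sub>0 rat) set) set" where
  "Aw_ht H T = completed_quotient (free_space (H <+> T)) (ht_rels H T)"

definition ht_proj where
  "ht_proj H T = quot_map (ht_rels H T) id"

definition separated :: "('h + 't) diagram \<Rightarrow> bool" where
  "separated D \<longleftrightarrow> (\<forall>h. set (strand D (Inl h)) \<subseteq> range Head) \<and>
                    (\<forall>t. set (strand D (Inr t)) \<subseteq> range Tail)"

definition separated_space :: "'h set \<Rightarrow> 't set \<Rightarrow> nat \<Rightarrow> (('h + 't) diagram \<Rightarrow>\<^sub>0 rat) set" where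
  "separated_space H T n = lc.span (basis ` {D \<in> diagrams (H <+> T) n. separated D})"

text \<open>
  \<open>y\<close> is the class over the full strands \<open>H <+> T\<close> of some way of writing \<open>x\<close> with only heads on
  the head strands and only tails on the tail strands.
\<close>

definition separated_form where
  "separated_form H T x y \<longleftrightarrow>
     (\<exists>f. \<forall>n. f n \<in> x n \<inter> separated_space H T n \<and> y n = coset (rels (H <+> T) n) (f n))"

text \<open>
  For separated diagrams, merging the tails on equally labelled tail strands may be done in any
  order by \<open>TC\<close>; stacking is one such order, and on head strands it is the required stitching.
\<close>

definition Aw_ht_mult where
  "Aw_ht_mult H T x y =
     (\<lambda>n. \<Union>{coset (ht_rels H T n) (\<Sum>i\<le>n. lin_stack (f i) (g (n - i))) |f g.
               (\<forall>i. f i \<in> x i \<inter> separated_space H T i) \<and>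
               (\<forall>i. g i \<in> y i \<inter> separated_space H T i)})"


section \<open>Doubling and stitching all strands\<close>

text \<open>
  All strands are doubled at once: the strand \<open>a\<close> is replaced by \<open>ha = Inl a\<close> and \<open>ta = Inr a\<close>, and
  \<open>X\<close> is the set of ends that are lifted to the head copies.
\<close>

definition lift_ends :: "nat arrow_end set \<Rightarrow> 'a diagram \<Rightarrow> ('a + 'a) diagram" where
  "lift_ends X D =
     Diagram (case_sum (\<lambda>a. filter (\<lambda>x. x \<in> X) (strand D a))
                       (\<lambda>a. filter (\<lambda>x. x \<notin> X) (strand D a)))
             (trivs D)"

definition double_all :: "'a set \<Rightarrow> (nat \<Rightarrow> ('a diagram \<Rightarrow>\<^sub>0 rat) set) \<Rightarrow>
    (nat \<Rightarrow> (('a + 'a) diagram \<Rightarrow>\<^sub>0 rat) set)" where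
  "double_all S = quot_map (rels (S <+> S)) (lin_ext (\<lambda>D. \<Sum>X\<in>Pow (ends D). basis (lift_ends X D)))"

definition stitch :: "('a + 'a) diagram \<Rightarrow> 'a diagram" where
  "stitch D = Diagram (\<lambda>a. strand D (Inl a) @ strand D (Inr a)) (trivs D)"

definition stitch_all :: "'a set \<Rightarrow> (nat \<Rightarrow> (('a + 'a) diagram \<Rightarrow>\<^sub>0 rat) set) \<Rightarrow>
    (nat \<Rightarrow> ('a diagram \<Rightarrow>\<^sub>0 rat) set)" where
  "stitch_all S = quot_map (rels S) (lin_ext (\<lambda>D. basis (stitch D)))"

definition delta :: "'a set \<Rightarrow> (nat \<Rightarrow> ('a diagram \<Rightarrow>\<^sub>0 rat) set) \<Rightarrow>
    (nat \<Rightarrow> (('a + 'a) diagram \<Rightarrow>\<^sub>0 rat) set)" where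
  "delta S = ht_proj S S \<circ> double_all S"

definition delta_multiplicative :: "'a set \<Rightarrow> bool" where
  "delta_multiplicative S \<longleftrightarrow>
     (\<forall>x\<in>Aw S. \<forall>y\<in>Aw S. delta S (Aw_mult S x y) = Aw_ht_mult S S (delta S x) (delta S y))"

end

theory Submission
  imports Defs
begin

text \<open>
  Membership in a span of relators is tested against weights: a combination lies in the span iff every
  rational function on diagrams that kills the relators kills the combination.

  By \<open>STU2\<close> every diagram can be rewritten so that on each strand all heads lie below all tails. Such a
  diagram is the stitching of a separated one, so separated diagrams span both \<open>Aw S\<close> (after stitching)
  and \<open>Aw_ht S S\<close>, and \<open>delta\<close> undoes stitching on them: in every other lift a tail lands on a head
  strand, or a head is lowest on a tail strand. What remains is that separated diagrams satisfy no more
  relations in \<open>Aw_ht S S\<close> than in \<open>Aw (S <+> S)\<close>. For this, a weight on separated diagrams is extended to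
  all diagrams by sliding the lowest head \<open>p\<close> of a tail strand down to the bottom, where it dies by \<open>CP\<close>; each
  tail \<open>e\<close> it passes contributes minus the diagram in which \<open>p\<close> is attached to \<open>e\<close>. The extension respects
  \<open>STU1\<close> because of \<open>IHX\<close> and \<open>AS\<close>.

  For the failure of multiplicativity take an arrow from strand 0 to strand 1 followed by an arrow from
  strand 1 to strand 0: the head of the second lies above the tail of the first, which produces a tree
  with tails on two different strands, and such a tree is not zero.
\<close>

section \<open>Weights\<close>

text \<open>The hard point is injectivity: a separated combination that dies in \<open>Aw_ht\<close>
  must already die in \<open>Aw (S <+> S)\<close>. The natural proof is a retraction sliding heads
  off the tail strands, but its values live in a quotient, and each slide depends on a strand and on
  a fresh edge name. Dualising makes the target the rationals: the retraction becomes a recursively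
  computed number, and well-definedness a list of identities between numbers. Always taking the
  lowest head keeps the recursion simple: only tails lie below it, so one slide is a finite sum over
  these tails, and each summand has one head less on the tail strands. The identities follow one
  pattern: if the lowest head lies outside the window of a relation, expanding all terms there gives
  relations of the same kind with fewer heads; only a head in the window requires a computation. For
  \<open>STU1\<close> that computation slides two heads: the terms where they meet different tails
  agree in both orders, and those where they meet the same tail form a Jacobi identity.\<close>

definition pairing :: "('b \<Rightarrow> rat) \<Rightarrow> ('b \<Rightarrow>\<^sub>0 rat) \<Rightarrow> rat" where
  "pairing W f = (\<Sum>b\<in>Poly_Mapping.keys f. Poly_Mapping.lookup f b * W b)"

lemma pairing_superset:
  assumes "finite B" "Poly_Mapping.keys f \<subseteq> B"
  shows "pairing W f = (\<Sum>b\<in>B. Poly_Mapping.lookup f b * W b)"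
  unfolding pairing_def by (rule sum.mono_neutral_left) (use assms in \<open>auto simp: in_keys_iff\<close>)

lemma pairing_0 [simp]: "pairing W 0 = 0"
  by (simp add: pairing_def)

lemma pairing_basis [simp]: "pairing W (basis b) = W b"
  by (simp add: pairing_def)

lemma pairing_add [simp]: "pairing W (f + g) = pairing W f + pairing W g"
proof -
  let ?B = "Poly_Mapping.keys f \<union> Poly_Mapping.keys g"
  have "Poly_Mapping.keys (f + g) \<subseteq> ?B" by (rule Poly_Mapping.keys_add)
  then show ?thesis
    by (simp add: pairing_superset[of ?B] lookup_add algebra_simps sum.distrib)
qed

lemma pairing_scale [simp]: "pairing W (scale c f) = c * pairing W f"
proof -
  have "Poly_Mapping.keys (scale c f) \<subseteq> Poly_Mapping.keys f" by (auto simp: in_keys_iff)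
  then show ?thesis
    by (simp add: pairing_superset[of "Poly_Mapping.keys f"] sum_distrib_left mult.assoc)
qed

lemma pairing_uminus [simp]: "pairing W (- f) = - pairing W f"
  using pairing_add[of W f "- f"] by simp

lemma pairing_diff [simp]: "pairing W (f - g) = pairing W f - pairing W g"
  using pairing_add[of W f "- g"] by simp

lemma pairing_sum [simp]: "pairing W (sum g I) = (\<Sum>i\<in>I. pairing W (g i))"
  by (induction I rule: infinite_finite_induct) simp_all

lemma pairing_lin_ext [simp]: "pairing W (lin_ext \<phi> f) = pairing (\<lambda>b. pairing W (\<phi> b)) f"
  by (simp add: lin_ext_def pairing_def[of _ f])

lemma pairing_cong:
  "(\<And>b. b \<in> Poly_Mapping.keys f \<Longrightarrow> W b = W' b) \<Longrightarrow> pairing W f = pairing W' f"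
  unfolding pairing_def by (rule sum.cong) simp_all

lemma lookup_eq_pairing: "Poly_Mapping.lookup f b = pairing (\<lambda>c. if c = b then 1 else 0) f"
  by (simp add: pairing_def if_distrib[of "(*) _"] sum.delta in_keys_iff cong: if_cong)

lemma lc_eq_iff_pairing: "f = g \<longleftrightarrow> (\<forall>W. pairing W f = pairing W g)"
  by (auto intro!: poly_mapping_eqI simp: lookup_eq_pairing)

lemma lin_ext_basis [simp]: "lin_ext \<phi> (basis b) = \<phi> b"
  by (simp add: lc_eq_iff_pairing)

lemma lin_ext_add: "lin_ext \<phi> (f + g) = lin_ext \<phi> f + lin_ext \<phi> g"
  and lin_ext_diff: "lin_ext \<phi> (f - g) = lin_ext \<phi> f - lin_ext \<phi> g"
  and lin_ext_scale: "lin_ext \<phi> (scale c f) = scale c (lin_ext \<phi> f)"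
  by (simp_all add: lc_eq_iff_pairing)

lemma lc_expand: "f = (\<Sum>b\<in>Poly_Mapping.keys f. scale (Poly_Mapping.lookup f b) (basis b))"
  by (simp add: lc_eq_iff_pairing pairing_def[of _ f])

text \<open>If \<open>f\<close> lies outside the span, a maximal independent \<open>B\<close> inside
  \<open>A\<close> together with \<open>f\<close> is still independent, so some linear functional is
  1 at \<open>f\<close> and 0 on \<open>B\<close>, hence on \<open>A\<close>. A functional on the
  free space is the pairing with its values on the basis.\<close>

theorem in_span_iff_pairing:
  "f \<in> lc.span A \<longleftrightarrow> (\<forall>W. (\<forall>a\<in>A. pairing W a = 0) \<longrightarrow> pairing W f = 0)"
proof
  assume "f \<in> lc.span A"
  then show "\<forall>W. (\<forall>a\<in>A. pairing W a = 0) \<longrightarrow> pairing W f = 0"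
    by (induction rule: lc.span_induct_alt) auto
next
  assume *: "\<forall>W. (\<forall>a\<in>A. pairing W a = 0) \<longrightarrow> pairing W f = 0"
  show "f \<in> lc.span A"
  proof (rule ccontr)
    assume f: "f \<notin> lc.span A"
    interpret q: vector_space "(*) :: rat \<Rightarrow> rat \<Rightarrow> rat"
      by unfold_locales (simp_all add: algebra_simps)
    interpret p: vector_space_pair "scale :: rat \<Rightarrow> ('a \<Rightarrow>\<^sub>0 rat) \<Rightarrow> _" "(*) :: rat \<Rightarrow> rat \<Rightarrow> rat"
      by unfold_locales
    obtain B where B: "B \<subseteq> A" "lc.independent B" "A \<subseteq> lc.span B"
      using lc.maximal_independent_subset[of A] by blast
    have fB: "f \<notin> lc.span B" using f B(1) lc.span_mono by blast
    have "lc.independent (insert f B)" using B(2) fB by (simp add: lc.independent_insertI)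
    then obtain g where g: "Vector_Spaces.linear scale (*) g"
      "\<forall>x\<in>insert f B. g x = (if x = f then 1 else 0)"
      using p.linear_independent_extend[of "insert f B" "\<lambda>x. if x = f then 1 else 0"] by blast
    interpret g: Vector_Spaces.linear "scale :: rat \<Rightarrow> ('a \<Rightarrow>\<^sub>0 rat) \<Rightarrow> _" "(*) :: rat \<Rightarrow> rat \<Rightarrow> rat" g
      by (rule g(1))
    have pg: "pairing (\<lambda>b. g (basis b)) h = g h" for h
      using arg_cong[OF lc_expand[of h], of g] by (simp add: pairing_def g.sum g.scale)
    have gB: "g b = 0" if "b \<in> B" for b
    proof -
      have "b \<noteq> f" using that fB lc.span_base by blast
      then show ?thesis using g(2) that by simp
    qed
    have "g a = 0" if "a \<in> lc.span B" for a
      using that by (induction rule: lc.span_induct_alt) (simp_all add: gB g.add g.scale g.zero)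
    then have "\<forall>a\<in>A. pairing (\<lambda>b. g (basis b)) a = 0" using B(3) pg by auto
    then have "pairing (\<lambda>b. g (basis b)) f = 0" using * by blast
    then show False using g(2) pg by simp
  qed
qed

section \<open>Arrow diagrams\<close>

abbreviation spliced ::
    "('l \<Rightarrow> nat arrow_end list) \<Rightarrow> 'l \<Rightarrow> nat arrow_end list \<Rightarrow> nat arrow_end list \<Rightarrow> nat arrow_end list \<Rightarrow>
     (nat \<times> nat \<times> nat) set \<Rightarrow> 'l diagram" where
  "spliced \<sigma> s xs w ys V \<equiv> Diagram (\<sigma>(s := xs @ w @ ys)) V"

lemma tails_cong: "ends D' = ends D \<Longrightarrow> tails D' = tails D"
  and heads_cong: "ends D' = ends D \<Longrightarrow> heads D' = heads D"
  by (simp_all add: tails_def heads_def)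

lemma edges_cong: "ends D' = ends D \<Longrightarrow> trivs D' = trivs D \<Longrightarrow> edges D' = edges D"
  by (simp add: edges_def tails_def heads_def)

text \<open>Orientation, trivalence and connectedness depend on the strands only through the set of
  all ends, so moving ends along or between strands leaves just the three conditions on strands to
  check. Doubling, stitching and permuting are all of this kind.\<close>

lemma arrow_diagram_redistribute:
  assumes "arrow_diagram S D" "ends D' = ends D" "trivs D' = trivs D"
    and "\<And>s. s \<notin> S' \<Longrightarrow> strand D' s = []" "\<And>s. distinct (strand D' s)"
    and "\<And>s s'. s \<noteq> s' \<Longrightarrow> set (strand D' s) \<inter> set (strand D' s') = {}"
  shows "arrow_diagram S' D'"
  using assms(1) assms(4-6)
  unfolding arrow_diagram_def adjacent_def edges_cong[OF assms(2,3)] tails_cong[OF assms(2)]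
    heads_cong[OF assms(2)] assms(3)
  by simp

lemma diagrams_iff:
  "finite S \<Longrightarrow> D \<in> diagrams S n \<longleftrightarrow> arrow_diagram S D \<and> card (tails D) = n"
  by (auto simp: diagrams_def degree_eq_card_tails)

lemma diagrams_redistribute:
  assumes "finite S" "finite S'" "D \<in> diagrams S n" "ends D' = ends D" "trivs D' = trivs D"
    and "\<And>s. s \<notin> S' \<Longrightarrow> strand D' s = []" "\<And>s. distinct (strand D' s)"
    and "\<And>s s'. s \<noteq> s' \<Longrightarrow> set (strand D' s) \<inter> set (strand D' s') = {}"
  shows "D' \<in> diagrams S' n"
  using assms arrow_diagram_redistribute[of S D D' S'] tails_cong[of D' D]
  by (simp add: diagrams_iff)

lemma distinct_strand: "D \<in> diagrams S n \<Longrightarrow> distinct (strand D s)"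
  and disjoint_strands:
    "D \<in> diagrams S n \<Longrightarrow> x \<in> set (strand D s) \<Longrightarrow> x \<in> set (strand D s') \<Longrightarrow> s = s'"
  and strand_outside: "D \<in> diagrams S n \<Longrightarrow> s \<notin> S \<Longrightarrow> strand D s = []"
proof -
  assume "D \<in> diagrams S n"
  then have *: "\<forall>s. s \<notin> S \<longrightarrow> strand D s = []" "\<forall>s. distinct (strand D s)"
    "\<forall>s s'. s \<noteq> s' \<longrightarrow> set (strand D s) \<inter> set (strand D s') = {}"
    by (simp_all add: diagrams_def arrow_diagram_def)
  then show "distinct (strand D s)" "s \<notin> S \<Longrightarrow> strand D s = []" by simp_all
  show "x \<in> set (strand D s) \<Longrightarrow> x \<in> set (strand D s') \<Longrightarrow> s = s'" using *(3) by blast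
qed

lemma finite_ends:
  assumes "finite S" "D \<in> diagrams S n"
  shows "finite (ends D)"
proof -
  have "ends D \<subseteq> (\<Union>s\<in>S. set (strand D s))"
    using strand_outside[OF assms(2)] unfolding ends_def by fastforce
  then show ?thesis using assms(1) by (meson finite_UN finite_subset List.finite_set)
qed

lemma finite_edges:
  assumes "finite S" "D \<in> diagrams S n"
  shows "finite (edges D)"
proof -
  have *: "tails D \<union> out_edge ` trivs D = edges D" "finite (trivs D)"
    using assms(2) by (auto simp: diagrams_def arrow_diagram_def)
  have "Tail ` tails D \<subseteq> ends D" by (auto simp: tails_def)
  then have "finite (tails D)"
    using finite_ends[OF assms] by (meson finite_subset finite_imageD inj_onI arrow_end.inject)
  then show ?thesis using * by (metis finite_Un finite_imageI)
qed

lemma exists_fresh_edge: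
  assumes "finite S" "D \<in> diagrams S n" "finite B"
  shows "\<exists>m. m \<notin> edges D \<and> m \<notin> B"
  using ex_new_if_finite[of "edges D \<union> B"] finite_edges[OF assms(1,2)] assms(3) by auto

lemma lift_ends_in_diagrams:
  assumes "finite S" "D \<in> diagrams S n"
  shows "lift_ends X D \<in> diagrams (S <+> S) n"
proof (rule diagrams_redistribute[OF assms(1) _ assms(2)])
  show "finite (S <+> S)" using assms(1) by simp
  show "ends (lift_ends X D) = ends D"
    by (auto simp: ends_def lift_ends_def UNIV_sum image_Un image_image)
  show "strand (lift_ends X D) s = []" if "s \<notin> S <+> S" for s
    using that strand_outside[OF assms(2)]
    by (cases s) (simp_all add: lift_ends_def Plus_def image_iff)
  show "distinct (strand (lift_ends X D) s)" for s
    using distinct_strand[OF assms(2)] by (cases s) (auto simp: lift_ends_def)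
  show "set (strand (lift_ends X D) s) \<inter> set (strand (lift_ends X D) s') = {}" if "s \<noteq> s'" for s s'
    using that disjoint_strands[OF assms(2)]
    by (cases s; cases s') (auto simp: lift_ends_def)
qed (simp add: lift_ends_def)

lemma ends_stitch: "ends (stitch D) = ends D"
proof -
  have "(\<Union>s. set (strand D s)) = (\<Union>a. set (strand D (Inl a))) \<union> (\<Union>a. set (strand D (Inr a)))"
    by (simp add: UNIV_sum image_Un image_image)
  then show ?thesis by (auto simp: ends_def stitch_def)
qed

lemma trivs_stitch [simp]: "trivs (stitch D) = trivs D"
  by (simp add: stitch_def)

lemma stitch_in_diagrams:
  assumes "finite S" "D \<in> diagrams (S <+> S) n"
  shows "stitch D \<in> diagrams S n"
proof (rule diagrams_redistribute[OF _ assms(1) assms(2)])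
  show "finite (S <+> S)" using assms(1) by simp
  show "strand (stitch D) s = []" if "s \<notin> S" for s
    using that strand_outside[OF assms(2)] by (auto simp: stitch_def)
  show "distinct (strand (stitch D) s)" for s
    using distinct_strand[OF assms(2)] disjoint_strands[OF assms(2), of _ "Inl s" "Inr s"]
    by (auto simp: stitch_def)
  show "set (strand (stitch D) s) \<inter> set (strand (stitch D) s') = {}" if "s \<noteq> s'" for s s'
    using that disjoint_strands[OF assms(2)] by (fastforce simp: stitch_def)
qed (simp_all add: ends_stitch)

lemma permute_in_diagrams:
  assumes "finite S" "Diagram (\<sigma>(s := L)) V \<in> diagrams S n" "set L' = set L" "distinct L'"
  shows "Diagram (\<sigma>(s := L')) V \<in> diagrams S n"
proof (rule diagrams_redistribute[OF assms(1,1,2)])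
  show "ends (Diagram (\<sigma>(s := L')) V) = ends (Diagram (\<sigma>(s := L)) V)"
    unfolding ends_def by (rule arg_cong[of _ _ Union], rule image_cong) (simp_all add: assms(3))
  show "strand (Diagram (\<sigma>(s := L')) V) r = []" if "r \<notin> S" for r
    using that strand_outside[OF assms(2), of r] assms(3) by (auto split: if_splits)
  show "distinct (strand (Diagram (\<sigma>(s := L')) V) r)" for r
    using distinct_strand[OF assms(2), of r] assms(4) by (auto split: if_splits)
  show "set (strand (Diagram (\<sigma>(s := L')) V) r) \<inter> set (strand (Diagram (\<sigma>(s := L')) V) r') = {}"
    if "r \<noteq> r'" for r r'
    using that disjoint_strands[OF assms(2), of _ r r'] assms(3) by (auto split: if_splits)
qed simp

text \<open>\<open>AS\<close> demands that both diagrams be valid, so the flipped one has to be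
  supplied. If \<open>(p, q, u)\<close> were also in \<open>V\<close>, the insertion would add a
  second vertex with output \<open>u\<close> instead of flipping one.\<close>

lemma flip_in_diagrams:
  assumes "finite S" "Diagram \<sigma> (insert (p, q, u) V) \<in> diagrams S n" "(p, q, u) \<notin> V"
  shows "Diagram \<sigma> (insert (q, p, u) V) \<in> diagrams S n"
proof -
  let ?D = "Diagram \<sigma> (insert (p, q, u) V)" and ?D' = "Diagram \<sigma> (insert (q, p, u) V)"
  have e: "ends ?D' = ends ?D" by (simp add: ends_def)
  have t: "tails ?D' = tails ?D" "heads ?D' = heads ?D"
    by (rule tails_cong[OF e], rule heads_cong[OF e])
  have ed: "edges ?D' = edges ?D"
    unfolding edges_def t by (auto simp: in_edges_def out_edge_def)
  have ad: "adjacent ?D' = adjacent ?D"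
    by (auto simp: adjacent_def in_edges_def out_edge_def)
  have out: "out_edge ` insert (q, p, u) V = out_edge ` insert (p, q, u) V"
    by (auto simp: out_edge_def)
  have inn: "(\<Union>v\<in>insert (q, p, u) V. in_edges v) = (\<Union>v\<in>insert (p, q, u) V. in_edges v)"
    by (auto simp: in_edges_def)
  have A: "arrow_diagram S ?D" and c: "card (tails ?D) = n"
    using assms(1,2) by (simp_all add: diagrams_iff)
  have inj: "inj_on out_edge (insert (p, q, u) V)" and ne: "p \<noteq> q"
    and dj: "\<forall>v\<in>insert (p, q, u) V. \<forall>w\<in>insert (p, q, u) V. v \<noteq> w \<longrightarrow> in_edges v \<inter> in_edges w = {}"
    using A by (auto simp: arrow_diagram_def)
  have nV: "(q, p, u) \<notin> V"
    using inj ne by (auto simp: inj_on_def out_edge_def)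
  have inj': "inj_on out_edge (insert (q, p, u) V)"
    using inj assms(3) nV by (auto simp: out_edge_def)
  have dj': "in_edges v \<inter> in_edges w = {}"
    if "v \<in> insert (q, p, u) V" "w \<in> insert (q, p, u) V" "v \<noteq> w" for v w
  proof -
    \<comment> \<open>\<open>g\<close> undoes the flip; it preserves the inputs of a vertex and
      keeps distinct vertices distinct, which transfers disjointness from the original
      diagram.\<close>
    define g where "g = (\<lambda>v. if v = (q, p, u) then (p, q, u) else v)"
    have "in_edges (g v) = in_edges v" for v by (auto simp: g_def in_edges_def)
    moreover have "g v \<noteq> g w" using that assms(3) by (auto simp: g_def)
    moreover have "g v \<in> insert (p, q, u) V" "g w \<in> insert (p, q, u) V"
      using that by (auto simp: g_def)
    ultimately show ?thesis using dj by metis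
  qed
  have "arrow_diagram S ?D'"
    using A inj' dj' ne unfolding arrow_diagram_def t ed ad out inn diagram.sel by auto
  then show ?thesis using assms(1) c t by (simp add: diagrams_iff)
qed

section \<open>Attaching a head to a tail\<close>

text \<open>
  \<open>attach m p e D\<close> is the third diagram of \<open>STU2\<close>, except that the head of \<open>p\<close> and the tail of \<open>e\<close> need not
  be adjacent in \<open>D\<close>.
\<close>

definition attach_list :: "nat \<Rightarrow> nat \<Rightarrow> nat \<Rightarrow> nat arrow_end list \<Rightarrow> nat arrow_end list" where
  "attach_list m p e L = map (\<lambda>x. if x = Tail e then Tail m else x) (filter (\<lambda>x. x \<noteq> Head p) L)"

definition attach :: "nat \<Rightarrow> nat \<Rightarrow> nat \<Rightarrow> 'l diagram \<Rightarrow> 'l diagram" where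
  "attach m p e D = Diagram (\<lambda>s. attach_list m p e (strand D s)) (insert (m, p, e) (trivs D))"

lemma attach_list_simps [simp]:
  "attach_list m p e [] = []"
  "attach_list m p e (Head q # L) = (if q = p then [] else [Head q]) @ attach_list m p e L"
  "attach_list m p e (Tail d # L) = Tail (if d = e then m else d) # attach_list m p e L"
  "attach_list m p e (L @ L') = attach_list m p e L @ attach_list m p e L'"
  by (simp_all add: attach_list_def)

lemma attach_list_map_Tail [simp]:
  "attach_list m p e (map Tail ts) = map Tail (map (id(e := m)) ts)"
  by (induction ts) simp_all

lemma attach_list_id: "Tail e \<notin> set L \<Longrightarrow> Head p \<notin> set L \<Longrightarrow> attach_list m p e L = L"
  by (induction L) (auto simp: attach_list_def)

lemma set_attach_list:
  "set (attach_list m p e L) =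
    (set L - {Head p, Tail e}) \<union> (if Tail e \<in> set L then {Tail m} else {})"
  by (auto simp: attach_list_def)

lemma attach_sel [simp]:
  "strand (attach m p e D) s = attach_list m p e (strand D s)"
  "trivs (attach m p e D) = insert (m, p, e) (trivs D)"
  by (simp_all add: attach_def)

lemma attach_Diagram_upd:
  "attach m p e (Diagram (\<sigma>(s := L)) V) =
    Diagram ((\<lambda>r. attach_list m p e (\<sigma> r))(s := attach_list m p e L)) (insert (m, p, e) V)"
  by (auto simp: attach_def)

lemma attach_list_commute:
  assumes "e \<noteq> e'" "m \<noteq> e'" "m' \<noteq> e"
  shows "attach_list m p e (attach_list m' p' e' L) = attach_list m' p' e' (attach_list m p e L)"
  using assms by (induction L) (auto simp: attach_list_def)

lemma attach_commute:
  assumes "e \<noteq> e'" "m \<noteq> e'" "m' \<noteq> e"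
  shows "attach m p e (attach m' p' e' D) = attach m' p' e' (attach m p e D)"
  using assms by (simp add: attach_def attach_list_commute insert_commute)

lemma edge_of_end:
  "Tail e \<in> set (strand D s) \<Longrightarrow> e \<in> edges D" "Head e \<in> set (strand D s) \<Longrightarrow> e \<in> edges D"
  "Tail e \<in> ends D \<Longrightarrow> e \<in> edges D" "Head e \<in> ends D \<Longrightarrow> e \<in> edges D"
  by (auto simp: edges_def tails_def heads_def ends_def)

lemma edge_of_triv:
  assumes "(l, r, u) \<in> trivs D"
  shows "l \<in> edges D" "r \<in> edges D" "u \<in> edges D"
proof -
  have "insert (out_edge (l, r, u)) (in_edges (l, r, u)) \<subseteq> edges D"
    using assms by (auto simp: edges_def)
  then show "l \<in> edges D" "r \<in> edges D" "u \<in> edges D"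
    by (auto simp: in_edges_def out_edge_def)
qed

lemma ends_attach:
  assumes "Tail e \<in> ends D"
  shows "ends (attach m p e D) = insert (Tail m) (ends D - {Head p, Tail e})"
  using assms by (auto simp: ends_def set_attach_list split: if_splits)

lemma edges_attach:
  assumes "Tail e \<in> ends D" "Head p \<in> ends D"
  shows "edges (attach m p e D) = insert m (edges D)"
proof -
  have t: "tails (attach m p e D) = insert m (tails D - {e})"
    and h: "heads (attach m p e D) = heads D - {p}"
    by (auto simp: tails_def heads_def ends_attach[OF assms(1)])
  have "e \<in> tails D" "p \<in> heads D" using assms by (auto simp: tails_def heads_def)
  then show ?thesis
    unfolding edges_def t h attach_sel by (auto simp: in_edges_def out_edge_def)
qed

text \<open>The tail end of \<open>e\<close> and the head end of \<open>p\<close> give way to the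
  new vertex, which becomes the source of \<open>e\<close> and the target of \<open>p\<close>; the
  new edge \<open>m\<close> has its own tail and ends in that vertex. Replacing
  \<open>Tail e\<close> by \<open>Tail m\<close> keeps the number of tails, hence the
  degree.\<close>

lemma attach_in_diagrams:
  assumes S: "finite S" and D: "D \<in> diagrams S n"
    and e: "Tail e \<in> ends D" and p: "Head p \<in> ends D" and m: "m \<notin> edges D"
  shows "attach m p e D \<in> diagrams S n"
proof -
  let ?A = "attach m p e D"
  have t: "tails ?A = insert m (tails D - {e})"
    and h: "heads ?A = heads D - {p}"
    by (auto simp: tails_def heads_def ends_attach[OF e])
  have ed: "edges ?A = insert m (edges D)" by (rule edges_attach[OF e p])
  have et: "e \<in> tails D" and ph: "p \<in> heads D" using e p by (auto simp: tails_def heads_def)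
  have "arrow_diagram S D" using D by (simp add: diagrams_def)
  then have 1: "finite (trivs D)" and src: "tails D \<inter> out_edge ` trivs D = {}"
    and inj: "inj_on out_edge (trivs D)" and srcs: "tails D \<union> out_edge ` trivs D = edges D"
    and lr: "\<forall>(l, r, u) \<in> trivs D. l \<noteq> r"
    and tgt: "heads D \<inter> (\<Union>v\<in>trivs D. in_edges v) = {}"
    and dj: "\<forall>v\<in>trivs D. \<forall>w\<in>trivs D. v \<noteq> w \<longrightarrow> in_edges v \<inter> in_edges w = {}"
    and tgts: "heads D \<union> (\<Union>v\<in>trivs D. in_edges v) = edges D"
    and conn: "\<forall>x\<in>edges D. \<exists>e'. (x, e') \<in> (adjacent D)\<^sup>* \<and> e' \<in> tails D \<union> heads D"
    unfolding arrow_diagram_def by simp_all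
  have pe: "p \<in> edges D" "e \<in> edges D" using e p by (auto intro: edge_of_end(3,4))
  have mt: "m \<notin> tails D" "m \<notin> out_edge ` trivs D" "m \<notin> heads D" "m \<notin> (\<Union>v\<in>trivs D. in_edges v)"
    using m srcs tgts by blast+
  have eo: "e \<notin> out_edge ` trivs D" and pi: "p \<notin> (\<Union>v\<in>trivs D. in_edges v)"
    using src tgt et ph by blast+
  have [simp]: "out_edge (m, p, e) = e" "in_edges (m, p, e) = {m, p}"
    by (auto simp: in_edges_def out_edge_def)
  have "strand ?A s = []" if "s \<notin> S" for s
    using strand_outside[OF D that] by simp
  moreover have "distinct (strand ?A s)" for s
  proof -
    have "Tail m \<notin> set (strand D s)" using m edge_of_end(1) by metis
    then have "inj_on (\<lambda>x. if x = Tail e then Tail m else x) (set (strand D s))"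
      by (auto simp: inj_on_def)
    then show ?thesis
      using distinct_strand[OF D, of s]
      by (auto simp: attach_list_def distinct_map intro: inj_on_subset)
  qed
  moreover have "set (strand ?A s) \<inter> set (strand ?A s') = {}" if "s \<noteq> s'" for s s'
  proof -
    have "Tail m \<notin> set (strand D s)" "Tail m \<notin> set (strand D s')" using m edge_of_end(1) by metis+
    then show ?thesis
      using that disjoint_strands[OF D, of _ s s'] by (auto simp: set_attach_list)
  qed
  moreover have "tails ?A \<inter> out_edge ` trivs ?A = {}"
    using src mt pe m unfolding t by auto
  moreover have "inj_on out_edge (trivs ?A)"
    using inj eo by auto
  moreover have "tails ?A \<union> out_edge ` trivs ?A = edges ?A"
    using srcs et unfolding t ed by auto
  moreover have "\<forall>(l, r, u) \<in> trivs ?A. l \<noteq> r"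
    using lr pe m by auto
  moreover have "heads ?A \<inter> (\<Union>v\<in>trivs ?A. in_edges v) = {}"
    using tgt mt unfolding h by auto
  moreover have "\<forall>v\<in>trivs ?A. \<forall>w\<in>trivs ?A. v \<noteq> w \<longrightarrow> in_edges v \<inter> in_edges w = {}"
    using dj mt(4) pi by auto
  moreover have "heads ?A \<union> (\<Union>v\<in>trivs ?A. in_edges v) = edges ?A"
    using tgts ph unfolding h ed by auto
  moreover have "\<exists>e'. (x, e') \<in> (adjacent ?A)\<^sup>* \<and> e' \<in> tails ?A \<union> heads ?A" if xA: "x \<in> edges ?A" for x
  proof (cases "x = m")
    case True
    then show ?thesis using t by blast
  next
    case False
    then obtain e' where e': "(x, e') \<in> (adjacent D)\<^sup>*" "e' \<in> tails D \<union> heads D"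
      using xA conn ed by auto
    have "adjacent D \<subseteq> adjacent ?A" by (auto simp: adjacent_def)
    then have x: "(x, e') \<in> (adjacent ?A)\<^sup>*" using e'(1) rtrancl_mono by blast
    \<comment> \<open>A path in \<open>D\<close> may stop at an end that has been removed; then its
      last edge is \<open>e\<close> or \<open>p\<close>, and one more step leads to
      \<open>m\<close>, which has a tail.\<close>
    show ?thesis
    proof (cases "e' \<in> {e, p}")
      case True
      then have "(e', m) \<in> adjacent ?A" by (auto simp: adjacent_def)
      with x have "(x, m) \<in> (adjacent ?A)\<^sup>*" by (rule rtrancl_into_rtrancl)
      then show ?thesis using t by blast
    next
      case False
      then show ?thesis using x e'(2) t h by blast
    qed
  qed
  ultimately have "arrow_diagram S ?A"
    using 1 unfolding arrow_diagram_def by simp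
  moreover have "card (tails ?A) = card (tails D)"
  proof -
    have "finite (tails D)"
      using finite_edges[OF S D] srcs by (metis finite_Un)
    then show ?thesis using et mt(1) card_gt_0_iff[of "tails D"] by (auto simp: t card_Diff_singleton)
  qed
  ultimately show ?thesis using D S by (simp add: diagrams_iff)
qed

lemma rename_cong:
  assumes "\<And>x. x \<in> edges D \<Longrightarrow> f x = g x"
  shows "rename f D = rename g D"
proof -
  have "map_arrow_end f x = map_arrow_end g x" if "x \<in> set (strand D s)" for x s
    by (cases x) (use that in \<open>simp_all add: assms edge_of_end(1,2)[of _ D s]\<close>)
  moreover have "map_prod f (map_prod f f) v = map_prod g (map_prod g g) v" if "v \<in> trivs D" for v
    using edge_of_triv[of "fst v" "fst (snd v)" "snd (snd v)" D] that by (simp add: prod_eq_iff assms)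
  ultimately show ?thesis
    unfolding rename_def by (auto intro!: image_cong ext)
qed

lemma rename_id_on:
  assumes "\<And>x. x \<in> edges D \<Longrightarrow> f x = x"
  shows "rename f D = D"
proof -
  have "rename f D = rename id D" using assms by (intro rename_cong) simp
  also have "\<dots> = D"
    by (cases D) (simp add: rename_def arrow_end.map_id0 map_prod.id flip: id_def)
  finally show ?thesis .
qed

lemma strand_rename [simp]: "strand (rename f D) s = map (map_arrow_end f) (strand D s)"
  and trivs_rename: "trivs (rename f D) = map_prod f (map_prod f f) ` trivs D"
  by (simp_all add: rename_def)

lemma rename_attach:
  assumes "inj_on f (edges D)" "Tail e \<in> ends D" "Head p \<in> ends D"
  shows "rename f (attach m p e D) = attach (f m) (f p) (f e) (rename f D)"
proof -
  have "map (map_arrow_end f) (attach_list m p e L) =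
      attach_list (f m) (f p) (f e) (map (map_arrow_end f) L)"
    if "set L \<subseteq> ends D" for L
    using that
  proof (induction L)
    case (Cons x L)
    have "f y = f p \<longleftrightarrow> y = p" "f y = f e \<longleftrightarrow> y = e" if "y \<in> edges D" for y
      using assms(1) that edge_of_end(3)[OF assms(2)] edge_of_end(4)[OF assms(3)]
      by (auto dest: inj_onD)
    with Cons show ?case by (cases x) (auto dest: edge_of_end(3,4))
  qed simp
  moreover have "set (strand D s) \<subseteq> ends D" for s by (auto simp: ends_def)
  ultimately show ?thesis by (simp add: attach_def rename_def)
qed

text \<open>Every end occurs once in a diagram, so the substitution is invisible outside the window,
  and both orders of the two ends lead to the third diagram of \<open>STU2\<close>.\<close>

lemma attach_local:
  assumes D: "Diagram (\<sigma>(s := L)) V \<in> diagrams S n" and L: "L = xs @ w @ ys"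
    and w: "w = [Tail e, Head p] \<or> w = [Head p, Tail e]"
  shows "attach m p e (Diagram (\<sigma>(s := L)) V) =
    spliced \<sigma> s xs [Tail m] ys (insert (m, p, e) V)"
proof -
  have "distinct L" using distinct_strand[OF D, of s] by simp
  then have x: "attach_list m p e xs = xs" "attach_list m p e ys = ys"
    using L w by (auto intro!: attach_list_id)
  have "attach_list m p e (\<sigma> r) = \<sigma> r" if "r \<noteq> s" for r
    by (rule attach_list_id; use disjoint_strands[OF D, of _ r s] that L w in fastforce)
  then have "(\<lambda>r. attach_list m p e (\<sigma> r))(s := K) = \<sigma>(s := K)" for K by auto
  then show ?thesis using L w x by (auto simp: attach_Diagram_upd)
qed

section \<open>Extending weights of separated diagrams\<close>

text \<open>The \<open>STU2\<close> clause may also use that its first diagram occurs in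
  \<open>r\<close>: when all diagrams of \<open>r\<close> are separated, this excludes the clause
  altogether.\<close>

lemma pairing_relator_zero:
  assumes "r \<in> relators S n"
    and "\<And>D f. D \<in> diagrams S n \<Longrightarrow> inj_on f (edges D) \<Longrightarrow> W (rename f D) = W D"
    and "\<And>\<sigma> p q u V. Diagram \<sigma> (insert (p, q, u) V) \<in> diagrams S n \<Longrightarrow>
      Diagram \<sigma> (insert (q, p, u) V) \<in> diagrams S n \<Longrightarrow>
      W (Diagram \<sigma> (insert (p, q, u) V)) + W (Diagram \<sigma> (insert (q, p, u) V)) = 0"
    and "\<And>\<sigma> p q m r u V. Diagram \<sigma> ({(p, q, m), (m, r, u)} \<union> V) \<in> diagrams S n \<Longrightarrow>
      Diagram \<sigma> ({(q, r, m), (m, p, u)} \<union> V) \<in> diagrams S n \<Longrightarrow>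
      Diagram \<sigma> ({(r, p, m), (m, q, u)} \<union> V) \<in> diagrams S n \<Longrightarrow>
      W (Diagram \<sigma> ({(p, q, m), (m, r, u)} \<union> V)) + W (Diagram \<sigma> ({(q, r, m), (m, p, u)} \<union> V)) +
      W (Diagram \<sigma> ({(r, p, m), (m, q, u)} \<union> V)) = 0"
    and "\<And>\<sigma> s xs p q ys V m. spliced \<sigma> s xs [Head p, Head q] ys V \<in> diagrams S n \<Longrightarrow>
      spliced \<sigma> s xs [Head q, Head p] ys V \<in> diagrams S n \<Longrightarrow>
      spliced \<sigma> s xs [Head m] ys (insert (p, q, m) V) \<in> diagrams S n \<Longrightarrow>
      W (spliced \<sigma> s xs [Head p, Head q] ys V) - W (spliced \<sigma> s xs [Head q, Head p] ys V)
      - W (spliced \<sigma> s xs [Head m] ys (insert (p, q, m) V)) = 0"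
    and "\<And>\<sigma> s xs p e ys V m. spliced \<sigma> s xs [Head p, Tail e] ys V \<in> Poly_Mapping.keys r \<Longrightarrow>
      spliced \<sigma> s xs [Head p, Tail e] ys V \<in> diagrams S n \<Longrightarrow>
      spliced \<sigma> s xs [Tail e, Head p] ys V \<in> diagrams S n \<Longrightarrow>
      spliced \<sigma> s xs [Tail m] ys (insert (m, p, e) V) \<in> diagrams S n \<Longrightarrow>
      W (spliced \<sigma> s xs [Head p, Tail e] ys V) - W (spliced \<sigma> s xs [Tail e, Head p] ys V)
      - W (spliced \<sigma> s xs [Tail m] ys (insert (m, p, e) V)) = 0"
    and "\<And>\<sigma> s xs d e ys V. spliced \<sigma> s xs [Tail d, Tail e] ys V \<in> diagrams S n \<Longrightarrow>
      spliced \<sigma> s xs [Tail e, Tail d] ys V \<in> diagrams S n \<Longrightarrow>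
      W (spliced \<sigma> s xs [Tail d, Tail e] ys V) = W (spliced \<sigma> s xs [Tail e, Tail d] ys V)"
  shows "pairing W r = 0"
  using assms(1)
proof cases
  case (iso D f)
  then show ?thesis using assms(2) by simp
next
  case (AS D \<sigma> p q u V D')
  then show ?thesis using assms(3)[of \<sigma> p q u V] by simp
next
  case (IHX D1 \<sigma> p q m r u V D2 D3)
  then show ?thesis using assms(4)[of \<sigma> p q m r u V] by simp
next
  case (STU1 D1 \<sigma> s xs p q ys V D2 D3 m)
  then show ?thesis using assms(5)[of \<sigma> s xs p q ys V m] by simp
next
  case (STU2 D1 \<sigma> s xs p e ys V D2 D3 m)
  have s: "strand D1 s = xs @ [Head p, Tail e] @ ys" "strand D2 s = xs @ [Tail e, Head p] @ ys"
    "strand D3 s = xs @ [Tail m] @ ys"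
    unfolding STU2 by simp_all
  have "length (strand D3 s) < length (strand D1 s)" using s by simp
  \<comment> \<open>The first diagram differs from the other two (the third has a shorter strand),
    so its coefficient does not cancel and it is a key of \<open>r\<close>.\<close>
  then have "D1 \<noteq> D2" "D1 \<noteq> D3" using s by auto
  then have "D1 \<in> Poly_Mapping.keys r"
    unfolding STU2(1) by (simp add: in_keys_iff lookup_minus lookup_single)
  then show ?thesis using assms(6)[of \<sigma> s xs p e ys V m] STU2 by simp
next
  case (TC D \<sigma> s xs d e ys V D')
  then show ?thesis using assms(7)[of \<sigma> s xs d e ys V] by simp
qed

section \<open>Lowest heads on tail strands\<close>

definition tail_strand_heads :: "('h + 't) diagram \<Rightarrow> nat set" where
  "tail_strand_heads D = {p. \<exists>t. Head p \<in> set (strand D (Inr t))}"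

definition first_head :: "('h + 't) diagram \<Rightarrow> 't \<Rightarrow> nat list \<Rightarrow> nat \<Rightarrow> bool" where
  "first_head D t ts p \<longleftrightarrow> (\<exists>ys. strand D (Inr t) = map Tail ts @ Head p # ys)"

lemma split_at_first_head:
  "Head p \<in> set L \<Longrightarrow> \<exists>ts q ys. L = map Tail ts @ Head q # ys"
proof (induction L)
  case (Cons x L)
  show ?case
  proof (cases x)
    case (Head q)
    then have "x # L = map Tail [] @ Head q # L" by simp
    then show ?thesis by blast
  next
    case (Tail e)
    with Cons obtain ts q ys where "L = map Tail ts @ Head q # ys" by auto
    with Tail have "x # L = map Tail (e # ts) @ Head q # ys" by simp
    then show ?thesis by blast
  qed
qed simp

lemma map_Tail_Head_eq:
  "map Tail ts @ Head p # ys = map Tail ts' @ Head p' # ys' \<Longrightarrow> ts = ts' \<and> p = p' \<and> ys = ys'"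
proof (induction ts arbitrary: ts')
  case Nil
  then show ?case by (cases ts') auto
next
  case (Cons a ts)
  then show ?case by (cases ts') auto
qed

lemma first_head_unique:
  "first_head D t ts p \<Longrightarrow> first_head D t ts' p' \<Longrightarrow> ts = ts' \<and> p = p'"
  unfolding first_head_def using map_Tail_Head_eq by metis

lemma first_head_exists:
  "tail_strand_heads D \<noteq> {} \<Longrightarrow> \<exists>t ts p. first_head D t ts p"
  unfolding tail_strand_heads_def first_head_def using split_at_first_head by fast

lemma first_headD:
  assumes "first_head D t ts p"
  shows "Head p \<in> set (strand D (Inr t))" "Head p \<in> ends D" "p \<in> tail_strand_heads D"
    and "e \<in> set ts \<Longrightarrow> Tail e \<in> set (strand D (Inr t))" "e \<in> set ts \<Longrightarrow> Tail e \<in> ends D"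
proof -
  obtain ys where ys: "strand D (Inr t) = map Tail ts @ Head p # ys"
    using assms by (auto simp: first_head_def)
  show 1: "Head p \<in> set (strand D (Inr t))" by (simp add: ys)
  show 2: "e \<in> set ts \<Longrightarrow> Tail e \<in> set (strand D (Inr t))" by (simp add: ys)
  show "Head p \<in> ends D" "p \<in> tail_strand_heads D"
    using 1 by (auto simp: ends_def tail_strand_heads_def)
  show "e \<in> set ts \<Longrightarrow> Tail e \<in> ends D"
    using 2 by (auto simp: ends_def)
qed

lemma tail_strand_heads_attach [simp]:
  "tail_strand_heads (attach m p e D) = tail_strand_heads D - {p}"
  by (auto simp: tail_strand_heads_def set_attach_list)

lemma in_map_arrow_end_image:
  "Head q \<in> map_arrow_end f ` A \<longleftrightarrow> (\<exists>p. q = f p \<and> Head p \<in> A)"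
  "Tail q \<in> map_arrow_end f ` A \<longleftrightarrow> (\<exists>p. q = f p \<and> Tail p \<in> A)"
proof -
  have "Head q = map_arrow_end f x \<longleftrightarrow> (\<exists>p. x = Head p \<and> q = f p)"
    "Tail q = map_arrow_end f x \<longleftrightarrow> (\<exists>p. x = Tail p \<and> q = f p)" for x
    by (cases x; auto)+
  then show "Head q \<in> map_arrow_end f ` A \<longleftrightarrow> (\<exists>p. q = f p \<and> Head p \<in> A)"
    "Tail q \<in> map_arrow_end f ` A \<longleftrightarrow> (\<exists>p. q = f p \<and> Tail p \<in> A)"
    by (auto simp: image_iff)
qed

lemma tail_strand_heads_rename [simp]:
  "tail_strand_heads (rename f D) = f ` tail_strand_heads D"
  by (auto simp: tail_strand_heads_def in_map_arrow_end_image)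

lemma finite_tail_strand_heads:
  assumes "finite S" "D \<in> diagrams S n"
  shows "finite (tail_strand_heads D)"
proof (rule finite_subset[OF _ finite_edges[OF assms]])
  show "tail_strand_heads D \<subseteq> edges D"
    using edge_of_end(2) by (auto simp: tail_strand_heads_def)
qed

lemma first_head_attach_other:
  assumes "D \<in> diagrams S n" "first_head D t ts p" "first_head D t' ts' p'" "t \<noteq> t'" "e \<in> set ts"
  shows "first_head (attach m p e D) t' ts' p'"
proof -
  have "Inr t \<noteq> Inr t'" using assms(4) by simp
  then have "Head p \<notin> set (strand D (Inr t'))" "Tail e \<notin> set (strand D (Inr t'))"
    using first_headD(1)[OF assms(2)] first_headD(4)[OF assms(2,5)]
      disjoint_strands[OF assms(1), of _ "Inr t" "Inr t'"]
    by metis+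
  then have "strand (attach m p e D) (Inr t') = strand D (Inr t')"
    by (simp add: attach_list_id)
  then show ?thesis using assms(3) by (simp add: first_head_def)
qed

lemma first_head_rename:
  assumes "first_head (rename f D) t ts' p'"
  shows "\<exists>ts p. first_head D t ts p \<and> ts' = map f ts \<and> p' = f p"
proof -
  obtain ys' where e: "map (map_arrow_end f) (strand D (Inr t)) = map Tail ts' @ Head p' # ys'"
    using assms by (auto simp: first_head_def)
  then have "Head p' \<in> map_arrow_end f ` set (strand D (Inr t))"
    by (metis in_set_conv_decomp set_map)
  then obtain x where "x \<in> set (strand D (Inr t))" "Head p' = map_arrow_end f x" by blast
  moreover from this(2) have "\<exists>q. x = Head q" by (cases x) auto
  ultimately obtain q where "Head q \<in> set (strand D (Inr t))" by blast
  then obtain ts p ys where s: "strand D (Inr t) = map Tail ts @ Head p # ys"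
    using split_at_first_head[of q "strand D (Inr t)"] by blast
  have "map Tail (map f ts) @ Head (f p) # map (map_arrow_end f) ys = map Tail ts' @ Head p' # ys'"
    using e by (simp add: s comp_def)
  from map_Tail_Head_eq[OF this] have "map f ts = ts' \<and> f p = p'" by simp
  then show ?thesis using s unfolding first_head_def by blast
qed

lemma edges_rename: "edges (rename f D) = f ` edges D"
proof -
  have e: "ends (rename f D) = map_arrow_end f ` ends D" by (auto simp: ends_def)
  have "tails (rename f D) = f ` tails D" "heads (rename f D) = f ` heads D"
    by (auto simp: tails_def heads_def e in_map_arrow_end_image)
  moreover have "insert (out_edge (map_prod f (map_prod f f) v)) (in_edges (map_prod f (map_prod f f) v)) =
      f ` insert (out_edge v) (in_edges v)" for v
    by (cases v) (simp add: out_edge_def in_edges_def)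
  ultimately show ?thesis
    unfolding edges_def trivs_rename by (simp add: image_Un image_UN)
qed

lemma attach_change_fresh:
  assumes "Tail e \<in> ends D" "Head p \<in> ends D" "m \<notin> edges D"
  shows "attach m' p e D = rename (id(m := m')) (attach m p e D)"
proof -
  have "inj_on (id(m := m')) (edges D)" using assms(3) by (auto simp: inj_on_def)
  moreover have "p \<noteq> m" "e \<noteq> m" using assms by (auto dest: edge_of_end(3,4))
  moreover have "rename (id(m := m')) D = D" using assms(3) by (intro rename_id_on) auto
  ultimately show ?thesis using assms by (simp add: rename_attach)
qed

text \<open>
  The tail strand \<open>t\<close> on which the lowest head is slid down, and the new edge, are arbitrary choices; the
  value does not depend on them for diagrams with exactly \<open>k\<close> heads on tail strands.
\<close>

primrec extend_weight :: "(('h + 't) diagram \<Rightarrow> rat) \<Rightarrow> nat \<Rightarrow> ('h + 't) diagram \<Rightarrow> rat" where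
  "extend_weight W 0 D = W D"
| "extend_weight W (Suc k) D =
    (let c = SOME c. (\<exists>t. first_head D t (fst c) (fst (snd c))) \<and> snd (snd c) \<notin> edges D
     in - (\<Sum>e\<in>set (fst c). extend_weight W k (attach (snd (snd c)) (fst (snd c)) e D)))"

text \<open>Relators are tested only where no head lies on a tail strand; elsewhere the recursion
  replaces the values of \<open>W\<close>. Tails on head strands are still permitted, so a window on
  a head strand is covered by the hypothesis and the extension has only tail strands to
  treat.\<close>

locale tail_weight =
  fixes H :: "'h set" and T :: "'t set" and n :: nat and W :: "('h + 't) diagram \<Rightarrow> rat"
  assumes fin: "finite (H <+> T)"
    and relator: "\<And>r. r \<in> relators (H <+> T) n \<Longrightarrow>
      (\<And>D. D \<in> Poly_Mapping.keys r \<Longrightarrow> tail_strand_heads D = {}) \<Longrightarrow> pairing W r = 0"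
begin

abbreviation dgs :: "('h + 't) diagram set" where "dgs \<equiv> diagrams (H <+> T) n"

abbreviation E :: "nat \<Rightarrow> ('h + 't) diagram \<Rightarrow> rat" where "E \<equiv> extend_weight W"

definition iso_invariant :: "nat \<Rightarrow> bool" where
  "iso_invariant k \<longleftrightarrow> (\<forall>D f. D \<in> dgs \<longrightarrow> card (tail_strand_heads D) = k \<longrightarrow>
     inj_on f (edges D) \<longrightarrow> E k (rename f D) = E k D)"

text \<open>For \<open>k = 0\<close> this is vacuous, since a first head is a head on a tail strand;
  the truncated \<open>k - 1\<close> is therefore harmless.\<close>

definition expandable :: "nat \<Rightarrow> bool" where
  "expandable k \<longleftrightarrow> (\<forall>D t ts p m. D \<in> dgs \<longrightarrow> card (tail_strand_heads D) = k \<longrightarrow>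
     first_head D t ts p \<longrightarrow> m \<notin> edges D \<longrightarrow>
     E k D = - (\<Sum>e\<in>set ts. E (k - 1) (attach m p e D)))"

lemma expandableD:
  "expandable k \<Longrightarrow> D \<in> dgs \<Longrightarrow> card (tail_strand_heads D) = k \<Longrightarrow> first_head D t ts p \<Longrightarrow>
    m \<notin> edges D \<Longrightarrow> E k D = - (\<Sum>e\<in>set ts. E (k - 1) (attach m p e D))"
  unfolding expandable_def by blast

lemma attach_first_head:
  assumes "D \<in> dgs" "first_head D t ts p" "m \<notin> edges D" "e \<in> set ts"
  shows "attach m p e D \<in> dgs"
    and "card (tail_strand_heads (attach m p e D)) = card (tail_strand_heads D) - 1"
    and "edges (attach m p e D) = insert m (edges D)"
  using attach_in_diagrams[OF fin assms(1) _ _ assms(3), of e p] first_headD[OF assms(2)] assms(4)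
    finite_tail_strand_heads[OF fin assms(1)] edges_attach[of e D p m]
  by simp_all

lemma change_fresh:
  assumes "iso_invariant k" "D \<in> dgs" "card (tail_strand_heads D) = Suc k" "first_head D t ts p"
    and "m \<notin> edges D" "m' \<notin> edges D" "e \<in> set ts"
  shows "E k (attach m' p e D) = E k (attach m p e D)"
proof -
  have "inj_on (id(m := m')) (edges (attach m p e D))"
    using assms(6) attach_first_head(3)[OF assms(2,4,5,7)] by (auto simp: inj_on_def)
  then show ?thesis
    using assms attach_first_head[OF assms(2,4,5,7)]
      attach_change_fresh[of e D p m m'] first_headD[OF assms(4)]
    unfolding iso_invariant_def by simp
qed

text \<open>Two choices on the same strand pick the same lowest head and differ only by the name of
  the new edge. Choices on different strands are compared by expanding every term once more at the
  other head: attachments on different strands commute, so both sides become the same double sum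
  with the order of summation exchanged.\<close>

lemma expansions_agree:
  assumes IH: "iso_invariant k" "expandable k"
    and D: "D \<in> dgs" "card (tail_strand_heads D) = Suc k"
    and a: "first_head D t ts p" "m \<notin> edges D"
    and b: "first_head D t' ts' p'" "m' \<notin> edges D"
  shows "(\<Sum>e\<in>set ts. E k (attach m p e D)) = (\<Sum>e\<in>set ts'. E k (attach m' p' e D))"
proof (cases "t = t'")
  case True
  then have "ts = ts'" "p = p'" using first_head_unique[of D t ts p ts' p'] a(1) b(1) by auto
  then show ?thesis
    using change_fresh[OF IH(1) D a(1) b(2) a(2)] by simp
next
  case False
  \<comment> \<open>The second expansion takes place in diagrams that already contain
    \<open>m\<close>, so its new edge has to avoid \<open>m\<close> too.\<close>
  obtain m2 where m2: "m2 \<notin> edges D" "m2 \<noteq> m"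
    using exists_fresh_edge[OF fin D(1), of "{m}"] by auto
  have 1: "E k (attach m p e D) = - (\<Sum>e'\<in>set ts'. E (k - 1) (attach m2 p' e' (attach m p e D)))"
    if e: "e \<in> set ts" for e
    using expandableD[OF IH(2) attach_first_head(1)[OF D(1) a e] _
        first_head_attach_other[OF D(1) a(1) b(1) False e], of m2]
      attach_first_head(2,3)[OF D(1) a e] D(2) m2
    by simp
  have 2: "E k (attach m2 p' e' D) = - (\<Sum>e\<in>set ts. E (k - 1) (attach m p e (attach m2 p' e' D)))"
    if e: "e' \<in> set ts'" for e'
    using expandableD[OF IH(2) attach_first_head(1)[OF D(1) b(1) m2(1) e] _
        first_head_attach_other[OF D(1) b(1) a(1) False[symmetric] e], of m]
      attach_first_head(2,3)[OF D(1) b(1) m2(1) e] D(2) m2 a(2)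
    by simp
  have 3: "attach m2 p' e' (attach m p e D) = attach m p e (attach m2 p' e' D)"
    if "e \<in> set ts" "e' \<in> set ts'" for e e'
  proof (rule attach_commute)
    show "e' \<noteq> e"
      using first_headD(4)[OF a(1) that(1)] first_headD(4)[OF b(1) that(2)] False
        disjoint_strands[OF D(1), of _ "Inr t" "Inr t'"] by auto
    show "m2 \<noteq> e" "m \<noteq> e'"
      using first_headD(5)[OF a(1) that(1)] first_headD(5)[OF b(1) that(2)] a(2) m2(1)
      by (auto dest: edge_of_end(3))
  qed
  have "(\<Sum>e\<in>set ts. E k (attach m p e D)) =
      - (\<Sum>e\<in>set ts. \<Sum>e'\<in>set ts'. E (k - 1) (attach m2 p' e' (attach m p e D)))"
    by (simp add: 1 sum_negf)
  also have "\<dots> = - (\<Sum>e'\<in>set ts'. \<Sum>e\<in>set ts. E (k - 1) (attach m2 p' e' (attach m p e D)))"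
    by (subst sum.swap) simp
  also have "\<dots> = (\<Sum>e'\<in>set ts'. E k (attach m2 p' e' D))"
    by (simp add: 2 3 sum_negf cong: sum.cong)
  also have "\<dots> = (\<Sum>e'\<in>set ts'. E k (attach m' p' e' D))"
    using change_fresh[OF IH(1) D b(1) b(2) m2(1)] by simp
  finally show ?thesis .
qed

lemma chosen_expansion:
  assumes "finite (edges D)" "tail_strand_heads D \<noteq> {}"
  obtains t ts p m where "first_head D t ts p" "m \<notin> edges D"
    "E (Suc k) D = - (\<Sum>e\<in>set ts. E k (attach m p e D))"
proof -
  define P where "P = (\<lambda>c. (\<exists>t. first_head D t (fst c) (fst (snd c))) \<and> snd (snd c) \<notin> edges D)"
  obtain t ts p where f: "first_head D t ts p" using first_head_exists[OF assms(2)] by blast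
  obtain m where m: "m \<notin> edges D" using ex_new_if_finite[OF _ assms(1)] by auto
  have "P (ts, p, m)" using f m by (auto simp: P_def)
  then have c: "P (SOME c. P c)" by (rule someI)
  then obtain t' where t': "first_head D t' (fst (SOME c. P c)) (fst (snd (SOME c. P c)))"
    by (auto simp: P_def)
  have m': "snd (snd (SOME c. P c)) \<notin> edges D" using c by (simp add: P_def)
  have "E (Suc k) D = - (\<Sum>e\<in>set (fst (SOME c. P c)).
      E k (attach (snd (snd (SOME c. P c))) (fst (snd (SOME c. P c))) e D))"
    by (simp only: extend_weight.simps P_def Let_def)
  from that[OF t' m' this] show ?thesis .
qed

text \<open>Independence of the choices and invariance under renaming need each other in the induction step.\<close>

lemma iso_invariant_expandable: "iso_invariant k \<and> expandable k"
proof (induction k)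
  case 0
  have "E 0 (rename f D) = E 0 D"
    if D: "D \<in> dgs" "card (tail_strand_heads D) = 0" and f: "inj_on f (edges D)" for D f
  proof -
    have t: "tail_strand_heads D = {}"
      using D finite_tail_strand_heads[OF fin D(1)] by simp
    let ?r = "basis D - basis (rename f D)"
    have "pairing W ?r = 0"
    proof (rule relator)
      show "?r \<in> relators (H <+> T) n" using D(1) f by (rule relators.iso)
      show "tail_strand_heads D' = {}" if "D' \<in> Poly_Mapping.keys ?r" for D'
        using that t keys_diff[of "basis D" "basis (rename f D)"] by auto
    qed
    then show ?thesis by simp
  qed
  moreover have "\<not> first_head D t ts p" if "D \<in> dgs" "card (tail_strand_heads D) = 0" for D t ts p
    using that finite_tail_strand_heads[OF fin that(1)] first_headD(3) by fastforce
  ultimately show ?case unfolding iso_invariant_def expandable_def by blast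
next
  case (Suc k)
  then have IH: "iso_invariant k" "expandable k" by auto
  have ex: "E (Suc k) D = - (\<Sum>e\<in>set ts. E k (attach m p e D))"
    if D: "D \<in> dgs" "card (tail_strand_heads D) = Suc k" and a: "first_head D t ts p" "m \<notin> edges D"
    for D t ts p m
  proof -
    have "tail_strand_heads D \<noteq> {}" using D(2) by auto
    then obtain t' ts' p' m' where b: "first_head D t' ts' p'" "m' \<notin> edges D"
      and e: "E (Suc k) D = - (\<Sum>e\<in>set ts'. E k (attach m' p' e D))"
      using chosen_expansion[OF finite_edges[OF fin D(1)]] by metis
    show ?thesis using e expansions_agree[OF IH D a b] by simp
  qed
  have "E (Suc k) (rename f D) = E (Suc k) D"
    if D: "D \<in> dgs" "card (tail_strand_heads D) = Suc k" and f: "inj_on f (edges D)" for D f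
  proof -
    have "finite (edges (rename f D))" using finite_edges[OF fin D(1)] by (simp add: edges_rename)
    moreover have "tail_strand_heads (rename f D) \<noteq> {}" using D(2) by auto
    ultimately obtain t ts' p' m' where c: "first_head (rename f D) t ts' p'"
        "m' \<notin> edges (rename f D)"
      and e: "E (Suc k) (rename f D) = - (\<Sum>e\<in>set ts'. E k (attach m' p' e (rename f D)))"
      using chosen_expansion by metis
    obtain ts p where a: "first_head D t ts p" and ts': "ts' = map f ts" and p': "p' = f p"
      using first_head_rename[OF c(1)] by auto
    obtain m where m: "m \<notin> edges D" using exists_fresh_edge[OF fin D(1), of "{}"] by auto
    \<comment> \<open>The renaming is extended to the new edges, so that the expansions of the two
      diagrams match term by term.\<close>
    let ?f = "f(m := m')"
    have i: "inj_on ?f (insert m (edges D))"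
      using f m c(2) by (auto simp: inj_on_def edges_rename)
    have tsE: "set ts \<subseteq> edges D" using first_headD(5)[OF a] edge_of_end(3)[of _ D] by auto
    have "E k (attach m' p' (f e) (rename f D)) = E k (attach m p e D)" if "e \<in> set ts" for e
    proof -
      have n: "e \<noteq> m" "p \<noteq> m"
        using m that tsE first_headD(2)[OF a] by (auto dest: edge_of_end(4))
      have "rename ?f (attach m p e D) = attach (?f m) (?f p) (?f e) (rename ?f D)"
        using first_headD[OF a] that i by (intro rename_attach) (auto intro: inj_on_subset)
      also have "rename ?f D = rename f D" using m by (intro rename_cong) auto
      finally have "rename ?f (attach m p e D) = attach m' p' (f e) (rename f D)"
        using n p' by (simp add: fun_upd_def)
      moreover have "E k (rename ?f (attach m p e D)) = E k (attach m p e D)"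
        using IH(1) attach_first_head[OF D(1) a m that] i D(2) unfolding iso_invariant_def by simp
      ultimately show ?thesis by simp
    qed
    moreover have "inj_on f (set ts)" using f tsE by (rule inj_on_subset)
    ultimately show ?thesis
      using e ex[OF D a m] by (simp add: ts' sum.reindex)
  qed
  with ex show ?case unfolding iso_invariant_def expandable_def by simp
qed

end

lemma all_tails: "(\<And>q. Head q \<notin> set L) \<Longrightarrow> \<exists>ts. L = map Tail ts"
proof (induction L)
  case (Cons x L)
  then obtain ts where ts: "L = map Tail ts" by auto
  from Cons.prems obtain e where "x = Tail e" by (cases x) auto
  then have "x # L = map Tail (e # ts)" using ts by simp
  then show ?case by (rule exI)
qed simp

lemma local_end_neq:
  assumes "spliced \<sigma> s xs w ys V \<in> diagrams S n" "x \<in> set w"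
    and "y \<in> set xs \<or> y \<in> set ys \<or> (r \<noteq> s \<and> y \<in> set (\<sigma> r))"
  shows "y \<noteq> x"
proof
  assume "y = x"
  have d: "distinct (xs @ w @ ys)" using distinct_strand[OF assms(1), of s] by simp
  have "y \<notin> set (\<sigma> r)" if "r \<noteq> s"
    using disjoint_strands[OF assms(1), of y r s] that \<open>y = x\<close> assms(2) by auto
  then show False using d assms(2,3) \<open>y = x\<close> by auto
qed

lemma in_tails_local:
  "e \<in> tails (spliced \<sigma> s xs w ys V) \<longleftrightarrow>
    Tail e \<in> set xs \<or> Tail e \<in> set w \<or> Tail e \<in> set ys \<or> (\<exists>r. r \<noteq> s \<and> Tail e \<in> set (\<sigma> r))"
  unfolding tails_def ends_def
  by (simp add: fun_upd_def) (metis Un_iff set_append)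

lemma edges_eq_sources: "D \<in> diagrams S n \<Longrightarrow> edges D = tails D \<union> out_edge ` trivs D"
  and sources_disjoint: "D \<in> diagrams S n \<Longrightarrow> tails D \<inter> out_edge ` trivs D = {}"
  and out_edge_inj: "D \<in> diagrams S n \<Longrightarrow> inj_on out_edge (trivs D)"
  and targets_disjoint: "D \<in> diagrams S n \<Longrightarrow> heads D \<inter> (\<Union>v\<in>trivs D. in_edges v) = {}"
  by (simp_all add: diagrams_def arrow_diagram_def)

text \<open>An edge of the first two diagrams has a source in them. In the third diagram
  \<open>m\<close> has its tail in the window, and a source elsewhere would be a second one. The
  condition on \<open>w\<close> covers both orders of the window.\<close>

lemma STU2_fresh:
  assumes D1: "spliced \<sigma> s xs w ys V \<in> diagrams S n" and w: "Tail ` {e} = set w \<inter> range Tail"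
    and D3: "spliced \<sigma> s xs [Tail m] ys (insert (m, p, e) V) \<in> diagrams S n"
  shows "m \<notin> edges (spliced \<sigma> s xs w ys V)"
proof
  assume "m \<in> edges (spliced \<sigma> s xs w ys V)"
  then consider "m \<in> tails (spliced \<sigma> s xs w ys V)" | "m \<in> out_edge ` V"
    using edges_eq_sources[OF D1] by auto
  moreover have m: "m \<in> tails (spliced \<sigma> s xs [Tail m] ys (insert (m, p, e) V))"
    unfolding in_tails_local by simp
  then have "m \<notin> out_edge ` insert (m, p, e) V"
    using sources_disjoint[OF D3] by auto
  then have mo: "m \<notin> out_edge ` V" "m \<noteq> e" by (auto simp: out_edge_def)
  ultimately have "m \<in> tails (spliced \<sigma> s xs w ys V)" by blast
  moreover have "Tail m \<notin> set w" using w mo(2) by auto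
  ultimately show False
    unfolding in_tails_local using local_end_neq[OF D3, of "Tail m" "Tail m"] by auto
qed

text \<open>If \<open>m\<close> were old, its source would compete with the new vertex: a tail
  contradicts validity of the third diagram, and a vertex with output \<open>m\<close> would have to
  be \<open>(p, q, m)\<close> itself, although in the first diagram \<open>p\<close> ends in a
  head.\<close>

lemma STU1_fresh:
  assumes D1: "spliced \<sigma> s xs [Head p, Head q] ys V \<in> diagrams S n"
    and D3: "spliced \<sigma> s xs [Head m] ys (insert (p, q, m) V) \<in> diagrams S n"
  shows "m \<notin> edges (spliced \<sigma> s xs [Head p, Head q] ys V)"
proof
  assume "m \<in> edges (spliced \<sigma> s xs [Head p, Head q] ys V)"
  then consider "m \<in> tails (spliced \<sigma> s xs [Head p, Head q] ys V)" | "m \<in> out_edge ` V"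
    using edges_eq_sources[OF D1] by auto
  then show False
  proof cases
    case 1
    then have "m \<in> tails (spliced \<sigma> s xs [Head m] ys (insert (p, q, m) V))"
      unfolding in_tails_local by simp
    then show False using sources_disjoint[OF D3] by (auto simp: out_edge_def)
  next
    case 2
    then obtain v where v: "v \<in> V" "out_edge v = m" by auto
    then have "v = (p, q, m)"
      using out_edge_inj[OF D3] by (auto simp: inj_on_def out_edge_def)
    then have "p \<in> (\<Union>v\<in>V. in_edges v)" using v(1) by (force simp: in_edges_def)
    moreover have "p \<in> heads (spliced \<sigma> s xs [Head p, Head q] ys V)"
      by (auto simp: heads_def ends_def)
    ultimately show False using targets_disjoint[OF D1] by auto
  qed
qed

section \<open>Relations satisfied by the extended weight\<close>

context tail_weight
begin

definition extension :: "('h + 't) diagram \<Rightarrow> rat" where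
  "extension D = E (card (tail_strand_heads D)) D"

lemma extension_base: "tail_strand_heads D = {} \<Longrightarrow> extension D = W D"
  by (simp add: extension_def)

lemma extension_expand:
  assumes "D \<in> dgs" "first_head D t ts p" "m \<notin> edges D"
  shows "extension D = - (\<Sum>e\<in>set ts. extension (attach m p e D))"
proof -
  have "E (card (tail_strand_heads D) - 1) (attach m p e D) = extension (attach m p e D)"
    if "e \<in> set ts" for e
    using attach_first_head(2)[OF assms that] by (simp add: extension_def)
  then show ?thesis
    using expandableD[OF _ assms(1) refl assms(2,3)] iso_invariant_expandable
    by (simp add: extension_def cong: sum.cong)
qed

lemma extension_rename:
  assumes "D \<in> dgs" "inj_on f (edges D)"
  shows "extension (rename f D) = extension D"
proof -
  have "tail_strand_heads D \<subseteq> edges D"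
    using edge_of_end(2) by (auto simp: tail_strand_heads_def)
  then have "card (tail_strand_heads (rename f D)) = card (tail_strand_heads D)"
    using assms(2) by (simp add: card_image inj_on_subset)
  then show ?thesis
    using conjunct1[OF iso_invariant_expandable, of "card (tail_strand_heads D)"] assms
    unfolding iso_invariant_def extension_def by simp
qed

text \<open>\<open>q\<close> is a linear combination written as a list, so that
  \<open>attach\<close> acts termwise even if terms coincide. The terms share the strand, the lowest
  head and the set \<open>B\<close> of tails below it, while the order of these tails may vary, as
  it does in \<open>TC\<close>.\<close>

definition expands_within ::
    "(rat \<times> ('h + 't) diagram) list set \<Rightarrow> (rat \<times> ('h + 't) diagram) list \<Rightarrow> bool" where
  "expands_within Q q \<longleftrightarrow> (\<exists>t p B.
     (\<forall>x\<in>set q. \<exists>ts. set ts = B \<and> first_head (snd x) t ts p) \<and>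
     (\<forall>m e. e \<in> B \<longrightarrow> (\<forall>x\<in>set q. m \<notin> edges (snd x)) \<longrightarrow> map (apsnd (attach m p e)) q \<in> Q))"

lemma expands_withinI:
  assumes "\<And>x. x \<in> set q \<Longrightarrow> \<exists>ts. set ts = B \<and> first_head (snd x) t ts p"
    and "\<And>m e. e \<in> B \<Longrightarrow> \<forall>x\<in>set q. m \<notin> edges (snd x) \<Longrightarrow>
      map (apsnd (attach m p e)) q \<in> Q"
  shows "expands_within Q q"
  unfolding expands_within_def
  by (rule exI[of _ t], rule exI[of _ p], rule exI[of _ B]) (simp add: assms)

text \<open>Expanding all terms of \<open>q\<close> at the common head, with one new edge, turns the
  value of \<open>q\<close> into minus a sum of values of members of \<open>Q\<close> that have
  fewer heads on tail strands. A relation thus only has to be checked where no common expansion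
  stays inside the family.\<close>

lemma relation_by_expansion:
  assumes "q \<in> Q"
    and dgs: "\<And>q x. q \<in> Q \<Longrightarrow> x \<in> set q \<Longrightarrow> snd x \<in> dgs"
    and step: "\<And>q. q \<in> Q \<Longrightarrow> (\<Sum>x\<leftarrow>q. fst x * extension (snd x)) = 0 \<or> expands_within Q q"
  shows "(\<Sum>x\<leftarrow>q. fst x * extension (snd x)) = 0"
  using assms(1)
proof (induction "\<Sum>x\<leftarrow>q. card (tail_strand_heads (snd x))" arbitrary: q rule: less_induct)
  case less
  note dg = dgs[OF less.prems]
  show ?case
    using step[OF less.prems] unfolding expands_within_def
  proof (elim disjE exE conjE)
    fix t p B
    assume fh: "\<forall>x\<in>set q. \<exists>ts. set ts = B \<and> first_head (snd x) t ts p"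
      and cl: "\<forall>m e. e \<in> B \<longrightarrow> (\<forall>x\<in>set q. m \<notin> edges (snd x)) \<longrightarrow> map (apsnd (attach m p e)) q \<in> Q"
    have "finite (\<Union>x\<in>set q. edges (snd x))" by (auto intro!: finite_edges[OF fin] dg)
    then obtain m where "m \<notin> (\<Union>x\<in>set q. edges (snd x))"
      using ex_new_if_finite[OF infinite_UNIV_nat] by blast
    then have m: "\<forall>x\<in>set q. m \<notin> edges (snd x)" by simp
    have "fst x * extension (snd x) = - (\<Sum>e\<in>B. fst x * extension (attach m p e (snd x)))"
      if x: "x \<in> set q" for x
    proof -
      obtain ts where ts: "set ts = B" "first_head (snd x) t ts p" using fh x by blast
      show ?thesis
        using extension_expand[OF dg[OF x] ts(2), of m] m x by (simp add: ts(1) sum_distrib_left)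
    qed
    then have "(\<Sum>x\<leftarrow>q. fst x * extension (snd x)) =
        (\<Sum>x\<leftarrow>q. - (\<Sum>e\<in>B. fst x * extension (attach m p e (snd x))))"
      by (intro arg_cong[of _ _ sum_list] map_cong) auto
    also have "\<dots> = - (\<Sum>e\<in>B. \<Sum>x\<leftarrow>map (apsnd (attach m p e)) q. fst x * extension (snd x))"
      by (induction q) (simp_all add: sum.distrib)
    also have "\<dots> = 0"
    \<comment> \<open>Without terms the measure cannot decrease, but then the sum is empty.\<close>
    proof (cases "q = []")
      case False
      have "(\<Sum>x\<leftarrow>map (apsnd (attach m p e)) q. fst x * extension (snd x)) = 0" if "e \<in> B" for e
      proof (rule less.hyps[OF _ cl[rule_format, OF that m[rule_format]]])
        have "card (tail_strand_heads (attach m p e (snd x))) < card (tail_strand_heads (snd x))"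
          if x: "x \<in> set q" for x
        proof -
          have "p \<in> tail_strand_heads (snd x)" using fh x first_headD(3) by metis
          then show ?thesis
            using finite_tail_strand_heads[OF fin dg[OF x]] by (simp add: card_Diff1_less del: card_Diff_insert)
        qed
        then have "(\<Sum>x\<leftarrow>q. card (tail_strand_heads (attach m p e (snd x))))
            < (\<Sum>x\<leftarrow>q. card (tail_strand_heads (snd x)))"
          by (intro sum_list_strict_mono[OF False])
        then show "(\<Sum>x\<leftarrow>map (apsnd (attach m p e)) q. card (tail_strand_heads (snd x)))
            < (\<Sum>x\<leftarrow>q. card (tail_strand_heads (snd x)))"
          by (simp add: comp_def)
      qed auto
      then show ?thesis by simp
    qed simp
    finally show ?thesis .
  qed
qed

lemma tail_strand_heads_Diagram:
  "tail_strand_heads (Diagram \<sigma> V) = {p. \<exists>t. Head p \<in> set (\<sigma> (Inr t))}"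
  by (simp add: tail_strand_heads_def)

end

lemma keys_combination:
  "Poly_Mapping.keys (basis a + basis b) \<subseteq> {a, b}"
  "Poly_Mapping.keys (basis a - basis b) \<subseteq> {a, b}"
  "Poly_Mapping.keys (basis a + basis b + basis c) \<subseteq> {a, b, c}"
  "Poly_Mapping.keys (basis a - basis b - basis c) \<subseteq> {a, b, c}"
  by (auto simp: in_keys_iff lookup_add lookup_minus lookup_single when_def split: if_splits)

context tail_weight
begin

lemma extension_relator_base:
  assumes "r \<in> relators (H <+> T) n" "Poly_Mapping.keys r \<subseteq> A" "\<And>D. D \<in> A \<Longrightarrow> tail_strand_heads D = {}"
  shows "pairing extension r = 0"
proof -
  have e: "tail_strand_heads D = {}" if "D \<in> Poly_Mapping.keys r" for D
    using that assms(2,3) by blast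
  have "pairing extension r = pairing W r"
    using e by (intro pairing_cong) (simp add: extension_base)
  also have "\<dots> = 0" using assms(1) e by (rule relator)
  finally show ?thesis .
qed


text \<open>\<open>AS\<close> and \<open>IHX\<close> change vertices only, so all terms have the
  same strands and the same lowest heads; attaching adds one and the same vertex to each. The
  hypothesis \<open>rel\<close> ranges over all strands and all \<open>V\<close> because both change
  during the expansion.\<close>

lemma extension_same_strands:
  assumes dg: "\<forall>u\<in>set us. Diagram \<sigma> (snd u \<union> V) \<in> dgs"
    and rel: "\<And>\<sigma> V. \<forall>u\<in>set us. Diagram \<sigma> (snd u \<union> V) \<in> dgs \<Longrightarrow> tail_strand_heads (Diagram \<sigma> {}) = {} \<Longrightarrow>
      (\<Sum>u\<leftarrow>us. fst u * extension (Diagram \<sigma> (snd u \<union> V))) = 0"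
  shows "(\<Sum>u\<leftarrow>us. fst u * extension (Diagram \<sigma> (snd u \<union> V))) = 0"
proof -
  let ?q = "\<lambda>\<sigma> V. map (\<lambda>u. (fst u, Diagram \<sigma> (snd u \<union> V))) us"
  define Q where "Q = {?q \<sigma> V | \<sigma> V. \<forall>u\<in>set us. Diagram \<sigma> (snd u \<union> V) \<in> dgs}"
  have "(\<Sum>x\<leftarrow>?q \<sigma> V. fst x * extension (snd x)) = 0"
  proof (rule relation_by_expansion[of _ Q])
    show "?q \<sigma> V \<in> Q" using dg unfolding Q_def by blast
    fix Y assume "Y \<in> Q"
    then obtain \<sigma> V where Y: "Y = ?q \<sigma> V" and dg: "\<forall>u\<in>set us. Diagram \<sigma> (snd u \<union> V) \<in> dgs"
      unfolding Q_def by blast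
    show "snd x \<in> dgs" if "x \<in> set Y" for x using that Y dg by auto
    show "(\<Sum>x\<leftarrow>Y. fst x * extension (snd x)) = 0 \<or> expands_within Q Y"
    proof (cases "tail_strand_heads (Diagram \<sigma> {}) = {}")
      case True
      then show ?thesis using rel[OF dg] by (simp add: Y comp_def)
    next
      case False
      then obtain t ts p where f: "first_head (Diagram \<sigma> {}) t ts p" using first_head_exists by blast
      then have f: "first_head (Diagram \<sigma> U) t ts p" for U by (simp add: first_head_def)
      have "expands_within Q Y"
      proof (rule expands_withinI[where t = t and p = p and B = "set ts"])
        show "\<exists>ts'. set ts' = set ts \<and> first_head (snd x) t ts' p" if "x \<in> set Y" for x
          using that f Y by auto
        fix k e assume e: "e \<in> set ts" and k: "\<forall>x\<in>set Y. k \<notin> edges (snd x)"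
        let ?\<sigma> = "\<lambda>s. attach_list k p e (\<sigma> s)" and ?V = "insert (k, p, e) V"
        have a: "attach k p e (Diagram \<sigma> (U \<union> V)) = Diagram ?\<sigma> (U \<union> ?V)" for U by (simp add: attach_def)
        have "Diagram ?\<sigma> (snd u \<union> ?V) \<in> dgs" if "u \<in> set us" for u
          using attach_first_head(1)[OF bspec[OF dg that] f _ e, of k] k that unfolding a Y by auto
        moreover have "map (apsnd (attach k p e)) Y = ?q ?\<sigma> ?V" by (simp add: Y a)
        ultimately show "map (apsnd (attach k p e)) Y \<in> Q" unfolding Q_def by blast
      qed
      then show ?thesis ..
    qed
  qed
  then show ?thesis by (simp add: comp_def)
qed

lemma extension_AS:
  assumes "Diagram \<sigma> (insert (a, b, u) V) \<in> dgs" "Diagram \<sigma> (insert (b, a, u) V) \<in> dgs"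
  shows "extension (Diagram \<sigma> (insert (a, b, u) V)) + extension (Diagram \<sigma> (insert (b, a, u) V)) = 0"
proof -
  let ?us = "[(1 :: rat, {(a, b, u)}), (1, {(b, a, u)})]"
  have "(\<Sum>x\<leftarrow>?us. fst x * extension (Diagram \<sigma> (snd x \<union> V))) = 0"
  proof (rule extension_same_strands)
    fix \<sigma> V assume d: "\<forall>x\<in>set ?us. Diagram \<sigma> (snd x \<union> V) \<in> dgs" and t: "tail_strand_heads (Diagram \<sigma> {}) = {}"
    let ?D = "Diagram \<sigma> (insert (a, b, u) V)" and ?D' = "Diagram \<sigma> (insert (b, a, u) V)"
    have "pairing extension (basis ?D + basis ?D') = 0"
      by (rule extension_relator_base[OF relators.AS[OF refl refl] keys_combination(1)])
        (use d t in \<open>auto simp: tail_strand_heads_Diagram\<close>)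
    then show "(\<Sum>x\<leftarrow>?us. fst x * extension (Diagram \<sigma> (snd x \<union> V))) = 0" by simp
  qed (use assms in simp)
  then show ?thesis by simp
qed

lemma extension_IHX:
  assumes "Diagram \<sigma> ({(p, q, m), (m, r, u)} \<union> V) \<in> dgs" "Diagram \<sigma> ({(q, r, m), (m, p, u)} \<union> V) \<in> dgs"
    "Diagram \<sigma> ({(r, p, m), (m, q, u)} \<union> V) \<in> dgs"
  shows "extension (Diagram \<sigma> ({(p, q, m), (m, r, u)} \<union> V)) +
    extension (Diagram \<sigma> ({(q, r, m), (m, p, u)} \<union> V)) +
    extension (Diagram \<sigma> ({(r, p, m), (m, q, u)} \<union> V)) = 0"
proof -
  let ?us = "[(1 :: rat, {(p, q, m), (m, r, u)}), (1, {(q, r, m), (m, p, u)}), (1, {(r, p, m), (m, q, u)})]"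
  have "(\<Sum>x\<leftarrow>?us. fst x * extension (Diagram \<sigma> (snd x \<union> V))) = 0"
  proof (rule extension_same_strands)
    fix \<sigma> V assume d: "\<forall>x\<in>set ?us. Diagram \<sigma> (snd x \<union> V) \<in> dgs" and t: "tail_strand_heads (Diagram \<sigma> {}) = {}"
    have "pairing extension (basis (Diagram \<sigma> ({(p, q, m), (m, r, u)} \<union> V)) +
        basis (Diagram \<sigma> ({(q, r, m), (m, p, u)} \<union> V)) + basis (Diagram \<sigma> ({(r, p, m), (m, q, u)} \<union> V))) = 0"
      by (rule extension_relator_base[OF relators.IHX[OF refl refl refl] keys_combination(3)])
        (use d t in \<open>auto simp: tail_strand_heads_Diagram\<close>)
    then show "(\<Sum>x\<leftarrow>?us. fst x * extension (Diagram \<sigma> (snd x \<union> V))) = 0" by simp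
  qed (use assms in simp)
  then show ?thesis by simp
qed

text \<open>The two tails are neighbours, so on their strand the lowest head is below both or above
  both, and exchanging them at most permutes the tails under it.\<close>

lemma first_head_permute:
  assumes f: "first_head (spliced \<sigma> s xs [Tail d, Tail e] ys V) t ts p"
  shows "\<exists>ts'. set ts' = set ts \<and> first_head (spliced \<sigma> s xs [Tail e, Tail d] ys V) t ts' p"
proof (cases "s = Inr t")
  case False
  then show ?thesis using f by (auto simp: first_head_def)
next
  case True
  with f obtain zs where z: "map Tail ts @ Head p # zs = xs @ [Tail d, Tail e] @ ys"
    by (auto simp: first_head_def)
  show ?thesis
  proof (cases "\<exists>q. Head q \<in> set xs")
    case True
    then obtain ts0 q zs0 where x: "xs = map Tail ts0 @ Head q # zs0"
      using split_at_first_head[of _ xs] by blast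
    have "map Tail ts @ Head p # zs = map Tail ts0 @ Head q # (zs0 @ [Tail d, Tail e] @ ys)"
      using z x by simp
    from map_Tail_Head_eq[OF this] have "ts0 = ts" "q = p" by auto
    then show ?thesis using x \<open>s = Inr t\<close> by (auto simp: first_head_def)
  next
    case False
    then obtain ts0 where x: "xs = map Tail ts0" using all_tails[of xs] by blast
    have "Head p \<in> set (xs @ [Tail d, Tail e] @ ys)" unfolding z[symmetric] by simp
    then have "Head p \<in> set ys" using x by auto
    then obtain ts1 q zs1 where y: "ys = map Tail ts1 @ Head q # zs1"
      using split_at_first_head[of p ys] by blast
    have "map Tail ts @ Head p # zs = map Tail (ts0 @ [d, e] @ ts1) @ Head q # zs1"
      using z x y by simp
    from map_Tail_Head_eq[OF this] have "ts = ts0 @ [d, e] @ ts1" "p = q" by auto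
    moreover have "first_head (spliced \<sigma> s xs [Tail e, Tail d] ys V) t (ts0 @ [e, d] @ ts1) q"
      using x y \<open>s = Inr t\<close> by (auto simp: first_head_def)
    ultimately show ?thesis by (intro exI[of _ "ts0 @ [e, d] @ ts1"]) auto
  qed
qed

lemma tail_strand_heads_local:
  "tail_strand_heads (Diagram (\<sigma>(s := L)) V) =
    {p. (\<exists>t. Inr t \<noteq> s \<and> Head p \<in> set (\<sigma> (Inr t))) \<or> (s \<in> range Inr \<and> Head p \<in> set L)}"
  unfolding tail_strand_heads_def by (auto split: if_splits)

lemma extension_TC:
  assumes "spliced \<sigma> s xs [Tail d, Tail e] ys V \<in> dgs"
    "spliced \<sigma> s xs [Tail e, Tail d] ys V \<in> dgs"
  shows "extension (spliced \<sigma> s xs [Tail d, Tail e] ys V) =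
    extension (spliced \<sigma> s xs [Tail e, Tail d] ys V)"
proof -
  let ?D = "\<lambda>\<sigma> xs ys d e V. spliced \<sigma> s xs [Tail d, Tail e] ys V"
  define Q where "Q = {[(1 :: rat, ?D \<sigma> xs ys d e V), (-1, ?D \<sigma> xs ys e d V)] | \<sigma> xs ys d e V.
    ?D \<sigma> xs ys d e V \<in> dgs \<and> ?D \<sigma> xs ys e d V \<in> dgs}"
  let ?q = "[(1, ?D \<sigma> xs ys d e V), (-1, ?D \<sigma> xs ys e d V)]"
  have "(\<Sum>x\<leftarrow>?q. fst x * extension (snd x)) = 0"
  proof (rule relation_by_expansion[of _ Q])
    show "?q \<in> Q" using assms unfolding Q_def by blast
    fix Y assume "Y \<in> Q"
    then obtain \<sigma> xs ys d e V where q: "Y = [(1, ?D \<sigma> xs ys d e V), (-1, ?D \<sigma> xs ys e d V)]"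
      and dg: "?D \<sigma> xs ys d e V \<in> dgs" "?D \<sigma> xs ys e d V \<in> dgs"
      unfolding Q_def by blast
    show "snd x \<in> dgs" if "x \<in> set Y" for x using that q dg by auto
    show "(\<Sum>x\<leftarrow>Y. fst x * extension (snd x)) = 0 \<or> expands_within Q Y"
    proof (cases "tail_strand_heads (?D \<sigma> xs ys d e V) = {}")
      case True
      have "basis (?D \<sigma> xs ys d e V) - basis (?D \<sigma> xs ys e d V) \<in> relators (H <+> T) n"
        by (rule relators.TC[OF refl refl]) (use dg in simp)
      moreover have "tail_strand_heads (?D \<sigma> xs ys e d V) = tail_strand_heads (?D \<sigma> xs ys d e V)"
        unfolding tail_strand_heads_local by auto
      ultimately have "pairing extension (basis (?D \<sigma> xs ys d e V) - basis (?D \<sigma> xs ys e d V)) = 0"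
        using True by (intro extension_relator_base[OF _ keys_combination(2)]) auto
      then show ?thesis by (simp add: q)
    next
      case False
      then obtain t ts p where f: "first_head (?D \<sigma> xs ys d e V) t ts p" using first_head_exists by blast
      then obtain ts' where f': "first_head (?D \<sigma> xs ys e d V) t ts' p" and ts': "set ts' = set ts"
        using first_head_permute[OF f] by blast
      have "expands_within Q Y"
      proof (rule expands_withinI[where t = t and p = p and B = "set ts"])
        show "\<exists>ts'. set ts' = set ts \<and> first_head (snd x) t ts' p" if "x \<in> set Y" for x
          using that f f' ts' q by auto
        fix k b assume b: "b \<in> set ts" and "\<forall>x\<in>set Y. k \<notin> edges (snd x)"
        then have k: "k \<notin> edges (?D \<sigma> xs ys d e V)" "k \<notin> edges (?D \<sigma> xs ys e d V)"
          by (simp_all add: q)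
        \<comment> \<open>If \<open>b\<close> is one of the two exchanged tails, attaching merely
          renames that tail to \<open>k\<close>; the window still consists of two adjacent
          tails.\<close>
        let ?f = "id(b := k)"
        let ?A = "\<lambda>d e. ?D (\<lambda>s. attach_list k p b (\<sigma> s)) (attach_list k p b xs) (attach_list k p b ys)
          d e (insert (k, p, b) V)"
        have a: "attach k p b (?D \<sigma> xs ys d e V) = ?A (?f d) (?f e)"
          "attach k p b (?D \<sigma> xs ys e d V) = ?A (?f e) (?f d)"
          unfolding attach_Diagram_upd by simp_all
        have "?A (?f d) (?f e) \<in> dgs" "?A (?f e) (?f d) \<in> dgs"
          using attach_first_head(1)[OF dg(1) f k(1) b] attach_first_head(1)[OF dg(2) f' k(2), of b] b ts'
          unfolding a by blast+
        then show "map (apsnd (attach k p b)) Y \<in> Q"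
          unfolding q Q_def list.map apsnd_conv a by blast
      qed
      then show ?thesis ..
    qed
  qed
  then show ?thesis by simp
qed

text \<open>The lowest head of a tail strand, provided it lies away from the strand \<open>s\<close>
  of the window or below the window on it. Such a head is common to all terms of a local relation,
  whatever the window contains.\<close>

definition outer_first_head ::
    "('h + 't \<Rightarrow> nat arrow_end list) \<Rightarrow> 'h + 't \<Rightarrow> nat arrow_end list \<Rightarrow> 't \<Rightarrow> nat list \<Rightarrow> nat \<Rightarrow> bool" where
  "outer_first_head \<sigma> s xs t ts p \<longleftrightarrow>
    (\<exists>zs. (if s = Inr t then xs else \<sigma> (Inr t)) = map Tail ts @ Head p # zs)"

lemma outer_first_headD:
  "outer_first_head \<sigma> s xs t ts p \<Longrightarrow> first_head (spliced \<sigma> s xs w ys V) t ts p"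
  by (auto simp: outer_first_head_def first_head_def split: if_splits)

lemma outer_first_head_exists:
  assumes "s = Inr t \<Longrightarrow> Head q \<in> set xs" "s \<noteq> Inr t \<Longrightarrow> Head q \<in> set (\<sigma> (Inr t))"
  shows "\<exists>t ts p. outer_first_head \<sigma> s xs t ts p"
proof -
  have "Head q \<in> set (if s = Inr t then xs else \<sigma> (Inr t))" using assms by simp
  from split_at_first_head[OF this] show ?thesis unfolding outer_first_head_def by blast
qed

lemma outer_first_head_neq:
  assumes "outer_first_head \<sigma> s xs t ts p" "spliced \<sigma> s xs w ys V \<in> dgs" "x \<in> set w"
  shows "x \<noteq> Head p" "b \<in> set ts \<Longrightarrow> x \<noteq> Tail b"
  using local_end_neq[OF assms(2,3), of "Head p" "Inr t"] local_end_neq[OF assms(2,3), of "Tail b" "Inr t"]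
    assms(1) unfolding outer_first_head_def by (auto split: if_splits)

lemma no_outer_first_head:
  assumes "\<not> (\<exists>t ts p. outer_first_head \<sigma> s xs t ts p)"
  shows "(\<exists>t ts. s = Inr t \<and> xs = map Tail ts) \<or>
    (\<forall>w ys V. tail_strand_heads (spliced \<sigma> s xs w ys V) = {})"
proof (cases s)
  case (Inr t)
  then have "Head q \<notin> set xs" for q
    using assms outer_first_head_exists[of s t q xs \<sigma>] by auto
  then show ?thesis using Inr all_tails[of xs] by blast
next
  case (Inl h)
  then have "Head q \<notin> set (\<sigma> (Inr t))" for q t
    using assms outer_first_head_exists[of s t q xs \<sigma>] by auto
  then show ?thesis using Inl by (auto simp: tail_strand_heads_local)
qed

text \<open>Sliding \<open>p\<close> down from above \<open>e\<close> passes one tail more than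
  sliding it from below \<open>e\<close>. The extra summand is the third diagram with a minus sign;
  the others coincide, because \<open>attach\<close> removes \<open>p\<close> from either
  position.\<close>

lemma extension_STU2_direct:
  assumes D1: "Diagram (\<sigma>(Inr t := map Tail ts @ [Head p, Tail e] @ ys)) V \<in> dgs" (is "?D1 \<in> _")
    and D2: "Diagram (\<sigma>(Inr t := map Tail ts @ [Tail e, Head p] @ ys)) V \<in> dgs" (is "?D2 \<in> _")
    and D3: "Diagram (\<sigma>(Inr t := map Tail ts @ [Tail m] @ ys)) (insert (m, p, e) V) \<in> dgs" (is "?D3 \<in> _")
  shows "extension ?D1 - extension ?D2 - extension ?D3 = 0"
proof -
  have m1: "m \<notin> edges ?D1" by (rule STU2_fresh[OF D1 _ D3]) auto
  have m2: "m \<notin> edges ?D2" by (rule STU2_fresh[OF D2 _ D3]) auto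
  have f1: "first_head ?D1 t ts p" by (simp add: first_head_def)
  have "strand ?D2 (Inr t) = map Tail (ts @ [e]) @ Head p # ys" by simp
  then have f2: "first_head ?D2 t (ts @ [e]) p" unfolding first_head_def by blast
  have e: "e \<notin> set ts" using distinct_strand[OF D1, of "Inr t"] by auto
  have eq: "attach m p b ?D1 = attach m p b ?D2" if "b \<in> set ts" for b
    unfolding attach_Diagram_upd by simp
  have "attach m p e ?D2 = ?D3" by (rule attach_local[OF D2 refl]) simp
  moreover have "(\<Sum>b\<in>set ts. extension (attach m p b ?D1)) = (\<Sum>b\<in>set ts. extension (attach m p b ?D2))"
    using eq by (intro sum.cong) simp_all
  ultimately show ?thesis
    using extension_expand[OF D1 f1 m1] extension_expand[OF D2 f2 m2] e
    by simp
qed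

text \<open>Common frame of \<open>STU1\<close> and \<open>STU2\<close>: the terms differ in a
  window and one vertex \<open>v\<close>. Expansion at a head outside the window leaves
  \<open>x\<close>, \<open>y\<close>, \<open>z\<close> and \<open>v\<close> alone, so
  \<open>direct\<close> only concerns a window on a tail strand with nothing but tails under
  it.\<close>

lemma extension_STU:
  fixes x y z :: "nat arrow_end" and s :: "'h + 't"
  assumes "spliced \<sigma> s xs [x, y] ys V \<in> dgs" "spliced \<sigma> s xs [y, x] ys V \<in> dgs"
    "spliced \<sigma> s xs [z] ys (insert v V) \<in> dgs"
    and rel: "\<And>\<sigma> xs ys V. spliced \<sigma> s xs [x, y] ys V \<in> dgs \<Longrightarrow>
      spliced \<sigma> s xs [y, x] ys V \<in> dgs \<Longrightarrow> spliced \<sigma> s xs [z] ys (insert v V) \<in> dgs \<Longrightarrow>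
      basis (spliced \<sigma> s xs [x, y] ys V) - basis (spliced \<sigma> s xs [y, x] ys V)
      - basis (spliced \<sigma> s xs [z] ys (insert v V)) \<in> relators (H <+> T) n"
    and direct: "\<And>\<sigma> t ts ys V. s = Inr t \<Longrightarrow> Diagram (\<sigma>(Inr t := map Tail ts @ [x, y] @ ys)) V \<in> dgs \<Longrightarrow>
      Diagram (\<sigma>(Inr t := map Tail ts @ [y, x] @ ys)) V \<in> dgs \<Longrightarrow>
      Diagram (\<sigma>(Inr t := map Tail ts @ [z] @ ys)) (insert v V) \<in> dgs \<Longrightarrow>
      extension (Diagram (\<sigma>(Inr t := map Tail ts @ [x, y] @ ys)) V)
      - extension (Diagram (\<sigma>(Inr t := map Tail ts @ [y, x] @ ys)) V)
      - extension (Diagram (\<sigma>(Inr t := map Tail ts @ [z] @ ys)) (insert v V)) = 0"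
  shows "extension (spliced \<sigma> s xs [x, y] ys V) - extension (spliced \<sigma> s xs [y, x] ys V)
    - extension (spliced \<sigma> s xs [z] ys (insert v V)) = 0"
proof -
  let ?D = "\<lambda>w \<sigma> xs ys V. spliced \<sigma> s xs w ys V"
  let ?q = "\<lambda>\<sigma> xs ys V. [(1 :: rat, ?D [x, y] \<sigma> xs ys V), (-1, ?D [y, x] \<sigma> xs ys V), (-1, ?D [z] \<sigma> xs ys (insert v V))]"
  define Q where "Q = {?q \<sigma> xs ys V | \<sigma> xs ys V. ?D [x, y] \<sigma> xs ys V \<in> dgs \<and> ?D [y, x] \<sigma> xs ys V \<in> dgs \<and>
    ?D [z] \<sigma> xs ys (insert v V) \<in> dgs}"
  have "(\<Sum>x\<leftarrow>?q \<sigma> xs ys V. fst x * extension (snd x)) = 0"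
  proof (rule relation_by_expansion[of _ Q])
    show "?q \<sigma> xs ys V \<in> Q" using assms(1-3) unfolding Q_def by blast
    fix Y assume "Y \<in> Q"
    then obtain \<sigma> xs ys V where q: "Y = ?q \<sigma> xs ys V"
      and dg: "?D [x, y] \<sigma> xs ys V \<in> dgs" "?D [y, x] \<sigma> xs ys V \<in> dgs" "?D [z] \<sigma> xs ys (insert v V) \<in> dgs"
      unfolding Q_def by blast
    show "snd x \<in> dgs" if "x \<in> set Y" for x using that q dg by auto
    show "(\<Sum>x\<leftarrow>Y. fst x * extension (snd x)) = 0 \<or> expands_within Q Y"
    proof (cases "\<exists>t ts p. outer_first_head \<sigma> s xs t ts p")
      case True
      then obtain t ts d where o: "outer_first_head \<sigma> s xs t ts d" by blast
      note f = outer_first_headD[OF o]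
      have "expands_within Q Y"
      proof (rule expands_withinI[where t = t and p = d and B = "set ts"])
        show "\<exists>ts'. set ts' = set ts \<and> first_head (snd u) t ts' d" if "u \<in> set Y" for u
          using that f[of "[x, y]" ys V] f[of "[y, x]" ys V] f[of "[z]" ys "insert v V"] unfolding q by auto
        fix k b assume b: "b \<in> set ts" and "\<forall>x\<in>set Y. k \<notin> edges (snd x)"
        then have k: "k \<notin> edges (?D [x, y] \<sigma> xs ys V)" "k \<notin> edges (?D [y, x] \<sigma> xs ys V)"
          "k \<notin> edges (?D [z] \<sigma> xs ys (insert v V))"
          by (simp_all add: q)
        \<comment> \<open>Ends occur once, so neither the sliding head nor the tail it meets is in
          the window.\<close>
        have ne: "x \<noteq> Head d" "y \<noteq> Head d" "z \<noteq> Head d" "x \<noteq> Tail b" "y \<noteq> Tail b" "z \<noteq> Tail b"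
          using outer_first_head_neq(1)[OF o dg(1), of x] outer_first_head_neq(1)[OF o dg(1), of y]
            outer_first_head_neq(1)[OF o dg(3), of z] outer_first_head_neq(2)[OF o dg(1), of x b]
            outer_first_head_neq(2)[OF o dg(1), of y b] outer_first_head_neq(2)[OF o dg(3), of z b] b
          by auto
        let ?A = "\<lambda>w. ?D w (\<lambda>s. attach_list k d b (\<sigma> s)) (attach_list k d b xs) (attach_list k d b ys)"
        let ?V = "insert (k, d, b) V"
        have w: "attach_list k d b [x, y] = [x, y]" "attach_list k d b [y, x] = [y, x]" "attach_list k d b [z] = [z]"
          using ne by (auto intro!: attach_list_id)
        have a: "attach k d b (?D [x, y] \<sigma> xs ys V) = ?A [x, y] ?V"
          "attach k d b (?D [y, x] \<sigma> xs ys V) = ?A [y, x] ?V"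
          "attach k d b (?D [z] \<sigma> xs ys (insert v V)) = ?A [z] (insert v ?V)"
          unfolding attach_Diagram_upd attach_list_simps(4) w by (simp_all only: insert_commute)
        have "?A [x, y] ?V \<in> dgs" "?A [y, x] ?V \<in> dgs" "?A [z] (insert v ?V) \<in> dgs"
          using attach_first_head(1)[OF dg(1) f k(1) b] attach_first_head(1)[OF dg(2) f k(2) b]
            attach_first_head(1)[OF dg(3) f k(3) b]
          unfolding a .
        then show "map (apsnd (attach k d b)) Y \<in> Q"
          unfolding q Q_def list.map apsnd_conv a by blast
      qed
      then show ?thesis ..
    next
      case False
      \<comment> \<open>Either the window sits on a tail strand directly above tails, or no head
        lies on a tail strand and the hypothesis on \<open>W\<close> decides.\<close>
      from no_outer_first_head[OF this] show ?thesis
      proof (elim disjE exE conjE)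
        fix t ts assume "s = Inr t" "xs = map Tail ts"
        then show ?thesis using direct[of t \<sigma> ts ys V] dg unfolding q by simp
      next
        assume t: "\<forall>w ys V. tail_strand_heads (?D w \<sigma> xs ys V) = {}"
        have "pairing extension (basis (?D [x, y] \<sigma> xs ys V) - basis (?D [y, x] \<sigma> xs ys V)
            - basis (?D [z] \<sigma> xs ys (insert v V))) = 0"
          by (rule extension_relator_base[OF rel[OF dg] keys_combination(4)])
            (use t in \<open>auto simp del: append_Cons append_Nil\<close>)
        then show ?thesis by (simp add: q)
      qed
    qed
  qed
  then show ?thesis by simp
qed

lemma extension_STU2:
  assumes "spliced \<sigma> s xs [Head p, Tail e] ys V \<in> dgs"
    "spliced \<sigma> s xs [Tail e, Head p] ys V \<in> dgs"
    "spliced \<sigma> s xs [Tail m] ys (insert (m, p, e) V) \<in> dgs"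
  shows "extension (spliced \<sigma> s xs [Head p, Tail e] ys V) -
    extension (spliced \<sigma> s xs [Tail e, Head p] ys V) -
    extension (spliced \<sigma> s xs [Tail m] ys (insert (m, p, e) V)) = 0"
  using assms
  by (rule extension_STU)
    ((rule relators.STU2[OF refl refl refl]; simp), (rule extension_STU2_direct; simp))

text \<open>Exchanging the names \<open>m\<close> and \<open>m'\<close> is an isomorphism of
  diagrams, which the weight does not see. This matches the two orders in which \<open>STU1\<close>
  slides its heads.\<close>

lemma extension_swap_fresh:
  assumes "D \<in> dgs" "Head p \<in> ends D" "Head q \<in> ends D" "p \<noteq> q" "Tail e \<in> ends D" "Tail e' \<in> ends D"
    and "e \<noteq> e'" "m \<notin> edges D" "m' \<notin> edges D" "m \<noteq> m'"
  shows "extension (attach m q e' (attach m' p e D)) = extension (attach m' q e' (attach m p e D))"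
proof -
  let ?f = "id(m := m', m' := m)"
  have i: "inj_on ?f A" for A using assms(10) by (auto simp: inj_on_def)
  have ne: "p \<noteq> m" "p \<noteq> m'" "q \<noteq> m" "q \<noteq> m'" "e \<noteq> m" "e \<noteq> m'" "e' \<noteq> m" "e' \<noteq> m'"
    using assms edge_of_end(3,4)[of _ D] by auto
  have r: "rename ?f D = D" using assms(8,9) by (intro rename_id_on) auto
  have en: "Head q \<in> ends (attach m p e D)" "Tail e' \<in> ends (attach m p e D)"
    using assms by (auto simp: ends_attach)
  have 1: "attach m p e D \<in> dgs" using assms by (intro attach_in_diagrams[OF fin])
  have "m' \<notin> edges (attach m p e D)" using assms by (simp add: edges_attach)
  then have 2: "attach m' q e' (attach m p e D) \<in> dgs" by (rule attach_in_diagrams[OF fin 1 en(2,1)])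
  have "rename ?f (attach m' q e' (attach m p e D)) = attach m q e' (attach m' p e D)"
    using assms ne r en i assms(10) by (simp add: rename_attach)
  then show ?thesis using extension_rename[OF 2 i] by simp
qed

lemma sum_off_diagonal_swap:
  "finite A \<Longrightarrow> (\<Sum>x\<in>A. \<Sum>y\<in>A - {x}. g x y) = (\<Sum>x\<in>A. \<Sum>y\<in>A - {x}. g y x)" for g :: "'b \<Rightarrow> 'b \<Rightarrow> rat"
proof -
  assume A: "finite A"
  have e: "A - {x} = {y \<in> A. x \<noteq> y}" "A - {x} = {y \<in> A. y \<noteq> x}" for x by auto
  have "(\<Sum>x\<in>A. \<Sum>y\<in>A - {x}. g x y) = (\<Sum>y\<in>A. \<Sum>x\<in>{x \<in> A. x \<noteq> y}. g x y)"
    unfolding e(1) by (rule sum.swap_restrict[OF A A])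
  then show ?thesis unfolding e(2) .
qed

lemma attach_list_remove_absent:
  "Head p \<notin> set L \<Longrightarrow> Head p' \<notin> set L \<Longrightarrow> attach_list m p e L = attach_list m p' e L"
  unfolding attach_list_def by (rule arg_cong[of _ _ "map _"], rule filter_cong) auto

text \<open>\<open>q\<close> is attached to the tail just created for \<open>p\<close>. On the
  strands only the loss of both heads and the new name of the tail are visible, which is symmetric
  in \<open>p\<close> and \<open>q\<close>.\<close>

lemma attach_list_twice:
  "Tail m \<notin> set L \<Longrightarrow>
    attach_list m' q m (attach_list m p e L) = attach_list m' p e (filter (\<lambda>x. x \<noteq> Head q) L)"
  by (induction L) (auto simp: attach_list_def)

text \<open>Read vertices as brackets. Sliding both heads expands the first two diagrams over
  ordered pairs of tails. Where both heads meet one tail, the first gives \<open>[[k, q], p]\<close>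
  and the second \<open>[[k, p], q]\<close>; the third gives \<open>[k, [p, q]]\<close> after a
  single slide, hence with the opposite sign. Their alternating sum vanishes by Jacobi and
  antisymmetry. Pairs of different tails cancel between the first two diagrams.\<close>

lemma extension_STU1_direct:
  assumes D1: "Diagram (\<sigma>(Inr t := map Tail ts @ [Head p, Head q] @ ys)) V \<in> dgs" (is "?D1 \<in> _")
    and D2: "Diagram (\<sigma>(Inr t := map Tail ts @ [Head q, Head p] @ ys)) V \<in> dgs" (is "?D2 \<in> _")
    and D3: "Diagram (\<sigma>(Inr t := map Tail ts @ [Head m] @ ys)) (insert (p, q, m) V) \<in> dgs" (is "?D3 \<in> _")
  shows "extension ?D1 - extension ?D2 - extension ?D3 = 0"
proof -
  have m1: "m \<notin> edges ?D1" by (rule STU1_fresh[OF D1 D3])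
  have "ends ?D2 = ends ?D1"
    unfolding ends_def by (rule arg_cong[of _ _ Union], rule image_cong) auto
  then have ed: "edges ?D2 = edges ?D1" by (rule edges_cong) simp
  have m2: "m \<notin> edges ?D2" using m1 ed by simp
  obtain k where k: "k \<notin> edges ?D1" "k \<notin> edges ?D3"
    using exists_fresh_edge[OF fin D1 finite_edges[OF fin D3]] by blast
  have k2: "k \<notin> edges ?D2" using k ed by simp
  have f1: "first_head ?D1 t ts p" and f2: "first_head ?D2 t ts q" and f3: "first_head ?D3 t ts m"
    by (simp_all add: first_head_def)
  have pq: "p \<noteq> q" using distinct_strand[OF D1, of "Inr t"] by auto
  have p: "Head p \<in> ends ?D1" and q: "Head q \<in> ends ?D1" by (auto simp: ends_def)
  have e: "Tail e \<in> ends ?D1" "e \<in> edges ?D1" "e \<noteq> m" "e \<noteq> k" if "e \<in> set ts" for e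
  proof -
    show "Tail e \<in> ends ?D1" using first_headD(5)[OF f1 that] .
    then show "e \<in> edges ?D1" by (rule edge_of_end(3))
    then show "e \<noteq> m" "e \<noteq> k" using m1 k by auto
  qed
  have km: "k \<noteq> m" using k(2) edge_of_triv(3)[of p q m ?D3] by auto
  have mts: "m \<notin> set ts" using e(3) by blast
  have set_upd: "set (map (id(e := m)) ts) = insert m (set ts - {e})" if "e \<in> set ts" for e
    using that by auto
  \<comment> \<open>After \<open>p\<close> has been attached to \<open>e\<close>, the tail of
    \<open>m\<close> stands in place of that of \<open>e\<close>; the term where \<open>q\<close>
    meets \<open>m\<close> is the one where both heads meet the same tail.\<close>
  have x1: "extension (attach m p e ?D1) =
      - (extension (attach k q m (attach m p e ?D1)) + (\<Sum>b\<in>set ts - {e}. extension (attach k q b (attach m p e ?D1))))"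
    if "e \<in> set ts" for e
  proof -
    note A = attach_first_head[OF D1 f1 m1 that]
    have f: "first_head (attach m p e ?D1) t (map (id(e := m)) ts) q"
      using pq by (simp add: first_head_def)
    have "k \<notin> edges (attach m p e ?D1)" using A(3) k km by simp
    from extension_expand[OF A(1) f this] show ?thesis unfolding set_upd[OF that] using mts by simp
  qed
  have x2: "extension (attach m q e ?D2) =
      - (extension (attach k p m (attach m q e ?D2)) + (\<Sum>b\<in>set ts - {e}. extension (attach k p b (attach m q e ?D2))))"
    if "e \<in> set ts" for e
  proof -
    note A = attach_first_head[OF D2 f2 m2 that]
    have f: "first_head (attach m q e ?D2) t (map (id(e := m)) ts) p"
      using pq by (simp add: first_head_def)
    have "k \<notin> edges (attach m q e ?D2)" using A(3) k2 km by simp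
    from extension_expand[OF A(1) f this] show ?thesis unfolding set_upd[OF that] using mts by simp
  qed
  \<comment> \<open>Heads on different tails: the two slides commute, up to the question which of
    them uses which new edge.\<close>
  have off: "extension (attach k p b (attach m q e ?D2)) = extension (attach k q e (attach m p b ?D1))"
    if "e \<in> set ts" "b \<in> set ts" "e \<noteq> b" for e b
  proof -
    have "attach k p b (attach m q e ?D2) = attach k p b (attach m q e ?D1)"
      unfolding attach_Diagram_upd using pq by simp
    also have "\<dots> = attach m q e (attach k p b ?D1)"
      using that e by (intro attach_commute) auto
    finally have "extension (attach k p b (attach m q e ?D2)) = extension (attach m q e (attach k p b ?D1))"
      by simp
    also have "\<dots> = extension (attach k q e (attach m p b ?D1))"
      using that e p q pq m1 k km by (intro extension_swap_fresh[OF D1]) auto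
    finally show ?thesis .
  qed
  have diag: "extension (attach k q m (attach m p e ?D1)) - extension (attach k p m (attach m q e ?D2))
      + extension (attach k m e ?D3) = 0" if "e \<in> set ts" for e
  proof -
    let ?K = "\<lambda>r. attach_list k q m (attach_list m p e (strand ?D1 r))"
    note A = attach_first_head[OF D1 f1 m1 that] and B = attach_first_head[OF D2 f2 m2 that]
    have tm: "Tail m \<notin> set (strand ?D1 r)" for r using m1 edge_of_end(1)[of m ?D1 r] by blast
    have hm: "Head m \<notin> set (strand ?D1 r)" for r using m1 edge_of_end(2)[of m ?D1 r] by blast
    \<comment> \<open>In all three cases the strands lose the heads of the window and carry
      \<open>Tail k\<close> in place of \<open>Tail e\<close>; the diagrams differ in two vertices
      only.\<close>
    have X: "attach k q m (attach m p e ?D1) = Diagram ?K (insert (k, q, m) (insert (m, p, e) V))"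
      by (simp add: attach_def)
    have "attach_list k p m (attach_list m q e (strand ?D2 r)) = ?K r" for r
    proof (cases "r = Inr t")
      case True
      have "Tail m \<notin> set (map Tail ts)" "Tail m \<notin> set ys" using tm[of "Inr t"] by auto
      then show ?thesis using pq True
        by (simp add: attach_list_twice) (simp add: attach_list_def conj_commute)
    next
      case False
      then have "Tail m \<notin> set (\<sigma> r)" using tm[of r] by simp
      then show ?thesis using False by (simp add: attach_list_twice) (simp add: attach_list_def conj_commute)
    qed
    then have Y: "attach k p m (attach m q e ?D2) = Diagram ?K (insert (k, p, m) (insert (m, q, e) V))"
      by (simp add: attach_def)
    have "attach_list k m e (strand ?D3 r) = ?K r" for r
    proof (cases "r = Inr t")
      case True
      have "Tail m \<notin> set ys" "Head m \<notin> set ys" using tm[of "Inr t"] hm[of "Inr t"] by auto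
      moreover have "Head p \<notin> set ys" "Head q \<notin> set ys" using distinct_strand[OF D1, of "Inr t"] by auto
      moreover from this have "filter (\<lambda>x. x \<noteq> Head q) ys = ys" by (auto simp: filter_id_conv)
      moreover have "attach_list k q m (map (Tail \<circ> id(e := m)) ts) = map (Tail \<circ> id(e := k)) ts"
        using mts by (induction ts) auto
      ultimately show ?thesis using pq True mts attach_list_remove_absent[of m ys p k e]
        by (auto simp: attach_list_twice)
    next
      case False
      have "Head p \<notin> set (\<sigma> r)" "Head q \<notin> set (\<sigma> r)"
        using disjoint_strands[OF D1, of _ r "Inr t"] False by auto
      moreover from this have "filter (\<lambda>x. x \<noteq> Head q) (\<sigma> r) = \<sigma> r" by (auto simp: filter_id_conv)
      ultimately show ?thesis using tm[of r] hm[of r] False attach_list_remove_absent[of m "\<sigma> r" p k e]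
        by (simp add: attach_list_twice)
    qed
    then have Z: "attach k m e ?D3 = Diagram ?K (insert (k, m, e) (insert (p, q, m) V))"
      by (simp add: attach_def)
    have hq: "Head q \<in> ends (attach m p e ?D1)" "Tail m \<in> ends (attach m p e ?D1)"
      using pq q e(1)[OF that] by (auto simp: ends_attach)
    have hp: "Head p \<in> ends (attach m q e ?D2)" "Tail m \<in> ends (attach m q e ?D2)"
      using pq p e(1)[OF that] \<open>ends ?D2 = ends ?D1\<close> by (auto simp: ends_attach)
    have Xd: "Diagram ?K (insert (k, q, m) (insert (m, p, e) V)) \<in> dgs"
      using attach_in_diagrams[OF fin A(1) hq(2,1), of k] A(3) k(1) km unfolding X by simp
    have Yd: "Diagram ?K (insert (k, p, m) (insert (m, q, e) V)) \<in> dgs"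
      using attach_in_diagrams[OF fin B(1) hp(2,1), of k] B(3) k2 km unfolding Y by simp
    have Zd: "Diagram ?K (insert (k, m, e) (insert (p, q, m) V)) \<in> dgs"
      using attach_first_head(1)[OF D3 f3 k(2) that] unfolding Z .
    have kV: "(k, a, b) \<notin> V" for a b using k(1) edge_of_triv(1)[of k a b ?D1] by auto
    have kp: "k \<noteq> p" using k p edge_of_end(4)[of p ?D1] by auto
    \<comment> \<open>\<open>IHX\<close> in the form
      \<open>[[p, q], k] + [[q, k], p] + [[k, p], q]\<close> needs the flips of two of the vertices
      at hand.\<close>
    have Xd': "Diagram ?K (insert (q, k, m) (insert (m, p, e) V)) \<in> dgs"
      by (rule flip_in_diagrams[OF fin Xd]) (use km kV in auto)
    have Zd': "Diagram ?K (insert (m, k, e) (insert (p, q, m) V)) \<in> dgs"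
      by (rule flip_in_diagrams[OF fin Zd]) (use kp kV in auto)
    have "extension (Diagram ?K (insert (p, q, m) (insert (m, k, e) V))) +
        extension (Diagram ?K (insert (q, k, m) (insert (m, p, e) V))) +
        extension (Diagram ?K (insert (k, p, m) (insert (m, q, e) V))) = 0"
      using extension_IHX[of ?K p q m k e V] Xd' Yd Zd' by (simp add: insert_commute)
    then show ?thesis
      using extension_AS[OF Xd Xd'] extension_AS[OF Zd Zd']
      unfolding X Y Z by (simp add: insert_commute)
  qed
  let ?g = "\<lambda>e b. extension (attach k q b (attach m p e ?D1))"
  have "extension ?D1 = (\<Sum>e\<in>set ts. extension (attach k q m (attach m p e ?D1)) + (\<Sum>b\<in>set ts - {e}. ?g e b))"
    unfolding extension_expand[OF D1 f1 m1] sum_negf[symmetric] using x1 by (intro sum.cong) simp_all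
  also have "\<dots> = (\<Sum>e\<in>set ts. extension (attach k q m (attach m p e ?D1))) + (\<Sum>e\<in>set ts. \<Sum>b\<in>set ts - {e}. ?g e b)"
    by (rule sum.distrib)
  finally have 1: "extension ?D1 = \<dots>" .
  have off': "(\<Sum>b\<in>set ts - {e}. extension (attach k p b (attach m q e ?D2))) = (\<Sum>b\<in>set ts - {e}. ?g b e)"
    if "e \<in> set ts" for e
    using that by (intro sum.cong refl off) auto
  have "extension ?D2 = (\<Sum>e\<in>set ts. extension (attach k p m (attach m q e ?D2)) + (\<Sum>b\<in>set ts - {e}. ?g b e))"
    unfolding extension_expand[OF D2 f2 m2] sum_negf[symmetric] using x2 off' by (intro sum.cong) simp_all
  also have "\<dots> = (\<Sum>e\<in>set ts. extension (attach k p m (attach m q e ?D2))) + (\<Sum>e\<in>set ts. \<Sum>b\<in>set ts - {e}. ?g b e)"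
    by (rule sum.distrib)
  finally have 2: "extension ?D2 = \<dots>" .
  have 3: "extension ?D3 = - (\<Sum>e\<in>set ts. extension (attach k m e ?D3))"
    by (rule extension_expand[OF D3 f3 k(2)])
  have "(\<Sum>e\<in>set ts. extension (attach k q m (attach m p e ?D1)) - extension (attach k p m (attach m q e ?D2))
      + extension (attach k m e ?D3)) = 0"
    using diag by (intro sum.neutral) blast
  then show ?thesis
    unfolding 1 2 3 using sum_off_diagonal_swap[of "set ts" ?g]
    by (simp add: sum.distrib sum_subtractf)
qed

lemma extension_STU1:
  assumes "spliced \<sigma> s xs [Head p, Head q] ys V \<in> dgs"
    "spliced \<sigma> s xs [Head q, Head p] ys V \<in> dgs"
    "spliced \<sigma> s xs [Head m] ys (insert (p, q, m) V) \<in> dgs"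
  shows "extension (spliced \<sigma> s xs [Head p, Head q] ys V) -
    extension (spliced \<sigma> s xs [Head q, Head p] ys V) -
    extension (spliced \<sigma> s xs [Head m] ys (insert (p, q, m) V)) = 0"
  using assms
  by (rule extension_STU)
    ((rule relators.STU1[OF refl refl refl]; simp), (rule extension_STU1_direct; simp))

text \<open>Slides happen on tail strands, so a tail on a head strand survives every attachment
  until \<open>W0\<close> applies. In \<open>CP\<close> the list of tails under the first head is
  empty, and so is the sum that gives the weight.\<close>

theorem extension_ht_relator:
  assumes W0: "\<And>D e h. D \<in> dgs \<Longrightarrow> tail_strand_heads D = {} \<Longrightarrow> Tail e \<in> set (strand D (Inl h)) \<Longrightarrow> W D = 0"
    and "r \<in> ht_relators H T n"
  shows "pairing extension r = 0"
proof -
  have full: "pairing extension r = 0" if "r \<in> relators (H <+> T) n" for r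
    using that
    by (rule pairing_relator_zero)
      (simp_all only: extension_rename extension_AS extension_IHX extension_STU1 extension_STU2 extension_TC)
  have toh: "extension D = 0" if "D \<in> dgs" "Tail e \<in> set (strand D (Inl h))" for D e h
    using that
  proof (induction "card (tail_strand_heads D)" arbitrary: D)
    case 0
    then have "tail_strand_heads D = {}" using finite_tail_strand_heads[OF fin] by auto
    then show ?case using 0 W0 by (simp add: extension_base)
  next
    case (Suc k)
    then have "tail_strand_heads D \<noteq> {}" by auto
    then obtain t ts p where f: "first_head D t ts p" using first_head_exists[of D] by blast
    obtain m where m: "m \<notin> edges D" using exists_fresh_edge[OF fin Suc.prems(1), of "{}"] by auto
    have "extension (attach m p b D) = 0" if "b \<in> set ts" for b
    proof (rule Suc.hyps(1))
      note A = attach_first_head[OF Suc.prems(1) f m that]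
      show "k = card (tail_strand_heads (attach m p b D))" using A(2) Suc.hyps(2) by simp
      show "attach m p b D \<in> dgs" by (rule A(1))
      have "b \<noteq> e"
        using disjoint_strands[OF Suc.prems(1,2), of "Inr t"] first_headD(4)[OF f that] by auto
      then show "Tail e \<in> set (strand (attach m p b D) (Inl h))"
        using Suc.prems(2) by (simp add: set_attach_list)
    qed
    then show ?case using extension_expand[OF Suc.prems(1) f m] by simp
  qed
  show ?thesis using assms(2)
  proof cases
    case Aw
    then show ?thesis by (rule full)
  next
    case (tail_on_head_strand D e h)
    then show ?thesis using toh by simp
  next
    case (CP D t e xs)
    then have f: "first_head D t [] e" by (simp add: first_head_def)
    obtain m where "m \<notin> edges D" using exists_fresh_edge[OF fin CP(2), of "{}"] by auto
    then show ?thesis using extension_expand[OF CP(2) f] CP by simp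
  qed
qed

end

section \<open>Restriction to separated diagrams\<close>

definition tail_on_head :: "('h + 't) diagram \<Rightarrow> bool" where
  "tail_on_head D \<longleftrightarrow> (\<exists>e h. Tail e \<in> set (strand D (Inl h)))"

lemma range_HeadTail: "x \<in> range Head \<longleftrightarrow> (\<forall>e. x \<noteq> Tail e)" "x \<in> range Tail \<longleftrightarrow> (\<forall>e. x \<noteq> Head e)"
  by (cases x; auto)+

lemma separated_iff: "separated D \<longleftrightarrow> \<not> tail_on_head D \<and> tail_strand_heads D = {}"
  unfolding separated_def tail_on_head_def tail_strand_heads_def subset_iff range_HeadTail by blast

lemma tail_on_head_local:
  "tail_on_head (Diagram (\<sigma>(s := L)) V) \<longleftrightarrow>
    (\<exists>h e. Inl h \<noteq> s \<and> Tail e \<in> set (\<sigma> (Inl h))) \<or> (s \<in> range Inl \<and> (\<exists>e. Tail e \<in> set L))"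
  unfolding tail_on_head_def by (auto split: if_splits)

lemma tail_on_head_Diagram: "tail_on_head (Diagram \<sigma> V) \<longleftrightarrow> (\<exists>h e. Tail e \<in> set (\<sigma> (Inl h)))"
  unfolding tail_on_head_def by auto

lemma tail_on_head_rename: "tail_on_head (rename f D) = tail_on_head D"
  unfolding tail_on_head_def by (auto simp: in_map_arrow_end_image)

text \<open>No relation moves an end to another strand, and the tail \<open>e\<close> lost in
  \<open>STU2\<close> is replaced by \<open>m\<close> at the same place. Hence a weight can be set
  to 0 on the diagrams with a tail on a head strand, relator by relator.\<close>

lemma relator_tail_on_head:
  assumes "r \<in> relators S n"
  shows "\<exists>b. \<forall>D\<in>Poly_Mapping.keys r. tail_on_head D = b"
  using assms
proof cases
  case (iso D f)
  then show ?thesis using keys_combination(2)[of D "rename f D"] tail_on_head_rename[of f D] by blast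
next
  case (AS D \<sigma> p q u V D')
  have "tail_on_head D' = tail_on_head D" unfolding AS tail_on_head_Diagram ..
  then show ?thesis using keys_combination(1)[of D D'] AS(1) by blast
next
  case (IHX D1 \<sigma> p q m r u V D2 D3)
  have "tail_on_head D2 = tail_on_head D1" "tail_on_head D3 = tail_on_head D1"
    unfolding IHX tail_on_head_Diagram by (rule refl)+
  then show ?thesis using keys_combination(3)[of D1 D2 D3] IHX(1) by blast
next
  case (STU1 D1 \<sigma> s xs p q ys V D2 D3 m)
  have "tail_on_head D2 = tail_on_head D1" "tail_on_head D3 = tail_on_head D1"
    unfolding STU1 tail_on_head_local by auto
  then show ?thesis using keys_combination(4)[of D1 D2 D3] STU1(1) by blast
next
  case (STU2 D1 \<sigma> s xs p e ys V D2 D3 m)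
  have "tail_on_head D2 = tail_on_head D1" "tail_on_head D3 = tail_on_head D1"
    unfolding STU2 tail_on_head_local by auto
  then show ?thesis using keys_combination(4)[of D1 D2 D3] STU2(1) by blast
next
  case (TC D \<sigma> s xs d e ys V D')
  have "tail_on_head D' = tail_on_head D"
    unfolding TC tail_on_head_local by auto
  then show ?thesis using keys_combination(2)[of D D'] TC(1) by blast
qed

text \<open>Where no head lies on a tail strand, a relator consists either of separated diagrams
  only, where \<open>W\<close> is tested, or only of diagrams with a tail on a head strand, where
  the weight is put to 0. Dually this says that separated classes inject into
  \<open>Aw_ht\<close>.\<close>

theorem separated_weight_extends:
  assumes fin: "finite H" "finite T"
    and W: "\<And>r. r \<in> relators (H <+> T) n \<Longrightarrow> (\<And>D. D \<in> Poly_Mapping.keys r \<Longrightarrow> separated D) \<Longrightarrow>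
      pairing W r = 0"
  shows "\<exists>W'. (\<forall>r\<in>ht_relators H T n. pairing W' r = 0) \<and> (\<forall>D. separated D \<longrightarrow> W' D = W D)"
proof -
  let ?W = "\<lambda>D. if separated D then W D else 0"
  interpret tail_weight H T n ?W
  proof
    show "finite (H <+> T)" using fin by simp
    fix r assume r: "r \<in> relators (H <+> T) n"
      and t: "\<And>D. D \<in> Poly_Mapping.keys r \<Longrightarrow> tail_strand_heads D = {}"
    obtain b where b: "\<forall>D\<in>Poly_Mapping.keys r. tail_on_head D = b"
      using relator_tail_on_head[OF r] by blast
    show "pairing ?W r = 0"
    proof (cases b)
      case True
      then have "pairing ?W r = pairing (\<lambda>_. 0) r"
        using b by (intro pairing_cong) (simp add: separated_iff)
      then show ?thesis by (simp add: pairing_def)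
    next
      case False
      then have s: "separated D" if "D \<in> Poly_Mapping.keys r" for D
        using that b t by (simp add: separated_iff)
      then have "pairing ?W r = pairing W r" by (intro pairing_cong) simp
      then show ?thesis using W[OF r s] by simp
    qed
  qed
  have "pairing extension r = 0" if "r \<in> ht_relators H T n" for r
    by (rule extension_ht_relator[OF _ that]) (auto simp: separated_iff tail_on_head_def)
  moreover have "extension D = W D" if "separated D" for D
    using that extension_base[of D] by (simp add: separated_iff)
  ultimately show ?thesis by blast
qed

section \<open>Stitching and doubling\<close>

definition weight_system :: "'l set \<Rightarrow> nat \<Rightarrow> ('l diagram \<Rightarrow> rat) \<Rightarrow> bool" where
  "weight_system S n W \<longleftrightarrow> (\<forall>r\<in>relators S n. pairing W r = 0)"

lemma weight_systemD:
  assumes "weight_system S n W"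
  shows "D \<in> diagrams S n \<Longrightarrow> inj_on f (edges D) \<Longrightarrow> W (rename f D) = W D" (is "PROP ?a")
    and "Diagram \<sigma> (insert (p, q, u) V) \<in> diagrams S n \<Longrightarrow>
      Diagram \<sigma> (insert (q, p, u) V) \<in> diagrams S n \<Longrightarrow>
      W (Diagram \<sigma> (insert (p, q, u) V)) + W (Diagram \<sigma> (insert (q, p, u) V)) = 0" (is "PROP ?b")
    and "Diagram \<sigma> ({(p, q, m), (m, r, u)} \<union> V) \<in> diagrams S n \<Longrightarrow>
      Diagram \<sigma> ({(q, r, m), (m, p, u)} \<union> V) \<in> diagrams S n \<Longrightarrow>
      Diagram \<sigma> ({(r, p, m), (m, q, u)} \<union> V) \<in> diagrams S n \<Longrightarrow>
      W (Diagram \<sigma> ({(p, q, m), (m, r, u)} \<union> V)) + W (Diagram \<sigma> ({(q, r, m), (m, p, u)} \<union> V)) +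
      W (Diagram \<sigma> ({(r, p, m), (m, q, u)} \<union> V)) = 0" (is "PROP ?c")
    and "spliced \<sigma> s xs [Head p, Head q] ys V \<in> diagrams S n \<Longrightarrow>
      spliced \<sigma> s xs [Head q, Head p] ys V \<in> diagrams S n \<Longrightarrow>
      spliced \<sigma> s xs [Head m] ys (insert (p, q, m) V) \<in> diagrams S n \<Longrightarrow>
      W (spliced \<sigma> s xs [Head p, Head q] ys V) - W (spliced \<sigma> s xs [Head q, Head p] ys V)
      - W (spliced \<sigma> s xs [Head m] ys (insert (p, q, m) V)) = 0" (is "PROP ?d")
    and "spliced \<sigma> s xs [Head p, Tail e] ys V \<in> diagrams S n \<Longrightarrow>
      spliced \<sigma> s xs [Tail e, Head p] ys V \<in> diagrams S n \<Longrightarrow>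
      spliced \<sigma> s xs [Tail m] ys (insert (m, p, e) V) \<in> diagrams S n \<Longrightarrow>
      W (spliced \<sigma> s xs [Head p, Tail e] ys V) - W (spliced \<sigma> s xs [Tail e, Head p] ys V)
      - W (spliced \<sigma> s xs [Tail m] ys (insert (m, p, e) V)) = 0" (is "PROP ?e")
    and "spliced \<sigma> s xs [Tail d, Tail e] ys V \<in> diagrams S n \<Longrightarrow>
      spliced \<sigma> s xs [Tail e, Tail d] ys V \<in> diagrams S n \<Longrightarrow>
      W (spliced \<sigma> s xs [Tail d, Tail e] ys V) = W (spliced \<sigma> s xs [Tail e, Tail d] ys V)" (is "PROP ?g")
proof -
  have k: "pairing W r = 0" if "r \<in> relators S n" for r
    using assms that by (simp add: weight_system_def)
  note rs = k[OF relators.iso[of D S n f]] k[OF relators.AS[OF refl refl, of \<sigma> p q u V]]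
    k[OF relators.IHX[OF refl refl refl, of \<sigma> p q m r u V]] k[OF relators.STU1[OF refl refl refl, of \<sigma> s xs p q ys V m]]
    k[OF relators.STU2[OF refl refl refl, of \<sigma> s xs p e ys V m]] k[OF relators.TC[OF refl refl, of \<sigma> s xs d e ys V]]
  show "PROP ?a" "PROP ?b" "PROP ?c" "PROP ?d" "PROP ?e" "PROP ?g"
    using rs by simp_all
qed

section \<open>Weights pulled back along stitching\<close>

lemma stitch_Diagram: "stitch (Diagram \<sigma> V) = Diagram (\<lambda>a. \<sigma> (Inl a) @ \<sigma> (Inr a)) V"
  by (simp add: stitch_def)

text \<open>Stitching only adds ends above or below the given strand, so a window stays a window and
  each relation becomes one of the same kind.\<close>

lemma stitch_local:
  "\<exists>\<tau> a xs' ys'. \<forall>w V. stitch (spliced \<sigma> s xs w ys V) = spliced \<tau> a xs' w ys' V"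
proof (cases s)
  case (Inl a)
  have "stitch (spliced \<sigma> s xs w ys V) =
      Diagram ((\<lambda>a. \<sigma> (Inl a) @ \<sigma> (Inr a))(a := xs @ w @ (ys @ \<sigma> (Inr a)))) V" for w V
    using Inl by (auto simp: stitch_Diagram)
  then show ?thesis by blast
next
  case (Inr a)
  have "stitch (spliced \<sigma> s xs w ys V) =
      Diagram ((\<lambda>a. \<sigma> (Inl a) @ \<sigma> (Inr a))(a := (\<sigma> (Inl a) @ xs) @ w @ ys)) V" for w V
    using Inr by (auto simp: stitch_Diagram)
  then show ?thesis by blast
qed

lemma stitch_rename: "stitch (rename f D) = rename f (stitch D)"
  by (simp add: stitch_def rename_def)

lemma edges_stitch: "edges (stitch D) = edges D"
  by (rule edges_cong) (simp_all add: ends_stitch)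

lemma weight_system_stitch:
  assumes S: "finite S" and W: "weight_system S n W"
  shows "weight_system (S <+> S) n (\<lambda>D. W (stitch D))"
  unfolding weight_system_def
proof (rule ballI, rule pairing_relator_zero)
  note st = stitch_in_diagrams[OF S, of _ n]
  show "W (stitch (rename f D)) = W (stitch D)" if "D \<in> diagrams (S <+> S) n" "inj_on f (edges D)" for D f
    using weight_systemD(1)[OF W st[OF that(1)], of f] that(2) by (simp add: stitch_rename edges_stitch)
next
  fix \<sigma> :: "'a + 'a \<Rightarrow> nat arrow_end list" and p q u V
  assume "Diagram \<sigma> (insert (p, q, u) V) \<in> diagrams (S <+> S) n"
    "Diagram \<sigma> (insert (q, p, u) V) \<in> diagrams (S <+> S) n"
  from this[THEN stitch_in_diagrams[OF S]]
  show "W (stitch (Diagram \<sigma> (insert (p, q, u) V))) + W (stitch (Diagram \<sigma> (insert (q, p, u) V))) = 0"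
    unfolding stitch_Diagram by (rule weight_systemD(2)[OF W])
next
  fix \<sigma> :: "'a + 'a \<Rightarrow> nat arrow_end list" and p q m r u V
  assume "Diagram \<sigma> ({(p, q, m), (m, r, u)} \<union> V) \<in> diagrams (S <+> S) n"
    "Diagram \<sigma> ({(q, r, m), (m, p, u)} \<union> V) \<in> diagrams (S <+> S) n"
    "Diagram \<sigma> ({(r, p, m), (m, q, u)} \<union> V) \<in> diagrams (S <+> S) n"
  from this[THEN stitch_in_diagrams[OF S]]
  show "W (stitch (Diagram \<sigma> ({(p, q, m), (m, r, u)} \<union> V))) + W (stitch (Diagram \<sigma> ({(q, r, m), (m, p, u)} \<union> V))) +
      W (stitch (Diagram \<sigma> ({(r, p, m), (m, q, u)} \<union> V))) = 0"
    unfolding stitch_Diagram by (rule weight_systemD(3)[OF W])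
next
  fix \<sigma> :: "'a + 'a \<Rightarrow> nat arrow_end list" and s xs p q ys V m
  assume a: "spliced \<sigma> s xs [Head p, Head q] ys V \<in> diagrams (S <+> S) n"
    "spliced \<sigma> s xs [Head q, Head p] ys V \<in> diagrams (S <+> S) n"
    "spliced \<sigma> s xs [Head m] ys (insert (p, q, m) V) \<in> diagrams (S <+> S) n"
  obtain \<tau> a xs' ys' where t: "\<And>w V. stitch (spliced \<sigma> s xs w ys V) = spliced \<tau> a xs' w ys' V"
    using stitch_local[of \<sigma> s xs ys] by blast
  from a[THEN stitch_in_diagrams[OF S]]
  show "W (stitch (spliced \<sigma> s xs [Head p, Head q] ys V)) - W (stitch (spliced \<sigma> s xs [Head q, Head p] ys V))
      - W (stitch (spliced \<sigma> s xs [Head m] ys (insert (p, q, m) V))) = 0"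
    unfolding t by (rule weight_systemD(4)[OF W])
next
  fix \<sigma> :: "'a + 'a \<Rightarrow> nat arrow_end list" and s xs p e ys V m
  assume a: "spliced \<sigma> s xs [Head p, Tail e] ys V \<in> diagrams (S <+> S) n"
    "spliced \<sigma> s xs [Tail e, Head p] ys V \<in> diagrams (S <+> S) n"
    "spliced \<sigma> s xs [Tail m] ys (insert (m, p, e) V) \<in> diagrams (S <+> S) n"
  obtain \<tau> a xs' ys' where t: "\<And>w V. stitch (spliced \<sigma> s xs w ys V) = spliced \<tau> a xs' w ys' V"
    using stitch_local[of \<sigma> s xs ys] by blast
  from a[THEN stitch_in_diagrams[OF S]]
  show "W (stitch (spliced \<sigma> s xs [Head p, Tail e] ys V)) - W (stitch (spliced \<sigma> s xs [Tail e, Head p] ys V))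
      - W (stitch (spliced \<sigma> s xs [Tail m] ys (insert (m, p, e) V))) = 0"
    unfolding t by (rule weight_systemD(5)[OF W])
next
  fix \<sigma> :: "'a + 'a \<Rightarrow> nat arrow_end list" and s xs d e ys V
  assume a: "spliced \<sigma> s xs [Tail d, Tail e] ys V \<in> diagrams (S <+> S) n"
    "spliced \<sigma> s xs [Tail e, Tail d] ys V \<in> diagrams (S <+> S) n"
  obtain \<tau> a xs' ys' where t: "\<And>w V. stitch (spliced \<sigma> s xs w ys V) = spliced \<tau> a xs' w ys' V"
    using stitch_local[of \<sigma> s xs ys] by blast
  from a[THEN stitch_in_diagrams[OF S]]
  show "W (stitch (spliced \<sigma> s xs [Tail d, Tail e] ys V)) = W (stitch (spliced \<sigma> s xs [Tail e, Tail d] ys V))"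
    unfolding t by (rule weight_systemD(6)[OF W])
qed

section \<open>Weights pulled back along doubling\<close>

definition double_weight :: "(('a + 'a) diagram \<Rightarrow> rat) \<Rightarrow> 'a diagram \<Rightarrow> rat" where
  "double_weight W D = (\<Sum>X\<in>Pow (ends D). W (lift_ends X D))"

lemma sum_Pow_insert:
  assumes "finite A" "a \<notin> A"
  shows "(\<Sum>X\<in>Pow (insert a A). g X) = (\<Sum>X\<in>Pow A. g X + g (insert a X :: 'b set) :: rat)"
proof -
  have "(\<Sum>X\<in>Pow (insert a A). g X) = (\<Sum>X\<in>Pow A. g X) + (\<Sum>X\<in>insert a ` Pow A. g X)"
    unfolding Pow_insert by (rule sum.union_disjoint) (use assms in auto)
  also have "(\<Sum>X\<in>insert a ` Pow A. g X) = (\<Sum>X\<in>Pow A. g (insert a X))"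
    using assms(2) by (subst sum.reindex) (auto simp: inj_on_def)
  finally show ?thesis by (simp add: sum.distrib)
qed

lemma lift_Diagram:
  "lift_ends X (Diagram \<sigma> V) = Diagram (case_sum (\<lambda>a. filter (\<lambda>x. x \<in> X) (\<sigma> a)) (\<lambda>a. filter (\<lambda>x. x \<notin> X) (\<sigma> a))) V"
  by (simp add: lift_ends_def)

context
  fixes \<sigma> :: "'a \<Rightarrow> nat arrow_end list" and s :: 'a and xs ys :: "nat arrow_end list"
begin

definition rest :: "nat arrow_end set" where
  "rest = (\<Union>r\<in>- {s}. set (\<sigma> r)) \<union> set xs \<union> set ys"

text \<open>\<open>X\<close> distributes the ends outside the window; \<open>v\<close> and
  \<open>w\<close> are the parts of the window that go to the head copy and the tail copy of
  \<open>s\<close>.\<close>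

definition lifted :: "nat arrow_end set \<Rightarrow> nat arrow_end list \<Rightarrow> nat arrow_end list \<Rightarrow> 'a + 'a \<Rightarrow> nat arrow_end list" where
  "lifted X v w = (case_sum (\<lambda>a. filter (\<lambda>x. x \<in> X) (\<sigma> a)) (\<lambda>a. filter (\<lambda>x. x \<notin> X) (\<sigma> a)))
     (Inl s := filter (\<lambda>x. x \<in> X) xs @ v @ filter (\<lambda>x. x \<in> X) ys,
      Inr s := filter (\<lambda>x. x \<notin> X) xs @ w @ filter (\<lambda>x. x \<notin> X) ys)"

lemma ends_local: "ends (spliced \<sigma> s xs w ys V) = set w \<union> rest"
  unfolding ends_def rest_def by (auto split: if_splits)

lemma lift_local:
  assumes "X \<subseteq> rest" "B \<subseteq> set w" "set w \<inter> rest = {}"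
  shows "lift_ends (B \<union> X) (spliced \<sigma> s xs w ys V) =
    Diagram (lifted X (filter (\<lambda>x. x \<in> B) w) (filter (\<lambda>x. x \<notin> B) w)) V"
proof -
  have r: "x \<in> B \<union> X \<longleftrightarrow> x \<in> X" if "x \<in> rest" for x
    using that assms by blast
  have w: "x \<in> B \<union> X \<longleftrightarrow> x \<in> B" if "x \<in> set w" for x
    using that assms by blast
  have [simp]: "filter (\<lambda>x. x \<in> B \<union> X) L = filter (\<lambda>x. x \<in> X) L"
    "filter (\<lambda>x. x \<notin> B \<union> X) L = filter (\<lambda>x. x \<notin> X) L" if "set L \<subseteq> rest" for L
    using that r by (auto intro!: filter_cong)
  have [simp]: "filter (\<lambda>x. x \<in> B \<union> X) w = filter (\<lambda>x. x \<in> B) w"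
    "filter (\<lambda>x. x \<notin> B \<union> X) w = filter (\<lambda>x. x \<notin> B) w"
    using w by (auto intro!: filter_cong)
  have [simp]: "set xs \<subseteq> rest" "set ys \<subseteq> rest" "a \<noteq> s \<Longrightarrow> set (\<sigma> a) \<subseteq> rest" for a
    by (auto simp: rest_def)
  have "case_sum (\<lambda>a. filter (\<lambda>x. x \<in> B \<union> X) ((\<sigma>(s := xs @ w @ ys)) a))
      (\<lambda>a. filter (\<lambda>x. x \<notin> B \<union> X) ((\<sigma>(s := xs @ w @ ys)) a)) c =
      lifted X (filter (\<lambda>x. x \<in> B) w) (filter (\<lambda>x. x \<notin> B) w) c" for c
    by (cases c) (simp_all add: lifted_def del: Un_iff)
  then show ?thesis unfolding lift_Diagram by presburger
qed

lemma local_disjoint_rest: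
  assumes "spliced \<sigma> s xs w ys V \<in> diagrams S n"
  shows "set w \<inter> rest = {}"
proof -
  have "x \<noteq> y" if "x \<in> set w" "y \<in> rest" for x y
    using that local_end_neq[OF assms that(1), of y] unfolding rest_def by auto
  then show ?thesis by blast
qed

lemma finite_rest:
  assumes "finite S" "spliced \<sigma> s xs w ys V \<in> diagrams S n"
  shows "finite rest"
  using finite_ends[OF assms] unfolding ends_local by simp

lemma double_weight_one:
  assumes "finite S" "spliced \<sigma> s xs [z] ys V \<in> diagrams S n"
  shows "double_weight W (spliced \<sigma> s xs [z] ys V) =
    (\<Sum>X\<in>Pow rest. W (Diagram (lifted X [] [z]) V) + W (Diagram (lifted X [z] []) V))"
proof -
  note d = local_disjoint_rest[OF assms(2)]
  let ?D = "spliced \<sigma> s xs [z] ys V"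
  have "double_weight W ?D = (\<Sum>X\<in>Pow (insert z rest). W (lift_ends X ?D))"
    unfolding double_weight_def ends_local by simp
  also have "\<dots> = (\<Sum>X\<in>Pow rest. W (lift_ends X ?D) + W (lift_ends (insert z X) ?D))"
    using finite_rest[OF assms] d by (intro sum_Pow_insert) auto
  also have "\<dots> = (\<Sum>X\<in>Pow rest. W (Diagram (lifted X [] [z]) V) + W (Diagram (lifted X [z] []) V))"
  proof (rule sum.cong[OF refl])
    fix X assume "X \<in> Pow rest"
    then have X: "X \<subseteq> rest" by simp
    show "W (lift_ends X ?D) + W (lift_ends (insert z X) ?D) =
        W (Diagram (lifted X [] [z]) V) + W (Diagram (lifted X [z] []) V)"
      using lift_local[OF X, of "{}" "[z]" V] lift_local[OF X, of "{z}" "[z]" V] d by simp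
  qed
  finally show ?thesis .
qed

lemma double_weight_two:
  assumes "finite S" "spliced \<sigma> s xs [x, y] ys V \<in> diagrams S n"
  shows "double_weight W (spliced \<sigma> s xs [x, y] ys V) =
    (\<Sum>X\<in>Pow rest. (W (Diagram (lifted X [] [x, y]) V) + W (Diagram (lifted X [x] [y]) V)) +
      (W (Diagram (lifted X [y] [x]) V) + W (Diagram (lifted X [x, y] []) V)))"
proof -
  note d = local_disjoint_rest[OF assms(2)]
  let ?D = "spliced \<sigma> s xs [x, y] ys V"
  have xy: "x \<noteq> y" using distinct_strand[OF assms(2), of s] by auto
  have f: "finite rest" by (rule finite_rest[OF assms])
  have "double_weight W ?D = (\<Sum>X\<in>Pow (insert y (insert x rest)). W (lift_ends X ?D))"
    unfolding double_weight_def ends_local by (simp add: insert_commute)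
  also have "\<dots> = (\<Sum>X\<in>Pow (insert x rest). W (lift_ends X ?D) + W (lift_ends (insert y X) ?D))"
    using f d xy by (intro sum_Pow_insert) auto
  also have "\<dots> = (\<Sum>X\<in>Pow rest. (W (lift_ends X ?D) + W (lift_ends (insert y X) ?D)) +
      (W (lift_ends (insert x X) ?D) + W (lift_ends (insert y (insert x X)) ?D)))"
    using f d xy by (intro sum_Pow_insert) auto
  also have "\<dots> = (\<Sum>X\<in>Pow rest. (W (Diagram (lifted X [] [x, y]) V) + W (Diagram (lifted X [x] [y]) V)) +
      (W (Diagram (lifted X [y] [x]) V) + W (Diagram (lifted X [x, y] []) V)))"
  proof (rule sum.cong[OF refl])
    fix X assume "X \<in> Pow rest"
    then have X: "X \<subseteq> rest" by simp
    show "(W (lift_ends X ?D) + W (lift_ends (insert y X) ?D)) +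
      (W (lift_ends (insert x X) ?D) + W (lift_ends (insert y (insert x X)) ?D)) =
      (W (Diagram (lifted X [] [x, y]) V) + W (Diagram (lifted X [x] [y]) V)) +
      (W (Diagram (lifted X [y] [x]) V) + W (Diagram (lifted X [x, y] []) V))"
      using lift_local[OF X, of "{}" "[x, y]" V] lift_local[OF X, of "{x}" "[x, y]" V]
        lift_local[OF X, of "{y}" "[x, y]" V] lift_local[OF X, of "{y, x}" "[x, y]" V] d xy
      by simp
  qed
  finally show ?thesis .
qed

lemma lifted_in_diagrams:
  assumes "finite S" "spliced \<sigma> s xs w ys V \<in> diagrams S n" "X \<subseteq> rest"
  shows "Diagram (lifted X [] w) V \<in> diagrams (S <+> S) n" "Diagram (lifted X w []) V \<in> diagrams (S <+> S) n"
proof -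
  have "filter (\<lambda>x. x \<in> set w) w = w" "filter (\<lambda>x. x \<notin> set w) w = []"
    by (simp_all add: filter_id_conv filter_empty_conv)
  then show "Diagram (lifted X [] w) V \<in> diagrams (S <+> S) n" "Diagram (lifted X w []) V \<in> diagrams (S <+> S) n"
    using lift_ends_in_diagrams[OF assms(1,2), of "{} \<union> X"] lift_ends_in_diagrams[OF assms(1,2), of "set w \<union> X"]
      lift_local[OF assms(3) _ local_disjoint_rest[OF assms(2)], of "{}" V]
      lift_local[OF assms(3) _ local_disjoint_rest[OF assms(2)], of "set w" V]
    by simp_all
qed

lemma lifted_as_update:
  "lifted X [] w = (lifted X [] [])(Inr s := filter (\<lambda>x. x \<notin> X) xs @ w @ filter (\<lambda>x. x \<notin> X) ys)"
  "lifted X w [] = (lifted X [] [])(Inl s := filter (\<lambda>x. x \<in> X) xs @ w @ filter (\<lambda>x. x \<in> X) ys)"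
  by (auto simp: lifted_def)

text \<open>Fix the lift \<open>X\<close> of the ends outside the window. If both ends of the window
  go to the same copy, the relation holds there. If they are separated, their order is lost, so
  these lifts of the first two diagrams coincide and cancel; the third diagram has one end in the
  window and no mixed lift.\<close>

lemma double_weight_STU:
  assumes S: "finite S"
    and D1: "spliced \<sigma> s xs [x, y] ys V \<in> diagrams S n"
    and D2: "spliced \<sigma> s xs [y, x] ys V \<in> diagrams S n"
    and D3: "spliced \<sigma> s xs [z] ys V' \<in> diagrams S n"
    and W: "\<And>\<tau> c us vs. spliced \<tau> c us [x, y] vs V \<in> diagrams (S <+> S) n \<Longrightarrow>
      spliced \<tau> c us [y, x] vs V \<in> diagrams (S <+> S) n \<Longrightarrow>
      spliced \<tau> c us [z] vs V' \<in> diagrams (S <+> S) n \<Longrightarrow>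
      W (spliced \<tau> c us [x, y] vs V) - W (spliced \<tau> c us [y, x] vs V)
      - W (spliced \<tau> c us [z] vs V') = 0"
  shows "double_weight W (spliced \<sigma> s xs [x, y] ys V) - double_weight W (spliced \<sigma> s xs [y, x] ys V)
      - double_weight W (spliced \<sigma> s xs [z] ys V') = 0"
proof -
  have "W (Diagram (lifted X [] [x, y]) V) - W (Diagram (lifted X [] [y, x]) V) - W (Diagram (lifted X [] [z]) V') = 0"
    "W (Diagram (lifted X [x, y] []) V) - W (Diagram (lifted X [y, x] []) V) - W (Diagram (lifted X [z] []) V') = 0"
    if "X \<in> Pow rest" for X
    using lifted_in_diagrams[OF S D1, of X] lifted_in_diagrams[OF S D2, of X] lifted_in_diagrams[OF S D3, of X] that
    unfolding lifted_as_update(1)[of X "[x, y]"] lifted_as_update(1)[of X "[y, x]"] lifted_as_update(1)[of X "[z]"]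
      lifted_as_update(2)[of X "[x, y]"] lifted_as_update(2)[of X "[y, x]"] lifted_as_update(2)[of X "[z]"]
    by (intro W; simp)+
  then show ?thesis
    unfolding double_weight_two[OF S D1] double_weight_two[OF S D2] double_weight_one[OF S D3]
      sum_subtractf[symmetric]
    by (intro sum.neutral) (simp add: algebra_simps)
qed

lemma double_weight_TC:
  assumes S: "finite S"
    and D1: "spliced \<sigma> s xs [x, y] ys V \<in> diagrams S n"
    and D2: "spliced \<sigma> s xs [y, x] ys V \<in> diagrams S n"
    and W: "\<And>\<tau> c us vs. spliced \<tau> c us [x, y] vs V \<in> diagrams (S <+> S) n \<Longrightarrow>
      spliced \<tau> c us [y, x] vs V \<in> diagrams (S <+> S) n \<Longrightarrow>
      W (spliced \<tau> c us [x, y] vs V) = W (spliced \<tau> c us [y, x] vs V)"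
  shows "double_weight W (spliced \<sigma> s xs [x, y] ys V) = double_weight W (spliced \<sigma> s xs [y, x] ys V)"
proof -
  have "W (Diagram (lifted X [] [x, y]) V) = W (Diagram (lifted X [] [y, x]) V)"
    "W (Diagram (lifted X [x, y] []) V) = W (Diagram (lifted X [y, x] []) V)"
    if "X \<in> Pow rest" for X
    using lifted_in_diagrams[OF S D1, of X] lifted_in_diagrams[OF S D2, of X] that
    unfolding lifted_as_update(1)[of X "[x, y]"] lifted_as_update(1)[of X "[y, x]"]
      lifted_as_update(2)[of X "[x, y]"] lifted_as_update(2)[of X "[y, x]"]
    by (intro W; simp)+
  then show ?thesis
    unfolding double_weight_two[OF S D1] double_weight_two[OF S D2]
    by (intro sum.cong) simp_all
qed

end

lemma double_weight_rename:
  assumes S: "finite S" and W: "weight_system (S <+> S) n W"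
    and D: "D \<in> diagrams S n" and f: "inj_on f (edges D)"
  shows "double_weight W (rename f D) = double_weight W D"
proof -
  let ?f = "map_arrow_end f"
  have inj: "inj_on ?f (ends D)"
  proof (rule inj_onI)
    fix x y assume "x \<in> ends D" "y \<in> ends D" "?f x = ?f y"
    then show "x = y" using f by (cases x; cases y) (auto dest: edge_of_end(3,4) inj_onD)
  qed
  have e: "ends (rename f D) = ?f ` ends D" by (auto simp: ends_def)
  have l: "lift_ends (?f ` X) (rename f D) = rename f (lift_ends X D)" if "X \<subseteq> ends D" for X
  proof -
    have m: "?f x \<in> ?f ` X \<longleftrightarrow> x \<in> X" if "x \<in> ends D" for x
      using that inj \<open>X \<subseteq> ends D\<close> by (auto dest: inj_onD)
    have "filter (\<lambda>x. x \<in> ?f ` X) (map ?f (strand D a)) = map ?f (filter (\<lambda>x. x \<in> X) (strand D a))"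
      "filter (\<lambda>x. x \<notin> ?f ` X) (map ?f (strand D a)) = map ?f (filter (\<lambda>x. x \<notin> X) (strand D a))" for a
    proof -
      have "x \<in> ends D" if "x \<in> set (strand D a)" for x using that by (auto simp: ends_def)
      then show "filter (\<lambda>x. x \<in> ?f ` X) (map ?f (strand D a)) = map ?f (filter (\<lambda>x. x \<in> X) (strand D a))"
        "filter (\<lambda>x. x \<notin> ?f ` X) (map ?f (strand D a)) = map ?f (filter (\<lambda>x. x \<notin> X) (strand D a))"
        unfolding filter_map comp_def using m by (auto intro!: arg_cong[of _ _ "map ?f"] filter_cong)
    qed
    then have "strand (lift_ends (?f ` X) (rename f D)) c = strand (rename f (lift_ends X D)) c" for c
      by (cases c) (simp_all add: lift_ends_def)
    moreover have "trivs (lift_ends (?f ` X) (rename f D)) = trivs (rename f (lift_ends X D))"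
      by (simp add: lift_ends_def trivs_rename)
    ultimately show ?thesis by (intro diagram.expand) auto
  qed
  have ed: "edges (lift_ends X D) = edges D" for X
  proof (rule edges_cong)
    show "ends (lift_ends X D) = ends D"
      by (auto simp: ends_def lift_ends_def UNIV_sum image_Un image_image)
  qed (simp add: lift_ends_def)
  have "double_weight W (rename f D) = (\<Sum>X\<in>(`) ?f ` Pow (ends D). W (lift_ends X (rename f D)))"
    unfolding double_weight_def e image_Pow_surj[OF refl, symmetric] ..
  also have "\<dots> = (\<Sum>X\<in>Pow (ends D). W (lift_ends (?f ` X) (rename f D)))"
    using inj by (subst sum.reindex) (auto simp: inj_on_image_Pow)
  also have "\<dots> = double_weight W D"
    unfolding double_weight_def
  proof (rule sum.cong[OF refl])
    fix X assume "X \<in> Pow (ends D)"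
    then show "W (lift_ends (?f ` X) (rename f D)) = W (lift_ends X D)"
      using l weight_systemD(1)[OF W lift_ends_in_diagrams[OF S D, of X], of f] f ed[of X] by simp
  qed
  finally show ?thesis .
qed

lemma weight_system_double:
  assumes S: "finite S" and W: "weight_system (S <+> S) n W"
  shows "weight_system S n (double_weight W)"
  unfolding weight_system_def
proof (rule ballI, rule pairing_relator_zero)
  show "double_weight W (rename f D) = double_weight W D"
    if "D \<in> diagrams S n" "inj_on f (edges D)" for D f
    using double_weight_rename[OF S W that] .
next
  fix \<sigma> :: "'a \<Rightarrow> nat arrow_end list" and p q u V
  assume a: "Diagram \<sigma> (insert (p, q, u) V) \<in> diagrams S n" "Diagram \<sigma> (insert (q, p, u) V) \<in> diagrams S n"
  have e: "ends (Diagram \<sigma> (insert (q, p, u) V)) = ends (Diagram \<sigma> (insert (p, q, u) V))" by (simp add: ends_def)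
  show "double_weight W (Diagram \<sigma> (insert (p, q, u) V)) + double_weight W (Diagram \<sigma> (insert (q, p, u) V)) = 0"
    unfolding double_weight_def e sum.distrib[symmetric]
    by (intro sum.neutral ballI)
      (use a[THEN lift_ends_in_diagrams[OF S]] in \<open>simp add: lift_Diagram weight_systemD(2)[OF W]\<close>)
next
  fix \<sigma> :: "'a \<Rightarrow> nat arrow_end list" and p q m r u V
  let ?D1 = "Diagram \<sigma> ({(p, q, m), (m, r, u)} \<union> V)" and ?D2 = "Diagram \<sigma> ({(q, r, m), (m, p, u)} \<union> V)"
    and ?D3 = "Diagram \<sigma> ({(r, p, m), (m, q, u)} \<union> V)"
  assume a: "?D1 \<in> diagrams S n" "?D2 \<in> diagrams S n" "?D3 \<in> diagrams S n"
  have e: "ends ?D2 = ends ?D1" "ends ?D3 = ends ?D1" by (simp_all add: ends_def)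
  have "W (lift_ends X ?D1) + W (lift_ends X ?D2) + W (lift_ends X ?D3) = 0" for X
    using a[THEN lift_ends_in_diagrams[OF S], of X] unfolding lift_Diagram by (rule weight_systemD(3)[OF W])
  then show "double_weight W ?D1 + double_weight W ?D2 + double_weight W ?D3 = 0"
    unfolding double_weight_def e sum.distrib[symmetric] by (intro sum.neutral) blast
next
  fix \<sigma> :: "'a \<Rightarrow> nat arrow_end list" and s xs p q ys V m
  assume "spliced \<sigma> s xs [Head p, Head q] ys V \<in> diagrams S n"
    "spliced \<sigma> s xs [Head q, Head p] ys V \<in> diagrams S n"
    "spliced \<sigma> s xs [Head m] ys (insert (p, q, m) V) \<in> diagrams S n"
  then show "double_weight W (spliced \<sigma> s xs [Head p, Head q] ys V)
      - double_weight W (spliced \<sigma> s xs [Head q, Head p] ys V)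
      - double_weight W (spliced \<sigma> s xs [Head m] ys (insert (p, q, m) V)) = 0"
    by (rule double_weight_STU[OF S]) (rule weight_systemD(4)[OF W])
next
  fix \<sigma> :: "'a \<Rightarrow> nat arrow_end list" and s xs p e ys V m
  assume "spliced \<sigma> s xs [Head p, Tail e] ys V \<in> diagrams S n"
    "spliced \<sigma> s xs [Tail e, Head p] ys V \<in> diagrams S n"
    "spliced \<sigma> s xs [Tail m] ys (insert (m, p, e) V) \<in> diagrams S n"
  then show "double_weight W (spliced \<sigma> s xs [Head p, Tail e] ys V)
      - double_weight W (spliced \<sigma> s xs [Tail e, Head p] ys V)
      - double_weight W (spliced \<sigma> s xs [Tail m] ys (insert (m, p, e) V)) = 0"
    by (rule double_weight_STU[OF S]) (rule weight_systemD(5)[OF W])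
next
  fix \<sigma> :: "'a \<Rightarrow> nat arrow_end list" and s xs d e ys V
  assume "spliced \<sigma> s xs [Tail d, Tail e] ys V \<in> diagrams S n"
    "spliced \<sigma> s xs [Tail e, Tail d] ys V \<in> diagrams S n"
  then show "double_weight W (spliced \<sigma> s xs [Tail d, Tail e] ys V) =
      double_weight W (spliced \<sigma> s xs [Tail e, Tail d] ys V)"
    by (rule double_weight_TC[OF S]) (rule weight_systemD(6)[OF W])
qed

lemma double_weight_stitch:
  assumes S: "finite S" and W: "\<forall>r\<in>ht_relators S S n. pairing W r = 0"
    and D: "D \<in> diagrams (S <+> S) n" and sep: "separated D"
  shows "double_weight W (stitch D) = W D"
proof -
  let ?X0 = "ends D \<inter> range Head"
  have l: "strand (lift_ends X (stitch D)) (Inl a) = filter (\<lambda>x. x \<in> X) (strand D (Inl a) @ strand D (Inr a))"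
    "strand (lift_ends X (stitch D)) (Inr a) = filter (\<lambda>x. x \<notin> X) (strand D (Inl a) @ strand D (Inr a))" for X a
    by (simp_all add: lift_ends_def stitch_def)
  have dg: "lift_ends X (stitch D) \<in> diagrams (S <+> S) n" for X
    by (rule lift_ends_in_diagrams[OF S stitch_in_diagrams[OF S D]])
  have sepD: "set (strand D (Inl a)) \<subseteq> range Head" "set (strand D (Inr a)) \<subseteq> range Tail" for a
    using sep by (auto simp: separated_def)
  have sub: "set (strand D c) \<subseteq> ends D" for c by (auto simp: ends_def)
  have 0: "lift_ends ?X0 (stitch D) = D"
  proof (rule diagram.expand, intro conjI ext)
    fix c
    have 1: "filter (\<lambda>x. x \<in> ?X0) (strand D (Inl a)) = strand D (Inl a)"
      "filter (\<lambda>x. x \<notin> ?X0) (strand D (Inl a)) = []" for a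
      using sepD(1)[of a] sub[of "Inl a"] by (auto simp: filter_id_conv filter_empty_conv)
    have 2: "filter (\<lambda>x. x \<notin> ?X0) (strand D (Inr a)) = strand D (Inr a)"
      "filter (\<lambda>x. x \<in> ?X0) (strand D (Inr a)) = []" for a
      using sepD(2)[of a] by (auto simp: filter_id_conv filter_empty_conv)
    show "strand (lift_ends ?X0 (stitch D)) c = strand D c"
      by (cases c) (simp_all only: l filter_append 1 2 append_Nil append_Nil2)
  qed (simp add: lift_ends_def)
  have z: "W (lift_ends X (stitch D)) = 0" if X: "X \<subseteq> ends D" "X \<noteq> ?X0" for X
  proof (cases "X \<subseteq> range Head")
    case False
    then obtain e where e: "Tail e \<in> X" by (metis range_HeadTail(1) subsetI)
    then obtain c where c: "Tail e \<in> set (strand D c)" using X(1) by (auto simp: ends_def)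
    then obtain a where "c = Inr a" using sepD(1) by (cases c) auto
    then have "Tail e \<in> set (strand (lift_ends X (stitch D)) (Inl a))" using c e by (simp add: l)
    from ht_relators.tail_on_head_strand[OF dg this] show ?thesis using W by fastforce
  next
    case True
    then obtain p where p: "Head p \<in> ends D" "Head p \<notin> X" using X by blast
    then obtain c where c: "Head p \<in> set (strand D c)" by (auto simp: ends_def)
    then obtain a where a: "c = Inl a" using sepD(2) by (cases c) auto
    \<comment> \<open>Stitching puts the head part of the strand first, so its lowest end sent to
      the tail copy is also the lowest end there, and it is a head.\<close>
    have "filter (\<lambda>x. x \<notin> X) (strand D (Inl a)) \<noteq> []"
      using c a p by (auto simp: filter_empty_conv)
    then obtain x zs where x: "filter (\<lambda>x. x \<notin> X) (strand D (Inl a)) = x # zs"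
      by (cases "filter (\<lambda>x. x \<notin> X) (strand D (Inl a))") auto
    then have "x \<in> set (strand D (Inl a))" using filter_is_subset[of "\<lambda>x. x \<notin> X" "strand D (Inl a)"] by simp
    then obtain q where "x = Head q" using sepD(1)[of a] by auto
    then have "strand (lift_ends X (stitch D)) (Inr a) = Head q # (zs @ filter (\<lambda>x. x \<notin> X) (strand D (Inr a)))"
      using x by (simp add: l)
    from ht_relators.CP[OF dg this] show ?thesis using W by fastforce
  qed
  have "finite (ends D)" using finite_ends[OF _ D] S by simp
  then have "double_weight W (stitch D) = (\<Sum>X\<in>{?X0}. W (lift_ends X (stitch D)))"
    unfolding double_weight_def ends_stitch using z by (intro sum.mono_neutral_right) auto
  then show ?thesis by (simp add: 0)
qed

section \<open>Sorting strands\<close>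

fun num_heads :: "nat arrow_end list \<Rightarrow> nat" where
  "num_heads [] = 0"
| "num_heads (Head p # L) = Suc (num_heads L)"
| "num_heads (Tail e # L) = num_heads L"

fun inversions :: "nat arrow_end list \<Rightarrow> nat" where
  "inversions [] = 0"
| "inversions (Head p # L) = inversions L"
| "inversions (Tail e # L) = num_heads L + inversions L"

lemma num_heads_append [simp]: "num_heads (L @ L') = num_heads L + num_heads L'"
  by (induction L rule: num_heads.induct) auto

text \<open>The exchange undoes exactly the pair in the window; in the third diagram the head
  disappears from the strand and with it all its pairs.\<close>

lemma inversions_decrease:
  "inversions (xs @ [Head p, Tail e] @ ys) < inversions (xs @ [Tail e, Head p] @ ys)"
  "inversions (xs @ [Tail m] @ ys) < inversions (xs @ [Tail e, Head p] @ ys)"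
  by (induction xs rule: inversions.induct) auto

definition heads_below_tails :: "nat arrow_end list \<Rightarrow> bool" where
  "heads_below_tails L \<longleftrightarrow> (\<exists>ps ts. L = map Head ps @ map Tail ts)"

lemma not_heads_below_tails:
  "\<not> heads_below_tails L \<Longrightarrow> \<exists>xs e p ys. L = xs @ [Tail e, Head p] @ ys"
proof (induction L)
  case Nil
  then show ?case by (simp add: heads_below_tails_def)
next
  case (Cons x L)
  show ?case
  proof (cases "heads_below_tails L")
    case False
    then obtain xs e p ys where "L = xs @ [Tail e, Head p] @ ys" using Cons.IH by blast
    then have "x # L = (x # xs) @ [Tail e, Head p] @ ys" by simp
    then show ?thesis by blast
  next
    case True
    then obtain ps ts where L: "L = map Head ps @ map Tail ts" by (auto simp: heads_below_tails_def)
    show ?thesis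
    proof (cases x)
      case (Head p)
      then have "x # L = map Head (p # ps) @ map Tail ts" using L by simp
      then show ?thesis using Cons.prems unfolding heads_below_tails_def by blast
    next
      case (Tail e)
      show ?thesis
      proof (cases ps)
        case Nil
        then have "x # L = map Head [] @ map Tail (e # ts)" using L Tail by simp
        then show ?thesis using Cons.prems unfolding heads_below_tails_def by blast
      next
        case (Cons p ps')
        then have "x # L = [] @ [Tail e, Head p] @ (map Head ps' @ map Tail ts)" using L Tail by simp
        then show ?thesis by blast
      qed
    qed
  qed
qed

text \<open>Induction on the total number of inversions: a tail directly below a head is the second
  window of \<open>STU2\<close>, and the other two diagrams have fewer inversions. Dually, sorted
  diagrams span.\<close>

lemma weight_zero_if_zero_on_sorted:
  assumes S: "finite S" and W: "weight_system S n W"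
    and zero: "\<And>D. D \<in> diagrams S n \<Longrightarrow> (\<And>s. heads_below_tails (strand D s)) \<Longrightarrow> W D = 0"
    and D: "D \<in> diagrams S n"
  shows "W D = 0"
  using D
proof (induction "\<Sum>s\<in>S. inversions (strand D s)" arbitrary: D rule: less_induct)
  case less
  show ?case
  proof (cases "\<forall>s. heads_below_tails (strand D s)")
    case True
    then show ?thesis using zero less.prems by blast
  next
    case False
    then obtain s xs e p ys where L: "strand D s = xs @ [Tail e, Head p] @ ys"
      using not_heads_below_tails by blast
    have s: "s \<in> S" using strand_outside[OF less.prems, of s] L by auto
    define \<sigma> V where "\<sigma> = strand D" and "V = trivs D"
    have D: "D = spliced \<sigma> s xs [Tail e, Head p] ys V"
      using L by (cases D) (auto simp: \<sigma>_def V_def)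
    let ?D1 = "spliced \<sigma> s xs [Head p, Tail e] ys V"
    obtain m where m: "m \<notin> edges D" using exists_fresh_edge[OF S less.prems, of "{}"] by auto
    let ?D3 = "spliced \<sigma> s xs [Tail m] ys (insert (m, p, e) V)"
    have d2: "spliced \<sigma> s xs [Tail e, Head p] ys V \<in> diagrams S n" using less.prems D by simp
    have d1: "?D1 \<in> diagrams S n"
      by (rule permute_in_diagrams[OF S d2]) (use distinct_strand[OF d2, of s] in auto)
    have "attach m p e D = ?D3" unfolding D by (rule attach_local[OF d2 refl]) simp
    moreover have "attach m p e D \<in> diagrams S n"
      using L m by (intro attach_in_diagrams[OF S less.prems]) (auto simp: ends_def intro!: exI[of _ s])
    ultimately have d3: "?D3 \<in> diagrams S n" by simp
    \<comment> \<open>Only strand \<open>s\<close> changes, so a decrease there is a decrease of the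
      total.\<close>
    have meas: "(\<Sum>r\<in>S. inversions ((\<sigma>(s := K)) r)) < (\<Sum>r\<in>S. inversions (strand D r))"
      if "inversions K < inversions (xs @ [Tail e, Head p] @ ys)" for K
      using S s that L by (intro sum_strict_mono_ex1) (auto simp: \<sigma>_def)
    have "W ?D1 = 0" "W ?D3 = 0"
      using less.hyps[OF _ d1] less.hyps[OF _ d3] meas inversions_decrease by auto
    then show ?thesis using weight_systemD(5)[OF W d1 d2 d3] D by simp
  qed
qed

section \<open>The isomorphism\<close>

abbreviation double_lc :: "('a diagram \<Rightarrow>\<^sub>0 rat) \<Rightarrow> (('a + 'a) diagram \<Rightarrow>\<^sub>0 rat)" where
  "double_lc \<equiv> lin_ext (\<lambda>D. \<Sum>X\<in>Pow (ends D). basis (lift_ends X D))"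

abbreviation stitch_lc :: "(('a + 'a) diagram \<Rightarrow>\<^sub>0 rat) \<Rightarrow> ('a diagram \<Rightarrow>\<^sub>0 rat)" where
  "stitch_lc \<equiv> lin_ext (\<lambda>D. basis (stitch D))"

lemma pairing_double: "pairing W (double_lc f) = pairing (double_weight W) f"
  by (simp add: double_weight_def[abs_def])

lemma rels_iff: "f \<in> rels S n \<longleftrightarrow> (\<forall>W. weight_system S n W \<longrightarrow> pairing W f = 0)"
  unfolding rels_def weight_system_def by (rule in_span_iff_pairing)

lemma ht_rels_iff: "f \<in> ht_rels H T n \<longleftrightarrow> (\<forall>W. (\<forall>r\<in>ht_relators H T n. pairing W r = 0) \<longrightarrow> pairing W f = 0)"
  unfolding ht_rels_def by (rule in_span_iff_pairing)

lemma weight_system_ht: "(\<forall>r\<in>ht_relators H T n. pairing W r = 0) \<Longrightarrow> weight_system (H <+> T) n W"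
  unfolding weight_system_def by (blast intro: ht_relators.Aw)

lemma rels_subset_ht_rels: "rels (H <+> T) n \<subseteq> ht_rels H T n"
proof
  fix f assume "f \<in> rels (H <+> T) n"
  then show "f \<in> ht_rels H T n" using weight_system_ht[of H T n] by (simp add: rels_iff ht_rels_iff)
qed

lemma span_basis_iff: "f \<in> lc.span (basis ` A) \<longleftrightarrow> Poly_Mapping.keys f \<subseteq> A"
proof
  assume "f \<in> lc.span (basis ` A)"
  then show "Poly_Mapping.keys f \<subseteq> A"
  proof (induction rule: lc.span_induct_alt)
    case (step c x y)
    then show ?case
      by (auto simp: in_keys_iff lookup_add lookup_single when_def split: if_splits)
  qed simp
next
  assume "Poly_Mapping.keys f \<subseteq> A"
  then have "(\<Sum>b\<in>Poly_Mapping.keys f. scale (Poly_Mapping.lookup f b) (basis b)) \<in> lc.span (basis ` A)"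
    by (intro lc.span_sum lc.span_scale lc.span_base) auto
  then show "f \<in> lc.span (basis ` A)" using lc_expand[of f] by simp
qed

lemma lin_ext_in_span:
  assumes "f \<in> lc.span (basis ` A)" "\<And>b. b \<in> A \<Longrightarrow> \<phi> b \<in> lc.span B"
  shows "lin_ext \<phi> f \<in> lc.span B"
  unfolding lin_ext_def using assms by (intro lc.span_sum lc.span_scale) (auto simp: span_basis_iff)

lemma double_free:
  assumes "finite S" "f \<in> free_space S n"
  shows "double_lc f \<in> free_space (S <+> S) n"
  using assms(2) unfolding free_space_def
  by (rule lin_ext_in_span) (intro lc.span_sum lc.span_base imageI lift_ends_in_diagrams[OF assms(1)])

lemma separated_subset_free: "separated_space H T n \<subseteq> free_space (H <+> T) n"
  unfolding separated_space_def free_space_def by (intro lc.span_mono) auto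

lemma stitch_free:
  assumes "finite S" "f \<in> free_space (S <+> S) n"
  shows "stitch_lc f \<in> free_space S n"
  using assms(2) unfolding free_space_def
  by (rule lin_ext_in_span) (intro lc.span_base imageI stitch_in_diagrams[OF assms(1)])

lemma double_rels: "finite S \<Longrightarrow> f \<in> rels S n \<Longrightarrow> double_lc f \<in> rels (S <+> S) n"
  using weight_system_double[of S n] by (simp add: rels_iff pairing_double del: pairing_lin_ext)

lemma stitch_rels: "finite S \<Longrightarrow> f \<in> rels (S <+> S) n \<Longrightarrow> stitch_lc f \<in> rels S n"
  using weight_system_stitch[of S n] by (simp add: rels_iff)

lemma double_stitch:
  assumes S: "finite S" and f: "f \<in> separated_space S S n"
  shows "double_lc (stitch_lc f) - f \<in> ht_rels S S n"
  unfolding ht_rels_iff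
proof (intro allI impI)
  fix W :: "('a + 'a) diagram \<Rightarrow> rat" assume W: "\<forall>r\<in>ht_relators S S n. pairing W r = 0"
  have "pairing W (double_lc (stitch_lc f)) = pairing (\<lambda>D. double_weight W (stitch D)) f"
    unfolding pairing_double by simp
  also have "\<dots> = pairing W f"
    using f double_weight_stitch[OF S W] unfolding separated_space_def span_basis_iff
    by (intro pairing_cong) auto
  finally show "pairing W (double_lc (stitch_lc f) - f) = 0" by simp
qed

lemma sorted_eq_stitch:
  assumes "\<And>s. heads_below_tails (strand D s)"
  shows "separated (lift_ends (range Head) D)" "stitch (lift_ends (range Head) D) = D"
proof -
  show "separated (lift_ends (range Head) D)"
    by (auto simp: separated_def lift_ends_def range_HeadTail)
  have "filter (\<lambda>x. x \<in> range Head) (strand D s) @ filter (\<lambda>x. x \<notin> range Head) (strand D s) = strand D s" for s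
  proof -
    obtain ps ts where L: "strand D s = map Head ps @ map Tail ts"
      using assms[of s] by (auto simp: heads_below_tails_def)
    have "filter (\<lambda>x. x \<in> range Head) (map Head ps) = map Head ps" "filter (\<lambda>x. x \<notin> range Head) (map Head ps) = []"
      "filter (\<lambda>x. x \<in> range Head) (map Tail ts) = []" "filter (\<lambda>x. x \<notin> range Head) (map Tail ts) = map Tail ts"
      by (auto simp: filter_id_conv filter_empty_conv)
    then show ?thesis unfolding L filter_append by simp
  qed
  then show "stitch (lift_ends (range Head) D) = D"
    by (cases D) (simp add: stitch_def lift_ends_def)
qed

text \<open>A weight that kills the relators and all stitched separated diagrams kills every sorted
  diagram, since such a diagram is the stitching of its split into heads and tails; so it kills all
  diagrams.\<close>

lemma exists_stitch_representative:
  assumes S: "finite S" and f: "f \<in> free_space S n"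
  shows "\<exists>g\<in>separated_space S S n. f - stitch_lc g \<in> rels S n"
proof -
  let ?B = "{D \<in> diagrams (S <+> S) n. separated D}"
  have "f \<in> lc.span (relators S n \<union> (\<lambda>D. basis (stitch D)) ` ?B)"
    unfolding in_span_iff_pairing
  proof (intro allI impI)
    fix W assume W: "\<forall>a\<in>relators S n \<union> (\<lambda>D. basis (stitch D)) ` ?B. pairing W a = 0"
    have ws: "weight_system S n W" using W by (auto simp: weight_system_def)
    have "W D = 0" if "D \<in> diagrams S n" for D
    proof (rule weight_zero_if_zero_on_sorted[OF S ws _ that])
      fix D assume D: "D \<in> diagrams S n" "\<And>s. heads_below_tails (strand D s)"
      have "lift_ends (range Head) D \<in> ?B"
        using sorted_eq_stitch(1)[OF D(2)] lift_ends_in_diagrams[OF S D(1)] by simp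
      then have "basis (stitch (lift_ends (range Head) D)) \<in> (\<lambda>D. basis (stitch D)) ` ?B" by blast
      then have "pairing W (basis (stitch (lift_ends (range Head) D))) = 0" using W by blast
      then show "W D = 0" using sorted_eq_stitch(2)[OF D(2)] by simp
    qed
    then have "pairing W f = pairing (\<lambda>_. 0) f"
      using f unfolding free_space_def span_basis_iff by (intro pairing_cong) auto
    then show "pairing W f = 0" by (simp add: pairing_def)
  qed
  then obtain a b where ab: "f = a + b" "a \<in> rels S n" "b \<in> lc.span ((\<lambda>D. basis (stitch D)) ` ?B)"
    unfolding lc.span_Un rels_def by blast
  from ab(3) have "\<exists>g\<in>separated_space S S n. b = stitch_lc g"
  proof (induction rule: lc.span_induct_alt)
    case base
    show ?case using lc.span_zero by (intro bexI[of _ 0]) (auto simp: separated_space_def lin_ext_def)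
  next
    case (step c x y)
    then obtain D g where D: "D \<in> ?B" "x = basis (stitch D)" and g: "g \<in> separated_space S S n" "y = stitch_lc g"
      by blast
    have "scale c x + y = stitch_lc (scale c (basis D) + g)"
      unfolding D g by (simp add: lin_ext_add lin_ext_scale)
    moreover have "scale c (basis D) + g \<in> separated_space S S n"
      using g(1) unfolding separated_space_def
      by (intro lc.span_add lc.span_scale lc.span_base[OF imageI[OF D(1)]])
    ultimately show ?case by blast
  qed
  then obtain g where g: "g \<in> separated_space S S n" "b = stitch_lc g" by blast
  then have "f - stitch_lc g = a" using ab(1) by simp
  then show ?thesis using ab(2) g(1) by auto
qed

lemma exists_separated_representative:
  assumes HT: "finite H" "finite T" and f: "f \<in> free_space (H <+> T) n"
  shows "\<exists>g\<in>separated_space H T n. f - g \<in> ht_rels H T n"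
proof -
  let ?B = "{D \<in> diagrams (H <+> T) n. separated D}"
  have "f \<in> lc.span (ht_relators H T n \<union> basis ` ?B)"
    unfolding in_span_iff_pairing
  proof (intro allI impI)
    fix W assume W: "\<forall>a\<in>ht_relators H T n \<union> basis ` ?B. pairing W a = 0"
    have ws: "weight_system (H <+> T) n W" using W by (intro weight_system_ht) auto
    have "W D = 0" if "D \<in> diagrams (H <+> T) n" for D
    proof (rule weight_zero_if_zero_on_sorted[OF _ ws _ that])
      show "finite (H <+> T)" using HT by simp
      fix D assume D: "D \<in> diagrams (H <+> T) n" "\<And>s. heads_below_tails (strand D s)"
      consider "separated D" | "tail_on_head D" | "tail_strand_heads D \<noteq> {}"
        unfolding separated_iff by blast
      then have "basis D \<in> ht_relators H T n \<union> basis ` ?B"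
      proof cases
        case 1
        then show ?thesis using D(1) by simp
      next
        case 2
        then show ?thesis using ht_relators.tail_on_head_strand[OF D(1)] by (auto simp: tail_on_head_def)
      next
        case 3
        then obtain q t where q: "Head q \<in> set (strand D (Inr t))" by (auto simp: tail_strand_heads_def)
        \<comment> \<open>On a sorted strand heads come first, so a head on a tail strand makes the
          lowest end a head, and \<open>CP\<close> applies.\<close>
        obtain ps ts where L: "strand D (Inr t) = map Head ps @ map Tail ts"
          using D(2)[of "Inr t"] by (auto simp: heads_below_tails_def)
        then obtain p ps' where "ps = p # ps'" using q by (cases ps) auto
        then show ?thesis using ht_relators.CP[OF D(1)] L by simp
      qed
      then have "pairing W (basis D) = 0" using W by blast
      then show "W D = 0" by simp
    qed
    then have "pairing W f = pairing (\<lambda>_. 0) f"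
      using f unfolding free_space_def span_basis_iff by (intro pairing_cong) auto
    then show "pairing W f = 0" by (simp add: pairing_def)
  qed
  then show ?thesis unfolding lc.span_Un ht_rels_def separated_space_def by force
qed

text \<open>Both spaces of relations are detected by weights, and on separated combinations a weight
  for the full strands agrees with its extension. This makes \<open>D'\<close> well defined and also
  yields injectivity of \<open>delta\<close>.\<close>

lemma separated_ht_rels:
  assumes HT: "finite H" "finite T" and f: "f \<in> separated_space H T n" "f \<in> ht_rels H T n"
  shows "f \<in> rels (H <+> T) n"
  unfolding rels_iff
proof (intro allI impI)
  fix W assume W: "weight_system (H <+> T) n W"
  then obtain W' where W': "\<forall>r\<in>ht_relators H T n. pairing W' r = 0" "\<forall>D. separated D \<longrightarrow> W' D = W D"
    using separated_weight_extends[OF HT, of n W] by (auto simp: weight_system_def)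
  have "pairing W f = pairing W' f"
    using f(1) W'(2) unfolding separated_space_def span_basis_iff by (intro pairing_cong) auto
  then show "pairing W f = 0" using f(2) W'(1) by (simp add: ht_rels_iff)
qed

section \<open>Operations on cosets\<close>

lemma coset_eq_iff: "coset (lc.span R) f = coset (lc.span R) g \<longleftrightarrow> f - g \<in> lc.span R"
proof
  assume "coset (lc.span R) f = coset (lc.span R) g"
  moreover have "f \<in> coset (lc.span R) f" by (simp add: coset_def lc.span_zero)
  ultimately show "f - g \<in> lc.span R" by (simp add: coset_def)
next
  assume fg: "f - g \<in> lc.span R"
  have "h - f \<in> lc.span R \<longleftrightarrow> h - g \<in> lc.span R" for h
    using lc.span_add[of "h - f" R "f - g"] lc.span_diff[of "h - g" R "f - g"] fg by auto
  then show "coset (lc.span R) f = coset (lc.span R) g" by (simp add: coset_def)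
qed

lemma coset_rels_eq_iff: "coset (rels S n) f = coset (rels S n) g \<longleftrightarrow> f - g \<in> rels S n"
  by (simp add: rels_def coset_eq_iff)

lemma coset_ht_rels_eq_iff: "coset (ht_rels H T n) f = coset (ht_rels H T n) g \<longleftrightarrow> f - g \<in> ht_rels H T n"
  by (simp add: ht_rels_def coset_eq_iff)

lemma UN_coset:
  assumes "\<And>g. g \<in> coset (lc.span R) f \<Longrightarrow> F g = C"
  shows "(\<Union>g\<in>coset (lc.span R) f. F g) = C"
proof -
  have "f \<in> coset (lc.span R) f" by (simp add: coset_def lc.span_zero)
  then show ?thesis using assms by blast
qed

text \<open>Since \<phi> respects differences and maps relations to relations, all representatives
  give the same coset and the union collapses.\<close>

lemma quot_map_coset:
  assumes "x n = coset (lc.span R) f" "R' n = lc.span Q"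
    and "\<And>r. r \<in> lc.span R \<Longrightarrow> \<phi> r \<in> lc.span Q" "\<And>f g. \<phi> (f - g) = \<phi> f - \<phi> g"
  shows "quot_map R' \<phi> x n = coset (R' n) (\<phi> f)"
  unfolding quot_map_def assms(1,2)
proof (rule UN_coset)
  fix g assume "g \<in> coset (lc.span R) f"
  then have "\<phi> (g - f) \<in> lc.span Q" using assms(3) by (simp add: coset_def)
  then show "coset (lc.span Q) (\<phi> g) = coset (lc.span Q) (\<phi> f)" by (simp add: coset_eq_iff assms(4))
qed

lemma quot_add_coset:
  assumes "x n = coset (lc.span R) f" "y n = coset (lc.span R) g" "R' n = lc.span R"
  shows "quot_add R' x y n = coset (R' n) (f + g)"
  unfolding quot_add_def assms
proof (intro UN_coset)
  fix f' g' assume "f' \<in> coset (lc.span R) f" "g' \<in> coset (lc.span R) g"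
  then have "(f' - f) + (g' - g) \<in> lc.span R" unfolding coset_def by (intro lc.span_add) auto
  then show "coset (lc.span R) (f' + g') = coset (lc.span R) (f + g)"
    by (simp add: coset_eq_iff algebra_simps)
qed

lemma quot_scale_coset:
  assumes "x n = coset (lc.span R) f" "R' n = lc.span R"
  shows "quot_scale R' c x n = coset (R' n) (scale c f)"
  unfolding quot_scale_def assms
proof (intro UN_coset)
  fix f' assume "f' \<in> coset (lc.span R) f"
  then have "scale c (f' - f) \<in> lc.span R" unfolding coset_def by (intro lc.span_scale) auto
  then show "coset (lc.span R) (scale c f') = coset (lc.span R) (scale c f)"
    by (simp add: coset_eq_iff lc.scale_right_diff_distrib)
qed

section \<open>The map on classes and its inverse\<close>

lemma delta_coset:
  assumes S: "finite S" and x: "x n = coset (rels S n) f"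
  shows "delta S x n = coset (ht_rels S S n) (double_lc f)"
proof -
  have "double_all S x n = coset (rels (S <+> S) n) (double_lc f)"
    unfolding double_all_def
    by (rule quot_map_coset[where R = "relators S n" and Q = "relators (S <+> S) n"])
      (use x double_rels[OF S, of _ n] in \<open>simp_all add: rels_def lin_ext_diff\<close>)
  then have "ht_proj S S (double_all S x) n = coset (ht_rels S S n) (id (double_lc f))"
    unfolding ht_proj_def
    by (intro quot_map_coset[where R = "relators (S <+> S) n" and Q = "ht_relators S S n"])
      (use rels_subset_ht_rels[of S S n] in \<open>auto simp: rels_def ht_rels_def\<close>)
  then show ?thesis by (simp add: delta_def)
qed

lemma stitch_all_coset:
  assumes S: "finite S" and x: "x n = coset (rels (S <+> S) n) f"
  shows "stitch_all S x n = coset (rels S n) (stitch_lc f)"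
  unfolding stitch_all_def
  by (rule quot_map_coset[where R = "relators (S <+> S) n" and Q = "relators S n"])
    (use x stitch_rels[OF S, of _ n] in \<open>simp_all add: rels_def lin_ext_diff\<close>)

lemma completed_quotientE:
  assumes "x \<in> completed_quotient F R"
  obtains f where "\<And>n. f n \<in> F n" "\<And>n. x n = coset (R n) (f n)"
proof -
  have "\<exists>f. f \<in> F n \<and> x n = coset (R n) f" for n
    using assms by (auto simp: completed_quotient_def)
  then obtain f where "\<forall>n. f n \<in> F n \<and> x n = coset (R n) (f n)" by metis
  then show ?thesis using that by blast
qed

lemma delta_in_Aw_ht:
  assumes S: "finite S" and x: "x \<in> Aw S"
  shows "delta S x \<in> Aw_ht S S"
proof -
  obtain f where f: "\<And>n. f n \<in> free_space S n" "\<And>n. x n = coset (rels S n) (f n)"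
    using completed_quotientE x unfolding Aw_def by metis
  have "delta S x n = coset (ht_rels S S n) (double_lc (f n))" for n
    by (rule delta_coset[OF S f(2)])
  then show ?thesis
    using double_free[OF S f(1)] by (auto simp: Aw_ht_def completed_quotient_def)
qed

text \<open>Modulo relations the difference of representatives is the stitching of a separated
  \<open>h\<close>. Doubling undoes stitching, so \<open>h\<close> dies in \<open>Aw_ht\<close>;
  being separated, it already dies on the full strands, and then so does its stitching.\<close>

lemma inj_on_delta:
  assumes S: "finite S"
  shows "inj_on (delta S) (Aw S)"
proof (rule inj_onI)
  fix x y assume xy: "x \<in> Aw S" "y \<in> Aw S" and eq: "delta S x = delta S y"
  obtain f where f: "\<And>n. f n \<in> free_space S n" "\<And>n. x n = coset (rels S n) (f n)"
    using completed_quotientE xy(1) unfolding Aw_def by metis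
  obtain g where g: "\<And>n. g n \<in> free_space S n" "\<And>n. y n = coset (rels S n) (g n)"
    using completed_quotientE xy(2) unfolding Aw_def by metis
  show "x = y"
  proof
    fix n
    have "double_lc (f n) - double_lc (g n) \<in> ht_rels S S n"
      using arg_cong[OF eq, of "\<lambda>x. x n"] delta_coset[OF S, of x n "f n"] delta_coset[OF S, of y n "g n"] f(2) g(2)
      by (simp add: coset_ht_rels_eq_iff)
    then have d: "double_lc (f n - g n) \<in> ht_rels S S n" by (simp add: lin_ext_diff)
    have "f n - g n \<in> free_space S n" using f(1) g(1) unfolding free_space_def by (rule lc.span_diff)
    then obtain h where h: "h \<in> separated_space S S n" "f n - g n - stitch_lc h \<in> rels S n"
      using exists_stitch_representative[OF S] by blast
    have "double_lc (f n - g n) - double_lc (stitch_lc h) \<in> ht_rels S S n"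
      using double_rels[OF S h(2)] rels_subset_ht_rels by (auto simp: lin_ext_diff)
    \<comment> \<open>The combination telescopes to \<open>h\<close>.\<close>
    from d this double_stitch[OF S h(1)] have "double_lc (f n - g n) - (double_lc (f n - g n) - double_lc (stitch_lc h))
        - (double_lc (stitch_lc h) - h) \<in> ht_rels S S n"
      unfolding ht_rels_def by (rule lc.span_diff[OF lc.span_diff])
    then have "h \<in> ht_rels S S n" by simp
    then have "stitch_lc h \<in> rels S n"
      using separated_ht_rels[OF S S h(1)] stitch_rels[OF S] by blast
    with h(2) have "(f n - g n - stitch_lc h) + stitch_lc h \<in> rels S n"
      unfolding rels_def by (rule lc.span_add)
    then show "x n = y n" by (simp add: f(2) g(2) coset_rels_eq_iff)
  qed
qed

text \<open>One separated representative \<open>g\<close> serves for everything: another one differs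
  from it by a relation of the full strands, which gives uniqueness; stitching it gives a preimage,
  so surjectivity and the formula for the inverse come together.\<close>

lemma separated_form_stitch:
  assumes S: "finite S" and D: "D \<in> Aw_ht S S"
  obtains D' where "D' \<in> Aw (S <+> S)" "\<forall>y. separated_form S S D y \<longleftrightarrow> y = D'"
    "stitch_all S D' \<in> Aw S" "delta S (stitch_all S D') = D"
proof -
  obtain d where d: "\<And>n. d n \<in> free_space (S <+> S) n" "\<And>n. D n = coset (ht_rels S S n) (d n)"
    using completed_quotientE D unfolding Aw_ht_def by metis
  obtain g where g: "\<And>n. g n \<in> separated_space S S n" "\<And>n. d n - g n \<in> ht_rels S S n"
    using exists_separated_representative[OF S S d(1)] by metis
  have Dg: "D n = coset (ht_rels S S n) (g n)" for n
    using d(2) g(2) by (simp add: coset_ht_rels_eq_iff)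
  define D' where "D' = (\<lambda>n. coset (rels (S <+> S) n) (g n))"
  have gf: "g n \<in> free_space (S <+> S) n" for n using g(1) separated_subset_free by blast
  have D'n: "D' n = coset (rels (S <+> S) n) (g n)" for n by (simp add: D'_def)
  show ?thesis
  proof
    show "D' \<in> Aw (S <+> S)" using gf by (auto simp: Aw_def completed_quotient_def D'_def)
    show "\<forall>y. separated_form S S D y \<longleftrightarrow> y = D'"
    proof (intro allI iffI)
      fix y assume "separated_form S S D y"
      then obtain f where f: "\<And>n. f n \<in> D n" "\<And>n. f n \<in> separated_space S S n"
        "\<And>n. y n = coset (rels (S <+> S) n) (f n)"
        unfolding separated_form_def by blast
      have "f n - g n \<in> rels (S <+> S) n" for n
      proof (rule separated_ht_rels[OF S S])
        show "f n - g n \<in> separated_space S S n"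
          using f(2) g(1) unfolding separated_space_def by (rule lc.span_diff)
        show "f n - g n \<in> ht_rels S S n" using f(1)[of n] by (simp add: Dg coset_def)
      qed
      then show "y = D'" by (intro ext) (simp add: f(3) D'_def coset_rels_eq_iff)
    next
      fix y assume "y = D'"
      moreover have "g n \<in> D n" for n by (simp add: Dg coset_def ht_rels_def lc.span_zero)
      ultimately show "separated_form S S D y"
        unfolding separated_form_def using g(1) D'n by blast
    qed
    have st: "stitch_all S D' n = coset (rels S n) (stitch_lc (g n))" for n
      by (rule stitch_all_coset[OF S D'n])
    then show "stitch_all S D' \<in> Aw S"
      using stitch_free[OF S gf] by (auto simp: Aw_def completed_quotient_def)
    show "delta S (stitch_all S D') = D"
    proof
      fix n
      show "delta S (stitch_all S D') n = D n"
        using delta_coset[OF S, of "stitch_all S D'" n, OF st] double_stitch[OF S g(1)[of n]]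
        by (simp add: Dg coset_ht_rels_eq_iff)
    qed
  qed
qed

lemma vector_space_iso_delta:
  assumes S: "finite S"
  shows "vector_space_iso (Aw S) (rels S) (Aw_ht S S) (ht_rels S S) (delta S)"
  unfolding vector_space_iso_def
proof (intro conjI ballI allI)
  have "delta S ` Aw S = Aw_ht S S"
  proof
    show "delta S ` Aw S \<subseteq> Aw_ht S S" using delta_in_Aw_ht[OF S] by blast
    show "Aw_ht S S \<subseteq> delta S ` Aw S"
    proof
      fix D assume "D \<in> Aw_ht S S"
      then obtain D' where "stitch_all S D' \<in> Aw S" "delta S (stitch_all S D') = D"
        using separated_form_stitch[OF S, of D] by blast
      then show "D \<in> delta S ` Aw S" by force
    qed
  qed
  then show "bij_betw (delta S) (Aw S) (Aw_ht S S)"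
    using inj_on_delta[OF S] by (simp add: bij_betw_def)
  fix x assume x: "x \<in> Aw S"
  obtain f where f: "\<And>n. x n = coset (rels S n) (f n)"
    using completed_quotientE x unfolding Aw_def by metis
  have dx: "delta S x n = coset (ht_rels S S n) (double_lc (f n))" for n by (rule delta_coset[OF S f])
  show "delta S (quot_scale (rels S) c x) = quot_scale (ht_rels S S) c (delta S x)" for c
  proof
    fix n
    have "quot_scale (rels S) c x n = coset (rels S n) (scale c (f n))"
      by (rule quot_scale_coset) (simp_all add: f rels_def)
    moreover have "quot_scale (ht_rels S S) c (delta S x) n = coset (ht_rels S S n) (scale c (double_lc (f n)))"
      by (rule quot_scale_coset) (simp_all add: dx ht_rels_def)
    ultimately show "delta S (quot_scale (rels S) c x) n = quot_scale (ht_rels S S) c (delta S x) n"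
      by (simp add: delta_coset[OF S] lin_ext_scale)
  qed
  fix y assume y: "y \<in> Aw S"
  obtain g where g: "\<And>n. y n = coset (rels S n) (g n)"
    using completed_quotientE y unfolding Aw_def by metis
  have dy: "delta S y n = coset (ht_rels S S n) (double_lc (g n))" for n by (rule delta_coset[OF S g])
  show "delta S (quot_add (rels S) x y) = quot_add (ht_rels S S) (delta S x) (delta S y)"
  proof
    fix n
    have "quot_add (rels S) x y n = coset (rels S n) (f n + g n)"
      by (rule quot_add_coset) (simp_all add: f g rels_def)
    moreover have "quot_add (ht_rels S S) (delta S x) (delta S y) n = coset (ht_rels S S n) (double_lc (f n) + double_lc (g n))"
      by (rule quot_add_coset) (simp_all add: dx dy ht_rels_def)
    ultimately show "delta S (quot_add (rels S) x y) n = quot_add (ht_rels S S) (delta S x) (delta S y) n"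
      by (simp add: delta_coset[OF S] lin_ext_add)
  qed
qed

section \<open>Failure of multiplicativity\<close>

lemma not_separated_Head_Tail: "\<not> separated (spliced \<sigma> s xs [Head p, Tail e] ys V)"
proof -
  have "set (strand D s) \<subseteq> range Head \<or> set (strand D s) \<subseteq> range Tail" if "separated D" for D
    using that unfolding separated_def by (cases s) simp_all
  from this[of "spliced \<sigma> s xs [Head p, Tail e] ys V"] show ?thesis by auto
qed

lemma rename_rename: "rename f (rename g D) = rename (f \<circ> g) D"
proof -
  have "map_prod f (map_prod f f) (map_prod g (map_prod g g) v) = map_prod (f \<circ> g) (map_prod (f \<circ> g) (f \<circ> g)) v" for v
    by (cases v) simp
  then show ?thesis by (simp add: rename_def arrow_end.map_comp comp_def image_image)
qed

lemma rename_in_closed_iff: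
  assumes closed: "\<And>D f. D \<in> P \<Longrightarrow> rename f D \<in> P" and f: "inj_on f (edges D)"
  shows "rename f D \<in> P \<longleftrightarrow> D \<in> P"
proof
  assume "rename f D \<in> P"
  then have "rename (inv_into (edges D) f) (rename f D) \<in> P" by (rule closed)
  moreover have "rename (inv_into (edges D) f) (rename f D) = D"
    unfolding rename_rename by (rule rename_id_on) (simp add: f)
  ultimately show "D \<in> P" by simp
qed (rule closed)

text \<open>Heads on the head strand 1, tails on the tail strands 0 and 1.\<close>

definition fork :: "nat arrow_end list \<Rightarrow> nat arrow_end list \<Rightarrow> nat arrow_end list \<Rightarrow> (nat \<times> nat \<times> nat) set \<Rightarrow>
    (nat + nat) diagram" where
  "fork h t0 t1 V = Diagram ((\<lambda>_. [])(Inl 1 := h, Inr 0 := t0, Inr 1 := t1)) V"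

lemma eq_fork_iff:
  "Diagram \<sigma> V = fork h t0 t1 V' \<longleftrightarrow> \<sigma> (Inl 1) = h \<and> \<sigma> (Inr 0) = t0 \<and> \<sigma> (Inr 1) = t1 \<and>
    (\<forall>r. r \<noteq> Inl 1 \<longrightarrow> r \<noteq> Inr 0 \<longrightarrow> r \<noteq> Inr 1 \<longrightarrow> \<sigma> r = []) \<and> V = V'"
  unfolding fork_def by (auto simp: fun_eq_iff)

lemma rename_fork:
  "rename f (fork h t0 t1 V) =
    fork (map (map_arrow_end f) h) (map (map_arrow_end f) t0) (map (map_arrow_end f) t1) (map_prod f (map_prod f f) ` V)"
  unfolding fork_def rename_def by (auto simp: fun_eq_iff)

definition two_arrows :: "(nat + nat) diagram set" where
  "two_arrows = {fork [Head p, Head q] [Tail p] [Tail q] {} | p q. True}"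

definition trees :: "(nat + nat) diagram set" where
  "trees = {fork [Head m] [Tail p] [Tail q] {(p, q, m)} | p q m. True}"

definition flipped_trees :: "(nat + nat) diagram set" where
  "flipped_trees = {fork [Head m] [Tail p] [Tail q] {(q, p, m)} | p q m. True}"

text \<open>The values on pairs of arrows are forced by \<open>STU1\<close> from those on trees, up to symmetrisation.\<close>

definition tree_weight :: "(nat + nat) diagram \<Rightarrow> rat" where
  "tree_weight D = of_bool (D \<in> two_arrows) + of_bool (D \<in> trees) - of_bool (D \<in> flipped_trees)"

text \<open>An arrow to head strand 1 from tail strand 0 or, for \<open>j\<close> other than 0, from
  tail strand 1. A member of \<open>one_arrow 0\<close> below one of \<open>one_arrow 1\<close>
  stacks to a member of \<open>two_arrows\<close>.\<close>

definition one_arrow :: "nat \<Rightarrow> (nat + nat) diagram set" where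
  "one_arrow j = {fork [Head p] (if j = 0 then [Tail p] else []) (if j = 0 then [] else [Tail p]) {} | p. True}"

lemmas pattern_defs = two_arrows_def trees_def flipped_trees_def one_arrow_def

lemma patterns_closed:
  "D \<in> two_arrows \<Longrightarrow> rename f D \<in> two_arrows" "D \<in> trees \<Longrightarrow> rename f D \<in> trees"
  "D \<in> flipped_trees \<Longrightarrow> rename f D \<in> flipped_trees" "D \<in> one_arrow j \<Longrightarrow> rename f D \<in> one_arrow j"
  unfolding pattern_defs by (auto simp: rename_fork) blast+

lemma not_pattern_two:
  assumes "x \<noteq> y" "\<not> (\<exists>p q. x = Head p \<and> y = Head q)"
  shows "spliced \<sigma> s xs [x, y] ys V \<notin> two_arrows"
    "spliced \<sigma> s xs [x, y] ys V \<notin> trees" "spliced \<sigma> s xs [x, y] ys V \<notin> flipped_trees"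
  using assms unfolding pattern_defs
  by (auto simp: eq_fork_iff append_eq_Cons_conv split: if_splits)

lemma not_one_arrow_two: "spliced \<sigma> s xs [x, y] ys V \<notin> one_arrow j"
  unfolding pattern_defs by (auto simp: eq_fork_iff append_eq_Cons_conv split: if_splits)

lemma not_trees_two_heads:
  "spliced \<sigma> s xs [Head p, Head q] ys V \<notin> trees" "spliced \<sigma> s xs [Head p, Head q] ys V \<notin> flipped_trees"
  unfolding pattern_defs by (auto simp: eq_fork_iff append_eq_Cons_conv split: if_splits)

lemma two_arrows_iff:
  "spliced \<sigma> s xs [Head p, Head q] ys V \<in> two_arrows \<longleftrightarrow>
    s = Inl 1 \<and> xs = [] \<and> ys = [] \<and> V = {} \<and> \<sigma> (Inr 0) = [Tail p] \<and> \<sigma> (Inr 1) = [Tail q] \<and>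
    (\<forall>r. r \<noteq> Inl 1 \<longrightarrow> r \<noteq> Inr 0 \<longrightarrow> r \<noteq> Inr 1 \<longrightarrow> \<sigma> r = [])"
  unfolding pattern_defs by (auto simp: eq_fork_iff append_eq_Cons_conv split: if_splits)

lemma trees_iff:
  assumes "(p, q, m) \<notin> V"
  shows "spliced \<sigma> s xs [Head m] ys (insert (p, q, m) V) \<in> trees \<longleftrightarrow>
    s = Inl 1 \<and> xs = [] \<and> ys = [] \<and> V = {} \<and> \<sigma> (Inr 0) = [Tail p] \<and> \<sigma> (Inr 1) = [Tail q] \<and>
    (\<forall>r. r \<noteq> Inl 1 \<longrightarrow> r \<noteq> Inr 0 \<longrightarrow> r \<noteq> Inr 1 \<longrightarrow> \<sigma> r = [])" (is ?t)
    and "spliced \<sigma> s xs [Head m] ys (insert (p, q, m) V) \<in> flipped_trees \<longleftrightarrow>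
    s = Inl 1 \<and> xs = [] \<and> ys = [] \<and> V = {} \<and> \<sigma> (Inr 0) = [Tail q] \<and> \<sigma> (Inr 1) = [Tail p] \<and>
    (\<forall>r. r \<noteq> Inl 1 \<longrightarrow> r \<noteq> Inr 0 \<longrightarrow> r \<noteq> Inr 1 \<longrightarrow> \<sigma> r = [])" (is ?f)
proof -
  have V: "insert (p, q, m) V = {v} \<longleftrightarrow> V = {} \<and> v = (p, q, m)" for v using assms by auto
  show ?t unfolding pattern_defs using assms
    by (auto simp: eq_fork_iff V append_eq_Cons_conv split: if_splits)
  show ?f unfolding pattern_defs using assms
    by (auto simp: eq_fork_iff V append_eq_Cons_conv split: if_splits)
qed

lemma nonempty_trivs: "V \<noteq> {} \<Longrightarrow> Diagram \<sigma> V \<notin> two_arrows" "V \<noteq> {} \<Longrightarrow> Diagram \<sigma> V \<notin> one_arrow j"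
  unfolding pattern_defs by (auto simp: eq_fork_iff)

lemma triv_inputs_distinct: "D \<in> diagrams S n \<Longrightarrow> (p, q, u) \<in> trivs D \<Longrightarrow> p \<noteq> q"
  by (auto simp: diagrams_def arrow_diagram_def)

lemma not_trees_two_trivs:
  assumes "v \<in> V" "v' \<in> V" "v \<noteq> v'"
  shows "Diagram \<sigma> V \<notin> trees" "Diagram \<sigma> V \<notin> flipped_trees"
  using assms unfolding pattern_defs by (auto simp: eq_fork_iff)

lemma flip_not_in:
  assumes "Diagram \<sigma> (insert (p, q, u) V) \<in> diagrams S n" "Diagram \<sigma> (insert (q, p, u) V) \<in> diagrams S n"
  shows "(p, q, u) \<notin> V"
proof
  assume "(p, q, u) \<in> V"
  then have "(p, q, u) = (q, p, u)"
    using out_edge_inj[OF assms(2)] by (auto simp: inj_on_def out_edge_def)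
  then show False using triv_inputs_distinct[OF assms(1), of p q u] by simp
qed

text \<open>The patterns have at most one vertex and at most one tail on each strand, so
  \<open>IHX\<close> and \<open>TC\<close> hold with all terms 0. \<open>AS\<close> exchanges
  \<open>trees\<close> and \<open>flipped_trees\<close>, \<open>STU1\<close> compares the order of
  two heads with a tree, and \<open>STU2\<close> never consists of separated diagrams.\<close>

lemma tree_weight_extends:
  assumes "finite H" "finite T"
  shows "\<exists>W'. (\<forall>r\<in>ht_relators H T n. pairing W' r = 0) \<and> (\<forall>D. separated D \<longrightarrow> W' D = tree_weight D)"
proof (rule separated_weight_extends[OF assms], rule pairing_relator_zero)
  show "tree_weight (rename f D) = tree_weight D" if "inj_on f (edges D)" for D f
    using rename_in_closed_iff[OF patterns_closed(1) that] rename_in_closed_iff[OF patterns_closed(2) that]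
      rename_in_closed_iff[OF patterns_closed(3) that] by (simp add: tree_weight_def)
next
  fix \<sigma> p q u V
  assume a: "Diagram \<sigma> (insert (p, q, u) V) \<in> diagrams (H <+> T) n" "Diagram \<sigma> (insert (q, p, u) V) \<in> diagrams (H <+> T) n"
  have V: "insert (p, q, u) V = {v} \<longleftrightarrow> V = {} \<and> v = (p, q, u)" "insert (q, p, u) V = {v} \<longleftrightarrow> V = {} \<and> v = (q, p, u)" for v
    using flip_not_in[OF a] flip_not_in[OF a(2,1)] by auto
  have "Diagram \<sigma> (insert (p, q, u) V) \<in> trees \<longleftrightarrow> Diagram \<sigma> (insert (q, p, u) V) \<in> flipped_trees"
    "Diagram \<sigma> (insert (p, q, u) V) \<in> flipped_trees \<longleftrightarrow> Diagram \<sigma> (insert (q, p, u) V) \<in> trees"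
    unfolding pattern_defs mem_Collect_eq eq_fork_iff V prod.inject by blast+
  then show "tree_weight (Diagram \<sigma> (insert (p, q, u) V)) + tree_weight (Diagram \<sigma> (insert (q, p, u) V)) = 0"
    by (simp add: tree_weight_def nonempty_trivs)
next
  fix \<sigma> :: "nat + nat \<Rightarrow> nat arrow_end list" and p q m r u V
  let ?D1 = "Diagram \<sigma> ({(p, q, m), (m, r, u)} \<union> V)" and ?D2 = "Diagram \<sigma> ({(q, r, m), (m, p, u)} \<union> V)"
    and ?D3 = "Diagram \<sigma> ({(r, p, m), (m, q, u)} \<union> V)"
  assume a: "?D1 \<in> diagrams (H <+> T) n" "?D2 \<in> diagrams (H <+> T) n" "?D3 \<in> diagrams (H <+> T) n"
  have ne: "p \<noteq> q" "q \<noteq> r" "r \<noteq> p"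
    using triv_inputs_distinct[OF a(1), of p q m] triv_inputs_distinct[OF a(2), of q r m]
      triv_inputs_distinct[OF a(3), of r p m] by auto
  have z: "tree_weight (Diagram \<sigma> U) = 0" if "v \<in> U" "v' \<in> U" "v \<noteq> v'" for U v v'
    using not_trees_two_trivs[OF that, of \<sigma>] nonempty_trivs(1)[of U \<sigma>] that by (auto simp: tree_weight_def)
  have "tree_weight ?D1 = 0" by (rule z[of "(p, q, m)" _ "(m, r, u)"]) (use ne in auto)
  moreover have "tree_weight ?D2 = 0" by (rule z[of "(q, r, m)" _ "(m, p, u)"]) (use ne in auto)
  moreover have "tree_weight ?D3 = 0" by (rule z[of "(r, p, m)" _ "(m, q, u)"]) (use ne in auto)
  ultimately show "tree_weight ?D1 + tree_weight ?D2 + tree_weight ?D3 = 0" by simp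
next
  fix \<sigma> s xs p q ys V m
  assume a: "spliced \<sigma> s xs [Head p, Head q] ys V \<in> diagrams (H <+> T) n"
    "spliced \<sigma> s xs [Head q, Head p] ys V \<in> diagrams (H <+> T) n"
    "spliced \<sigma> s xs [Head m] ys (insert (p, q, m) V) \<in> diagrams (H <+> T) n"
  have v: "(p, q, m) \<notin> V"
    using STU1_fresh[OF a(1,3)] edge_of_triv(3)[of p q m "spliced \<sigma> s xs [Head p, Head q] ys V"] by auto
  show "tree_weight (spliced \<sigma> s xs [Head p, Head q] ys V)
      - tree_weight (spliced \<sigma> s xs [Head q, Head p] ys V)
      - tree_weight (spliced \<sigma> s xs [Head m] ys (insert (p, q, m) V)) = 0"
    unfolding tree_weight_def
    using two_arrows_iff[of \<sigma> s xs p q ys V] two_arrows_iff[of \<sigma> s xs q p ys V] trees_iff[OF v, of \<sigma> s xs ys]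
      not_trees_two_heads[of \<sigma> s xs p q ys V] not_trees_two_heads[of \<sigma> s xs q p ys V]
      nonempty_trivs(1)[of "insert (p, q, m) V" "\<sigma>(s := xs @ [Head m] @ ys)"]
    by simp
next
  fix \<sigma> s xs d e ys V
  assume "spliced \<sigma> s xs [Tail d, Tail e] ys V \<in> diagrams (H <+> T) n"
  from distinct_strand[OF this, of s] have "d \<noteq> e" by auto
  then show "tree_weight (spliced \<sigma> s xs [Tail d, Tail e] ys V) =
      tree_weight (spliced \<sigma> s xs [Tail e, Tail d] ys V)"
    using not_pattern_two[of "Tail d" "Tail e" \<sigma> s xs ys V] not_pattern_two[of "Tail e" "Tail d" \<sigma> s xs ys V]
    by (simp add: tree_weight_def)
next
  fix r and \<sigma> :: "nat + nat \<Rightarrow> nat arrow_end list" and s xs p e ys V m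
  assume "\<And>D. D \<in> Poly_Mapping.keys r \<Longrightarrow> separated D"
    "spliced \<sigma> s xs [Head p, Tail e] ys V \<in> Poly_Mapping.keys r"
  then have False using not_separated_Head_Tail[of \<sigma> s xs p e ys V] by blast
  then show "tree_weight (spliced \<sigma> s xs [Head p, Tail e] ys V)
      - tree_weight (spliced \<sigma> s xs [Tail e, Head p] ys V)
      - tree_weight (spliced \<sigma> s xs [Tail m] ys (insert (m, p, e) V)) = 0" ..
qed

text \<open>These diagrams have no vertex and at most one end on each strand, so apart from renaming
  every relation holds with all terms 0.\<close>

lemma one_arrow_weight_extends:
  assumes "finite H" "finite T"
  shows "\<exists>W'. (\<forall>r\<in>ht_relators H T n. pairing W' r = 0) \<and> (\<forall>D. separated D \<longrightarrow> W' D = of_bool (D \<in> one_arrow j))"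
proof (rule separated_weight_extends[OF assms], rule pairing_relator_zero)
  show "(of_bool (rename f D \<in> one_arrow j) :: rat) = of_bool (D \<in> one_arrow j)" if "inj_on f (edges D)" for D f
    using rename_in_closed_iff[OF patterns_closed(4) that] by simp
qed (use not_one_arrow_two nonempty_trivs(2) in simp_all)

section \<open>Stacks of diagrams of degree one\<close>

lemma arrow_diagram_no_trivs:
  assumes "trivs D = {}" "\<And>s. s \<notin> S \<Longrightarrow> strand D s = []" "\<And>s. distinct (strand D s)"
    and "\<And>s s'. s \<noteq> s' \<Longrightarrow> set (strand D s) \<inter> set (strand D s') = {}" "heads D = tails D"
  shows "arrow_diagram S D"
proof -
  have e: "edges D = tails D" using assms by (simp add: edges_def)
  show ?thesis unfolding arrow_diagram_def e using assms by auto
qed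

lemma strand_stack:
  "strand (stack D1 D2) s =
    map (map_arrow_end (\<lambda>e. 2 * e)) (strand D1 s) @ map (map_arrow_end (\<lambda>e. 2 * e + 1)) (strand D2 s)"
  and trivs_stack:
  "trivs (stack D1 D2) = map_prod (\<lambda>e. 2 * e) (map_prod (\<lambda>e. 2 * e) (\<lambda>e. 2 * e)) ` trivs D1 \<union>
    map_prod (\<lambda>e. 2 * e + 1) (map_prod (\<lambda>e. 2 * e + 1) (\<lambda>e. 2 * e + 1)) ` trivs D2"
  by (simp_all add: stack_def Let_def trivs_rename)

lemma separated_stack: "separated D1 \<Longrightarrow> separated D2 \<Longrightarrow> separated (stack D1 D2)"
  unfolding separated_iff tail_on_head_def tail_strand_heads_def strand_stack
  by (auto simp: in_map_arrow_end_image)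

lemma unique_tail_degree_1:
  assumes "finite S" "D \<in> diagrams S 1" "Tail e \<in> set (strand D s)" "Tail e' \<in> set (strand D s')"
  shows "s = s'"
proof -
  have "card (tails D) = 1" using assms(1,2) by (simp add: diagrams_iff)
  moreover have "e \<in> tails D" "e' \<in> tails D" using assms(3,4) by (auto simp: tails_def ends_def)
  ultimately have "e = e'" by (metis card_1_singletonE singletonD)
  then show ?thesis using disjoint_strands[OF assms(2,3)] assms(4) by simp
qed

lemma map_arrow_end_eq_iff:
  "map_arrow_end f x = Tail a \<longleftrightarrow> (\<exists>p. x = Tail p \<and> a = f p)" "map_arrow_end f x = Head a \<longleftrightarrow> (\<exists>p. x = Head p \<and> a = f p)"
  by (cases x; auto)+

lemma stacked_eq_single:
  assumes "map (map_arrow_end f) K @ map (map_arrow_end g) L = [Tail a]"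
  obtains p where "a = f p" "K = [Tail p]" "L = []" | p where "a = g p" "K = []" "L = [Tail p]"
  using assms that by (auto simp: append_eq_Cons_conv map_arrow_end_eq_iff map_eq_Cons_conv)

text \<open>In a stack the even edges come from \<open>D1\<close> and the odd ones from
  \<open>D2\<close>. A tree has tails on two strands joined at a vertex, hence of equal parity, but
  a factor of degree 1 has a single tail. A pair of arrows must take one from each factor, and the
  order of the heads decides which.\<close>

lemma tree_weight_stack:
  assumes S: "finite S" and D: "D1 \<in> diagrams S 1" "D2 \<in> diagrams S 1"
  shows "tree_weight (stack D1 D2) = of_bool (D1 \<in> one_arrow 0) * of_bool (D2 \<in> one_arrow 1)"
proof -
  let ?S = "stack D1 D2"
  have sel: "strand ?S = (\<lambda>s. map (map_arrow_end (\<lambda>e. 2 * e)) (strand D1 s) @ map (map_arrow_end (\<lambda>e. 2 * e + 1)) (strand D2 s))"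
    by (rule ext) (rule strand_stack)
  \<comment> \<open>The two tails cannot stem from one factor. If \<open>D1\<close> supplies the
    tail on strand 1 instead of the one on strand 0, only the parities are recorded.\<close>
  have ends: "(\<exists>k l. a = 2 * k \<and> b = 2 * l + 1 \<and> strand D1 (Inr 0) = [Tail k] \<and> strand D2 (Inr 0) = [] \<and>
        strand D1 (Inr 1) = [] \<and> strand D2 (Inr 1) = [Tail l]) \<or> (odd a \<and> even b)"
    if ab: "strand ?S (Inr 0) = [Tail a]" "strand ?S (Inr 1) = [Tail b]" for a b
    using ab(1) unfolding sel
  proof (cases rule: stacked_eq_single)
    case (1 k)
    from ab(2) show ?thesis unfolding sel
    proof (cases rule: stacked_eq_single)
      case (1 l)
      then show ?thesis using unique_tail_degree_1[OF S D(1), of k "Inr 0" l "Inr 1"] \<open>strand D1 (Inr 0) = [Tail k]\<close> by simp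
    next
      case (2 l)
      then show ?thesis using 1 by auto
    qed
  next
    case (2 k)
    from ab(2) show ?thesis unfolding sel
    proof (cases rule: stacked_eq_single)
      case (1 l)
      then show ?thesis using 2 by auto
    next
      case (2 l)
      then show ?thesis using unique_tail_degree_1[OF S D(2), of k "Inr 0" l "Inr 1"] \<open>strand D2 (Inr 0) = [Tail k]\<close> by simp
    qed
  qed
  have parity: "even l = even r" if "(l, r, u) \<in> trivs ?S" for l r u
    using that unfolding trivs_stack by auto
  have noB: "?S \<notin> trees" "?S \<notin> flipped_trees"
  proof -
    have False if "strand ?S (Inr 0) = [Tail p]" "strand ?S (Inr 1) = [Tail q]" "(p, q, m) \<in> trivs ?S \<or> (q, p, m) \<in> trivs ?S" for p q m
      using ends[OF that(1,2)] parity that(3) by fastforce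
    moreover have "strand ?S (Inr 0) = [Tail p] \<and> strand ?S (Inr 1) = [Tail q] \<and> trivs ?S = V"
      if "?S = fork h [Tail p] [Tail q] V" for h p q V
      using that by (simp add: fork_def)
    ultimately show "?S \<notin> trees" "?S \<notin> flipped_trees" unfolding pattern_defs by blast+
  qed
  have "?S \<in> two_arrows \<longleftrightarrow> D1 \<in> one_arrow 0 \<and> D2 \<in> one_arrow 1"
  proof
    assume "?S \<in> two_arrows"
    then obtain a b where "Diagram (strand ?S) (trivs ?S) = fork [Head a, Head b] [Tail a] [Tail b] {}"
      unfolding pattern_defs by auto
    then have s: "strand ?S (Inl 1) = [Head a, Head b]" "strand ?S (Inr 0) = [Tail a]" "strand ?S (Inr 1) = [Tail b]"
      "\<And>r. r \<noteq> Inl 1 \<Longrightarrow> r \<noteq> Inr 0 \<Longrightarrow> r \<noteq> Inr 1 \<Longrightarrow> strand ?S r = []" "trivs ?S = {}"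
      unfolding eq_fork_iff by blast+
    let ?K = "strand D1 (Inl 1)" and ?L = "strand D2 (Inl 1)"
    have KL: "(\<exists>x y. ?K = [Head x, Head y] \<and> ?L = [] \<and> a = 2 * x \<and> b = 2 * y) \<or>
        (\<exists>x y. ?K = [Head x] \<and> ?L = [Head y] \<and> a = 2 * x \<and> b = 2 * y + 1) \<or>
        (\<exists>x y. ?K = [] \<and> ?L = [Head x, Head y] \<and> a = 2 * x + 1 \<and> b = 2 * y + 1)"
      using s(1) unfolding strand_stack
      by (auto simp: append_eq_Cons_conv map_eq_Cons_conv map_arrow_end_eq_iff)
    \<comment> \<open>Otherwise the lower head would come from the upper factor.\<close>
    then have "\<not> (odd a \<and> even b)" by auto
    then obtain k l where kl: "a = 2 * k" "b = 2 * l + 1" "strand D1 (Inr 0) = [Tail k]" "strand D2 (Inr 0) = []"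
      "strand D1 (Inr 1) = []" "strand D2 (Inr 1) = [Tail l]"
      using ends[OF s(2,3)] by blast
    have h: "?K = [Head k]" "?L = [Head l]" using KL kl(1,2) by auto presburger+
    have r: "strand D1 r = []" "strand D2 r = []" if "r \<noteq> Inl 1" "r \<noteq> Inr 0" "r \<noteq> Inr 1" for r
      using s(4)[OF that] by (simp_all add: strand_stack)
    have t: "trivs D1 = {}" "trivs D2 = {}" using s(5) by (simp_all add: trivs_stack)
    have "Diagram (strand D1) (trivs D1) = fork [Head k] [Tail k] [] {}"
      "Diagram (strand D2) (trivs D2) = fork [Head l] [] [Tail l] {}"
      unfolding eq_fork_iff using kl h r t by simp_all
    then show "D1 \<in> one_arrow 0 \<and> D2 \<in> one_arrow 1" unfolding one_arrow_def by auto
  next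
    assume "D1 \<in> one_arrow 0 \<and> D2 \<in> one_arrow 1"
    then obtain k l where D1: "D1 = fork [Head k] [Tail k] [] {}" and D2: "D2 = fork [Head l] [] [Tail l] {}"
      unfolding one_arrow_def by auto
    have "Diagram (strand ?S) (trivs ?S) = fork [Head (2 * k), Head (2 * l + 1)] [Tail (2 * k)] [Tail (2 * l + 1)] {}"
      unfolding eq_fork_iff strand_stack trivs_stack by (simp add: D1 D2 fork_def)
    then show "?S \<in> two_arrows" unfolding two_arrows_def by auto
  qed
  then show ?thesis using noB by (simp add: tree_weight_def)
qed

text \<open>The empty diagram is the only one of degree 0, so the only relator is the trivial one
  from \<open>iso\<close> and every function is a weight system. This forces the degree 0 parts of
  separated representatives of the two arrows to vanish.\<close>

lemma rels_degree_0:
  assumes "finite S" "f \<in> rels S 0"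
  shows "f = 0"
proof -
  have empty: "strand D s = [] \<and> trivs D = {}" if "D \<in> diagrams S 0" for D s
  proof -
    have "degree S D = 0" "finite (trivs D)"
      using that by (simp_all add: diagrams_def arrow_diagram_def)
    then have "(\<Sum>s\<in>S. length (strand D s)) + card (trivs D) = 0" "finite (trivs D)"
      by (simp_all del: of_nat_add of_nat_sum add: degree_def)
    then show ?thesis using assms(1) strand_outside[OF that, of s] by (cases "s \<in> S") auto
  qed
  have "weight_system S 0 W" for W
    unfolding weight_system_def
proof (rule ballI, rule pairing_relator_zero)
    show "W (rename f D) = W D" if "D \<in> diagrams S 0" for D f
    proof -
      have "D = Diagram (\<lambda>_. []) {}" by (rule diagram.expand) (use empty[OF that] in auto)
      then show ?thesis by (simp add: rename_def)
    qed
  qed (auto dest!: empty[where s = s for s] split: if_splits)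
  then have "pairing W f = pairing W 0" for W using assms(2) by (simp add: rels_iff)
  then show ?thesis using lc_eq_iff_pairing by blast
qed

definition single_arrow :: "'l \<Rightarrow> 'l \<Rightarrow> 'l diagram" where
  "single_arrow a b = Diagram ((\<lambda>_. [])(a := [Tail 0], b := [Head 0])) {}"

lemma single_arrow_in_diagrams:
  assumes "finite S" "a \<in> S" "b \<in> S" "a \<noteq> b"
  shows "single_arrow a b \<in> diagrams S 1"
proof -
  have e: "ends (single_arrow a b) = {Tail 0, Head 0}"
    using assms(4) by (auto simp: ends_def single_arrow_def split: if_splits)
  have "arrow_diagram S (single_arrow a b)"
  proof (rule arrow_diagram_no_trivs)
    show "heads (single_arrow a b) = tails (single_arrow a b)" by (auto simp: heads_def tails_def e)
  qed (use assms in \<open>auto simp: single_arrow_def\<close>)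
  moreover have "tails (single_arrow a b) = {0}" by (auto simp: tails_def e)
  ultimately show ?thesis using assms(1) by (simp add: diagrams_iff)
qed

lemma lin_ext_0 [simp]: "lin_ext \<phi> 0 = 0"
  by (simp add: lc_eq_iff_pairing)

lemma lin_stack_0 [simp]: "lin_stack 0 g = 0" "lin_stack f 0 = 0"
  by (simp_all add: lin_stack_def lc_eq_iff_pairing) (simp add: pairing_def)

lemma lin_stack_basis [simp]: "lin_stack (basis D) (basis D') = basis (stack D D')"
  by (simp add: lin_stack_def)

definition concentrated :: "'l set \<Rightarrow> 'l diagram \<Rightarrow> nat \<Rightarrow> ('l diagram \<Rightarrow>\<^sub>0 rat) set" where
  "concentrated S D n = coset (rels S n) (if n = 1 then basis D else 0)"

lemma concentrated_in_Aw: "D \<in> diagrams S 1 \<Longrightarrow> concentrated S D \<in> Aw S"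
  unfolding Aw_def completed_quotient_def concentrated_def free_space_def
  by (auto intro!: imageI lc.span_base lc.span_zero)

text \<open>Products and images are unions over representatives; the representatives with a part
  only in degree 1 provide a concrete member. Multiplicativity would place it in a product of
  separated representatives.\<close>

lemma delta_stack_mem:
  "double_lc (basis (stack D D')) \<in> delta S (Aw_mult S (concentrated S D) (concentrated S D')) 2"
proof -
  let ?f = "\<lambda>D (n :: nat). if n = 1 then basis D else 0"
  have mem: "g \<in> coset (rels S' n) g" "h \<in> coset (ht_rels S S n) h" for g S' n h
    by (simp_all add: coset_def rels_def ht_rels_def lc.span_zero)
  have sum: "(\<Sum>i\<le>2. lin_stack (?f D i) (?f D' (2 - i))) = basis (stack D D')"
    by (simp add: numeral_2_eq_2)
  have "coset (rels S 2) (basis (stack D D')) \<in> {coset (rels S 2) (\<Sum>i\<le>2. lin_stack (f i) (g (2 - i))) |f g.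
      (\<forall>i. f i \<in> concentrated S D i) \<and> (\<forall>i. g i \<in> concentrated S D' i)}"
  proof (rule CollectI, rule exI[of _ "?f D"], rule exI[of _ "?f D'"], intro conjI allI)
    show "coset (rels S 2) (basis (stack D D')) = coset (rels S 2) (\<Sum>i\<le>2. lin_stack (?f D i) (?f D' (2 - i)))"
      by (simp only: sum)
  qed (simp_all only: concentrated_def mem(1))
  then have "basis (stack D D') \<in> Aw_mult S (concentrated S D) (concentrated S D') 2"
    unfolding Aw_mult_def using mem(1) by blast
  then have "double_lc (basis (stack D D')) \<in> double_all S (Aw_mult S (concentrated S D) (concentrated S D')) 2"
    unfolding double_all_def quot_map_def using mem(1) by blast
  then show ?thesis
    unfolding delta_def ht_proj_def quot_map_def[of "ht_rels S S"] comp_apply id_apply using mem(2) by blast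
qed

text \<open>Both sides are evaluated by a weight extending \<open>tree_weight\<close>. On the image
  of the product it is -1, by \<open>STU2\<close>; on the product of the images it is 0, because the
  value factors over separated representatives and the image of the second arrow has its head on
  strand 0, where no pattern has one.\<close>

lemma not_delta_multiplicative: "\<not> delta_multiplicative {0, 1 :: nat}"
proof
  let ?S = "{0, 1 :: nat}"
  let ?x = "single_arrow 0 1 :: nat diagram" and ?y = "single_arrow 1 0 :: nat diagram"
  assume mult: "delta_multiplicative ?S"
  have S: "finite ?S" by simp
  have x: "?x \<in> diagrams ?S 1" and y: "?y \<in> diagrams ?S 1" by (rule single_arrow_in_diagrams; simp)+
  obtain W where W: "\<forall>r\<in>ht_relators ?S ?S 2. pairing W r = 0" "\<forall>D. separated D \<longrightarrow> W D = tree_weight D"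
    using tree_weight_extends[OF S S] by blast
  \<comment> \<open>\<open>U\<close> evaluates the second factor; since it respects all relations,
    its value does not depend on the representative \<open>g 1\<close>.\<close>
  obtain U where U: "\<forall>r\<in>ht_relators ?S ?S 1. pairing U r = 0" "\<forall>D. separated D \<longrightarrow> U D = of_bool (D \<in> one_arrow 1)"
    using one_arrow_weight_extends[OF S S] by blast
  have "double_lc (basis (stack ?x ?y)) \<in>
      Aw_ht_mult ?S ?S (delta ?S (concentrated ?S ?x)) (delta ?S (concentrated ?S ?y)) 2"
    using delta_stack_mem[of ?x ?y ?S] mult concentrated_in_Aw[OF x] concentrated_in_Aw[OF y]
    unfolding delta_multiplicative_def by simp
  then obtain f g where fg: "double_lc (basis (stack ?x ?y)) - (\<Sum>i\<le>2. lin_stack (f i) (g (2 - i))) \<in> ht_rels ?S ?S 2"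
    and f: "\<And>i. f i \<in> delta ?S (concentrated ?S ?x) i" "\<And>i. f i \<in> separated_space ?S ?S i"
    and g: "\<And>i. g i \<in> delta ?S (concentrated ?S ?y) i" "\<And>i. g i \<in> separated_space ?S ?S i"
    unfolding Aw_ht_mult_def coset_def by blast
  have d: "delta ?S (concentrated ?S D) n = coset (ht_rels ?S ?S n) (double_lc (if n = 1 then basis D else 0))" for D n
    by (rule delta_coset[OF S]) (simp add: concentrated_def)
  \<comment> \<open>Of the terms of degree 2 only the one of bidegree (1, 1) remains: the degree 0
    parts are separated relations, hence zero.\<close>
  have "f 0 \<in> ht_rels ?S ?S 0" "g 0 \<in> ht_rels ?S ?S 0"
    using f(1)[of 0] g(1)[of 0] unfolding d by (simp_all add: coset_def)
  from separated_ht_rels[OF S S f(2) this(1)] separated_ht_rels[OF S S g(2) this(2)]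
  have "f 0 = 0" "g 0 = 0" by (simp_all add: rels_degree_0[of "?S <+> ?S"])
  then have sum: "(\<Sum>i\<le>2. lin_stack (f i) (g (2 - i))) = lin_stack (f 1) (g 1)"
    by (simp add: numeral_2_eq_2)
  have fs: "separated D1 \<and> D1 \<in> diagrams (?S <+> ?S) 1" if "D1 \<in> Poly_Mapping.keys (f 1)" for D1
    using f(2)[of 1] that unfolding separated_space_def span_basis_iff by blast
  have gs: "separated D2 \<and> D2 \<in> diagrams (?S <+> ?S) 1" if "D2 \<in> Poly_Mapping.keys (g 1)" for D2
    using g(2)[of 1] that unfolding separated_space_def span_basis_iff by blast
  have "pairing W (lin_stack (f 1) (g 1)) = pairing (\<lambda>D1. pairing (\<lambda>D2. W (stack D1 D2)) (g 1)) (f 1)"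
    by (simp add: lin_stack_def)
  \<comment> \<open>On separated diagrams of degree 1 the weight of a stack is a product, so
    \<open>pairing U (g 1)\<close> splits off.\<close>
  also have "\<dots> = pairing (\<lambda>D1. of_bool (D1 \<in> one_arrow 0) * pairing U (g 1)) (f 1)"
  proof (rule pairing_cong)
    fix D1 assume D1: "D1 \<in> Poly_Mapping.keys (f 1)"
    have "pairing (\<lambda>D2. W (stack D1 D2)) (g 1) = pairing (\<lambda>D2. of_bool (D1 \<in> one_arrow 0) * U D2) (g 1)"
    proof (rule pairing_cong)
      fix D2 assume D2: "D2 \<in> Poly_Mapping.keys (g 1)"
      show "W (stack D1 D2) = of_bool (D1 \<in> one_arrow 0) * U D2"
        using fs[OF D1] gs[OF D2] W(2) U(2) separated_stack[of D1 D2] tree_weight_stack[of "?S <+> ?S" D1 D2] S by simp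
    qed
    then show "pairing (\<lambda>D2. W (stack D1 D2)) (g 1) = of_bool (D1 \<in> one_arrow 0) * pairing U (g 1)"
      by (simp add: pairing_def sum_distrib_left mult.left_commute)
  qed
  also have "pairing U (g 1) = 0"
  proof -
    let ?Y = "lift_ends (range Head) ?y"
    have sorted: "heads_below_tails (strand ?y s)" for s
    proof -
      have "strand ?y s = map Head (if s = 0 then [0] else []) @ map Tail (if s = 1 then [0] else [])"
        by (simp add: single_arrow_def)
      then show ?thesis unfolding heads_below_tails_def by blast
    qed
    have "g 1 - double_lc (basis ?y) \<in> ht_rels ?S ?S 1" using g(1)[of 1] unfolding d by (simp add: coset_def)
    then have "pairing U (g 1 - double_lc (basis ?y)) = 0" using U(1) by (simp add: ht_rels_iff)
    then have "pairing U (g 1) = double_weight U ?y" unfolding pairing_diff pairing_double by simp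
    also have "\<dots> = U ?Y"
      using double_weight_stitch[OF S U(1) lift_ends_in_diagrams[OF S y] sorted_eq_stitch(1)[OF sorted]]
        sorted_eq_stitch(2)[OF sorted] by simp
    also have "\<dots> = of_bool (?Y \<in> one_arrow 1)" using U(2) sorted_eq_stitch(1)[OF sorted] by blast
    finally have U: "pairing U (g 1) = of_bool (?Y \<in> one_arrow 1)" .
    have "?Y \<notin> one_arrow 1"
    proof -
      have "strand ?Y (Inl 0) = [Head 0]" by (simp add: lift_ends_def single_arrow_def)
      moreover have "strand D (Inl 0) = []" if "D \<in> one_arrow 1" for D
        using that unfolding one_arrow_def fork_def by auto
      ultimately show ?thesis by auto
    qed
    then show ?thesis using U by simp
  qed
  finally have rhs: "pairing W (lin_stack (f 1) (g 1)) = 0" by (simp add: pairing_def)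
  have "pairing W (double_lc (basis (stack ?x ?y)) - lin_stack (f 1) (g 1)) = 0"
    using fg W(1) unfolding sum ht_rels_iff by blast
  then have lhs: "double_weight W (stack ?x ?y) = 0"
    using rhs unfolding pairing_diff pairing_double by simp
  have ws: "weight_system ?S 2 (double_weight W)"
    using weight_system_double[OF S weight_system_ht[OF W(1)]] .
  \<comment> \<open>Stacking names the first arrow 0 and the second 1; 2 is the new edge of
    \<open>STU2\<close>, applied on strand 0 to the tail of the first and the head of the
    second.\<close>
  let ?\<sigma> = "(\<lambda>_. [])(1 := [Head 0, Tail 1]) :: nat \<Rightarrow> nat arrow_end list"
  let ?D1 = "spliced ?\<sigma> 0 [] [Head 1, Tail 0] [] {}" and ?D2 = "spliced ?\<sigma> 0 [] [Tail 0, Head 1] [] {}"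
    and ?D3 = "spliced ?\<sigma> 0 [] [Tail 2] [] (insert (2, 1, 0) {})"
  have st: "stack ?x ?y = ?D2"
    by (rule diagram.expand) (auto simp: strand_stack trivs_stack single_arrow_def fun_eq_iff)
  have e: "ends ?D2 = {Tail 0, Head 1, Head 0, Tail 1}"
    by (auto simp: ends_def split: if_splits)
  have d2: "?D2 \<in> diagrams ?S 2"
  proof -
    have "tails ?D2 = {0, 1}" "heads ?D2 = {0, 1}" unfolding tails_def heads_def e by auto
    moreover have "arrow_diagram ?S ?D2"
      by (rule arrow_diagram_no_trivs) (use calculation in auto)
    ultimately show ?thesis using S by (simp add: diagrams_iff)
  qed
  have d1: "?D1 \<in> diagrams ?S 2" by (rule permute_in_diagrams[OF S d2]) auto
  have "(2 :: nat) \<notin> edges ?D2" unfolding edges_def tails_def heads_def e by simp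
  then have "attach 2 1 0 ?D2 \<in> diagrams ?S 2" using e by (intro attach_in_diagrams[OF S d2]) auto
  moreover have "attach 2 1 0 ?D2 = ?D3" by (rule attach_local[OF d2 refl]) simp
  ultimately have d3: "?D3 \<in> diagrams ?S 2" by simp
  have dw: "double_weight W D = tree_weight (lift_ends (range Head) D)"
    if "D \<in> diagrams ?S 2" "\<And>s. heads_below_tails (strand D s)" for D
    using double_weight_stitch[OF S W(1) lift_ends_in_diagrams[OF S that(1)] sorted_eq_stitch(1)[OF that(2)]]
      sorted_eq_stitch[OF that(2)] W(2) by simp
  have "heads_below_tails (strand ?D1 s)" for s
  proof -
    have "strand ?D1 s = map Head (if s = 0 then [1] else if s = 1 then [0] else []) @
        map Tail (if s = 0 then [0] else if s = 1 then [1] else [])" by simp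
    then show ?thesis unfolding heads_below_tails_def by blast
  qed
  then have 1: "double_weight W ?D1 = tree_weight (lift_ends (range Head) ?D1)" by (rule dw[OF d1])
  \<comment> \<open>With the head below the tail the diagram is sorted and keeps a head on head
    strand 0, while the patterns have heads on head strand 1 only.\<close>
  have 0: "tree_weight D = 0" if "strand D (Inl 0) = [Head 1]" for D
  proof -
    have "D \<notin> two_arrows" "D \<notin> trees" "D \<notin> flipped_trees"
      using that unfolding pattern_defs fork_def by auto
    then show ?thesis by (simp add: tree_weight_def)
  qed
  have 1: "double_weight W ?D1 = 0" unfolding 1 by (rule 0) (auto simp: lift_ends_def)
  have "heads_below_tails (strand ?D3 s)" for s
  proof -
    have "strand ?D3 s = map Head (if s = 1 then [0] else []) @
        map Tail (if s = 0 then [2] else if s = 1 then [1] else [])" by simp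
    then show ?thesis unfolding heads_below_tails_def by blast
  qed
  then have 3: "double_weight W ?D3 = tree_weight (lift_ends (range Head) ?D3)" by (rule dw[OF d3])
  have F: "lift_ends (range Head) ?D3 = fork [Head 0] [Tail 2] [Tail 1] {(2, 1, 0)}"
    unfolding lift_Diagram eq_fork_iff by (auto split: sum.splits)
  have "tree_weight (fork [Head 0] [Tail 2] [Tail 1] {(2, 1, 0)}) = 1"
  proof -
    have "fork [Head 0] [Tail 2] [Tail 1] {(2, 1, 0)} \<in> trees" unfolding trees_def by blast
    moreover have "fork [Head 0] [Tail 2] [Tail 1] {(2, 1, 0)} \<notin> two_arrows"
      "fork [Head 0] [Tail 2] [Tail 1] {(2, 1, 0)} \<notin> flipped_trees"
      unfolding pattern_defs by (auto simp: fork_def fun_eq_iff split: if_splits)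
    ultimately show ?thesis by (simp add: tree_weight_def)
  qed
  then have "double_weight W ?D3 = 1" unfolding 3 F .
  then have "double_weight W ?D2 = -1"
    using weight_systemD(5)[OF ws d1 d2 d3] 1 by simp
  then show False using lhs st by simp
qed

theorem proposition2p23:
  fixes S :: "'a set"
  assumes "finite S"
  shows "vector_space_iso (Aw S) (rels S) (Aw_ht S S) (ht_rels S S) (delta S) \<and>
    (\<forall>D\<in>Aw_ht S S. \<exists>D'\<in>Aw (S <+> S).
       (\<forall>y. separated_form S S D y \<longleftrightarrow> y = D') \<and>
       inv_into (Aw S) (delta S) D = stitch_all S D') \<and>
    \<not> (\<forall>S' :: nat set. finite S' \<longrightarrow> delta_multiplicative S')"
proof (intro conjI ballI)
  show "vector_space_iso (Aw S) (rels S) (Aw_ht S S) (ht_rels S S) (delta S)"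
    by (rule vector_space_iso_delta[OF assms])
  show "\<not> (\<forall>S' :: nat set. finite S' \<longrightarrow> delta_multiplicative S')"
  proof
    assume "\<forall>S' :: nat set. finite S' \<longrightarrow> delta_multiplicative S'"
    then have "finite {0, 1 :: nat} \<longrightarrow> delta_multiplicative {0, 1 :: nat}" by (rule spec)
    then show False using not_delta_multiplicative by simp
  qed
  fix D assume D: "D \<in> Aw_ht S S"
  obtain D' where D': "D' \<in> Aw (S <+> S)" "\<forall>y. separated_form S S D y \<longleftrightarrow> y = D'"
    "stitch_all S D' \<in> Aw S" "delta S (stitch_all S D') = D"
    by (rule separated_form_stitch[OF assms D])
  have "inv_into (Aw S) (delta S) D = stitch_all S D'"
    using inv_into_f_f[OF inj_on_delta[OF assms] D'(3)] unfolding D'(4) .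
  then show "\<exists>D'\<in>Aw (S <+> S). (\<forall>y. separated_form S S D y \<longleftrightarrow> y = D') \<and>
      inv_into (Aw S) (delta S) D = stitch_all S D'"
    using D'(1,2) by blast
qed

end
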